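(* The sets $\mathcal B_4$ and $\mathcal D_4$ are equal. Moreover, let $\mu_1,\dots,\mu_{23}\in\mathbb R^{(2^{\{1,2,3,4\}})}$ be the distinct nullity types of the matrices obtained by column permutations of the following seven matrices: $$\begin{bmatrix}1&1&1&1\end{bmatrix},\quad \begin{bmatrix}0&1&1&1\end{bmatrix},\quad \begin{bmatrix}0&0&1&1\end{bmatrix},\quad \begin{bmatrix}1&0&1&0\\0&1&1&0\\0&0&0&1\end{bmatrix},\quad \begin{bmatrix}1&0&0&1\\0&1&0&1\\0&0&1&1\end{bmatrix},$$ $$\begin{bmatrix}1&0&1&1\\0&1&1&1\end{bmatrix},\quad \begin{bmatrix}1&1&1&1\\0&1&2&3\end{bmatrix}.$$ Then a homogeneous ratio $\frac{\alpha}{\beta}\in\mathcal H_4$ is bounded if and only if $\log(\frac{\alpha}{\beta})^T\mu_i\ge 0$ for all $i=1,\dots,23$.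
   Context: Let $n=4$ and $N=\{1,2,3,4\}$. Matrices are complex; positive definite (PD) matrices are Hermitian. For an $n\times n$ matrix $A$ and $S\subseteq N$, $A[S]$ is the principal submatrix in rows and columns $S$, with $\det A[\emptyset]=1$. Given finitely many index sets $\alpha_1,\dots,\alpha_p\subseteq N$ and exponents $\eta_1,\dots,\eta_p>0$ put $\alpha(A)=\prod_{i=1}^p(\det A[\alpha_i])^{\eta_i}$. A ratio $\frac{\alpha}{\beta}$ is the function $A\mapsto \alpha(A)/\beta(A)$ on $n\times n$ PD matrices, for two such products $\alpha,\beta$. It is bounded if it has an upper bound independent of the PD matrix $A$; $\mathcal B_n$ is the set of bounded ratios. The formal logarithm $\log(\frac{\alpha}{\beta})\in\mathbb R^{(2^N)}$ is the vector indexed by the subsets of $N$ whose entry at a nonempty $S$ is the total exponent of $S$ in $\alpha$ minus that in $\beta$, and whose entry at $\emptyset$ is chosen so that all entries sum to $0$. Ratios are identified when they have the same formal logarithm. A ratio is homogeneous if $\alpha(D)/\beta(D)=1$ for every PD diagonal matrix $D$; $\mathcal H_n$ is the set of homogeneous ratios. For a matrix $M$ with $n$ columns, its nullity type $\operatorname{nul}(M)\in\mathbb R^{(2^N)}$ is the vector whose entry at $T\subseteq N$ is the dimension of the null space of the submatrix of $M$ formed by the columns in $T$ (entry $0$ for $T=\emptyset$). $\mathcal D_n$ is the set of homogeneous ratios $\frac{\alpha}{\beta}$ such that $\log(\frac{\alpha}{\beta})^T\nu\ge 0$ for every nullity type $\nu$ of a matrix with $n$ columns. *)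

theory Defs
  imports
    Complex_Main
    "HOL-Combinatorics.Permutations"
    "Jordan_Normal_Form.Schur_Decomposition"
    "Jordan_Normal_Form.Matrix_Kernel"
    "Jordan_Normal_Form.DL_Submatrix"
begin

(* Rows and columns are numbered from 0 as in the matrix library, so the usual index set
   {1, ..., n} is rendered as {..<n}. *)

definition pos_def :: "nat \<Rightarrow> complex mat \<Rightarrow> bool" where
  "pos_def n A \<longleftrightarrow> A \<in> carrier_mat n n \<and> mat_adjoint A = A \<and>
     (\<forall>v \<in> carrier_vec n. v \<noteq> 0\<^sub>v n \<longrightarrow> Re ((A *\<^sub>v v) \<bullet>c v) > 0)"

(* The determinant of a Hermitian matrix is real, so taking the real part only changes the type.
   For S = {} the submatrix is 0 by 0 and its determinant is 1. *)
definition pminor :: "complex mat \<Rightarrow> nat set \<Rightarrow> real" where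
  "pminor A S = Re (det (submatrix A S S))"

(* The list [(a1, e1), ..., (ap, ep)] stands for the product of the pminor A ai powr ei. *)
type_synonym minor_prod = "(nat set \<times> real) list"

definition minor_prods :: "nat \<Rightarrow> minor_prod set" where
  "minor_prods n = {\<alpha>. \<forall>(S, e) \<in> set \<alpha>. S \<subseteq> {..<n} \<and> e > 0}"

definition prod_val :: "minor_prod \<Rightarrow> complex mat \<Rightarrow> real" where
  "prod_val \<alpha> A = (\<Prod>(S, e) \<leftarrow> \<alpha>. pminor A S powr e)"

definition total_exp :: "minor_prod \<Rightarrow> nat set \<Rightarrow> real" where
  "total_exp \<alpha> S = (\<Sum>(T, e) \<leftarrow> \<alpha>. if T = S then e else 0)"

(* A ratio is given by a representing pair (numerator, denominator).  Pairs with the same formal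
   logarithm define the same function on positive definite matrices, so the sets of ratios below
   consist of all representatives of their members. *)
type_synonym ratio = "minor_prod \<times> minor_prod"

definition ratios :: "nat \<Rightarrow> ratio set" where
  "ratios n = minor_prods n \<times> minor_prods n"

definition ratio_val :: "ratio \<Rightarrow> complex mat \<Rightarrow> real" where
  "ratio_val r A = prod_val (fst r) A / prod_val (snd r) A"

definition bounded_ratio :: "nat \<Rightarrow> ratio \<Rightarrow> bool" where
  "bounded_ratio n r \<longleftrightarrow> (\<exists>C. \<forall>A. pos_def n A \<longrightarrow> ratio_val r A \<le> C)"

definition bounded_ratios :: "nat \<Rightarrow> ratio set" where
  "bounded_ratios n = {r \<in> ratios n. bounded_ratio n r}"

definition homogeneous_ratios :: "nat \<Rightarrow> ratio set" where
  "homogeneous_ratios n =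
     {r \<in> ratios n. \<forall>D. pos_def n D \<and> diagonal_mat D \<longrightarrow> ratio_val r D = 1}"

(* Such a vector is a function on sets that vanishes outside Pow {..<n}, so that equality of
   functions is equality of vectors. *)
type_synonym set_vec = "nat set \<Rightarrow> real"

definition set_inner :: "nat \<Rightarrow> set_vec \<Rightarrow> set_vec \<Rightarrow> real" where
  "set_inner n x y = (\<Sum>S \<in> Pow {..<n}. x S * y S)"

definition log_entry :: "ratio \<Rightarrow> nat set \<Rightarrow> real" where
  "log_entry r S = total_exp (fst r) S - total_exp (snd r) S"

definition formal_log :: "nat \<Rightarrow> ratio \<Rightarrow> set_vec" where
  "formal_log n r = (\<lambda>S.
     if S = {} then - (\<Sum>T \<in> Pow {..<n} - {{}}. log_entry r T)
     else if S \<subseteq> {..<n} then log_entry r S else 0)"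

definition nullity_type :: "complex mat \<Rightarrow> set_vec" where
  "nullity_type M = (\<lambda>T.
     if T \<noteq> {} \<and> T \<subseteq> {..<dim_col M} then real (kernel_dim (submatrix M UNIV T)) else 0)"

definition D_ratios :: "nat \<Rightarrow> ratio set" where
  "D_ratios n = {r \<in> homogeneous_ratios n.
     \<forall>M. dim_col M = n \<longrightarrow> set_inner n (formal_log n r) (nullity_type M) \<ge> 0}"

definition permute_cols :: "(nat \<Rightarrow> nat) \<Rightarrow> 'a mat \<Rightarrow> 'a mat" where
  "permute_cols p M = mat (dim_row M) (dim_col M) (\<lambda>(i, j). M $$ (i, p j))"

definition base_mats4 :: "complex mat set" where
  "base_mats4 = mat_of_rows_list 4 ` {
     [[1, 1, 1, 1]],
     [[0, 1, 1, 1]],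
     [[0, 0, 1, 1]],
     [[1, 0, 1, 0],
      [0, 1, 1, 0],
      [0, 0, 0, 1]],
     [[1, 0, 0, 1],
      [0, 1, 0, 1],
      [0, 0, 1, 1]],
     [[1, 0, 1, 1],
      [0, 1, 1, 1]],
     [[1, 1, 1, 1],
      [0, 1, 2, 3]]}"

definition nullity_types4 :: "set_vec set" where
  "nullity_types4 = {nullity_type (permute_cols p M) | p M. M \<in> base_mats4 \<and> p permutes {..<4}}"

end

theory Submission
  imports Defs
    "Jordan_Normal_Form.Jordan_Normal_Form_Uniqueness"
    "Jordan_Normal_Form.Jordan_Normal_Form_Existence"
    "Jordan_Normal_Form.Matrix_IArray_Impl"
begin

text \<open>
  Write \<open>x\<close> for the formal logarithm of a ratio and \<open>L\<close> for the vector of the logarithms of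
  the principal minors of a positive definite matrix \<open>A\<close>. The logarithm of the ratio at \<open>A\<close>
  is the inner product of \<open>x\<close> and \<open>L\<close>, so boundedness says that this inner product is
  bounded above uniformly in \<open>A\<close>.

  Boundedness implies the inequalities, for every \<open>n\<close>. Rescaling one index by a positive number changes
  the logarithm of the ratio linearly, which forces homogeneity (\<open>bounded_imp_homogeneous\<close>). For a matrix
  \<open>M\<close> with \<open>n\<close> columns take \<open>A = M\<^sup>* M + t I\<close> with \<open>t\<close>
  tending to \<open>0\<close> from the right. The minor of \<open>A\<close> on \<open>S\<close> is a polynomial in
  \<open>t\<close> which vanishes at \<open>0\<close> exactly to the order of the nullity of the columns
  \<open>S\<close> of \<open>M\<close>, since a Hermitian matrix has equal algebraic and geometric multiplicities.
  Hence the logarithm of the ratio, divided by \<open>ln t\<close>, tends to the inner product of \<open>x\<close>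
  with the nullity type of \<open>M\<close>, and an upper bound makes this limit nonnegative
  (\<open>bounded_imp_nullity_nonneg\<close>).

  For the converse let \<open>n = 4\<close>. The homogeneous exponent vectors that satisfy the 23 inequalities form a
  polyhedral cone. In the coordinates \<open>v Q\<close>, the sum of \<open>x S\<close> over the subsets
  \<open>S\<close> of \<open>Q\<close>, homogeneity says that \<open>v Q = 0\<close> whenever \<open>Q\<close> has at
  least three elements. So \<open>v\<close> consists of one number \<open>w\<close> for the empty set, four numbers
  \<open>z\<close> at the vertices and six numbers \<open>e\<close> on the edges of the complete graph on the four
  indices, and the 23 inequalities read: all of these are nonnegative; each \<open>z\<close> is at most the sum of
  \<open>e\<close> over the edges at that vertex; the sum of all \<open>z\<close> is at most \<open>w\<close> plus the
  sum of all \<open>e\<close>; \<open>w\<close> is at most the sum of \<open>z\<close> at the ends of an edge and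
  \<open>e\<close> on the opposite edge; and \<open>2 w\<close> is at most the sum of all \<open>z\<close>.

  This cone is generated by eight orbits of vectors under permutation of the indices (\<open>generators_at\<close>).
  Three of them are Koteljanskii ratios and one is the Ingleton ratio. The other four are supported on stars of the
  graph; they are needed because a nullity type comes from a single vector for each index, and these test vectors cut
  out a larger cone than the one generated by the Koteljanskii and Ingleton ratios. Generation is proved without a
  triangulation: every nonzero face of the cone contains one of these vectors
  (\<open>every_face_has_generator\<close>), hence a positive multiple can be subtracted until one more inequality
  becomes tight, and this process ends at \<open>0\<close> (\<open>peeling\<close>).

  It remains to bound the eight generators. Writing \<open>a S\<close> for the minor on \<open>S\<close>, the quotient
  of \<open>a S\<close> and \<open>a (S - {i})\<close> is the minimum of the quadratic form of \<open>A\<close> over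
  the vectors supported on \<open>S\<close> with \<open>i\<close>-th coordinate \<open>1\<close>. This gives the
  Koteljanskii inequality, and also the estimate \<open>a {i} * a (S - {i}) \<le> C * (\<Sum>j\<in>S - {i}. a {j} * a
  (S - {j}))\<close> (\<open>complementary_product_bound\<close>), a substitute for the triangle inequality between
  angles. With these two facts the Ingleton ratio and two star ratios are bounded by products of inequalities, and the
  other two star ratios arise from them by passing to the inverse matrix, whose principal minors are the complementary
  minors of \<open>A\<close> divided by its determinant.
\<close>

section \<open>Principal minors as determinants of masked matrices\<close>

text \<open>
  Replacing the rows outside \<open>S\<close> by unit rows keeps every matrix of size \<open>n\<close> while its
  determinant is still the principal minor on \<open>S\<close>. Minors for different \<open>S\<close> can then be
  compared without renumbering indices.
\<close>

definition row_mask :: "nat set \<Rightarrow> 'a::comm_ring_1 mat \<Rightarrow> 'a mat" where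
  "row_mask S A = mat (dim_row A) (dim_col A)
     (\<lambda>(i, j). if i \<in> S then A $$ (i, j) else if i = j then 1 else 0)"

lemma row_mask_carrier [simp]: "A \<in> carrier_mat n n \<Longrightarrow> row_mask S A \<in> carrier_mat n n"
  by (auto simp: row_mask_def)

lemma row_mask_dim [simp]:
  "dim_row (row_mask S A) = dim_row A" "dim_col (row_mask S A) = dim_col A"
  by (simp_all add: row_mask_def)

lemma row_mask_index:
  "A \<in> carrier_mat n n \<Longrightarrow> i < n \<Longrightarrow> j < n \<Longrightarrow>
     row_mask S A $$ (i, j) = (if i \<in> S then A $$ (i, j) else if i = j then 1 else 0)"
  by (auto simp: row_mask_def)

text \<open>
  A permutation that moves an index outside \<open>S\<close> picks a zero entry of a unit row, so only the
  permutations of \<open>S\<close> contribute.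
\<close>

lemma det_row_mask_Leibniz:
  fixes A :: "'a::comm_ring_1 mat"
  assumes A: "A \<in> carrier_mat n n" and S: "S \<subseteq> {..<n}"
  shows "det (row_mask S A) = (\<Sum>p | p permutes S. signof p * (\<Prod>i\<in>S. A $$ (i, p i)))"
proof -
  let ?B = "row_mask S A"
  let ?t = "\<lambda>p. signof p * (\<Prod>i = 0..<n. ?B $$ (i, p i))"
  have fin: "finite {p. p permutes {0..<n}}"
    by (rule finite_permutations) simp
  have "det ?B = (\<Sum>p | p permutes {0..<n}. ?t p)"
    using A by (simp add: det_def' [of _ n])
  also have "\<dots> = (\<Sum>p | p permutes S. ?t p)"
  proof (rule sum.mono_neutral_right [OF fin])
    show "{p. p permutes S} \<subseteq> {p. p permutes {0..<n}}"
      using S permutes_subset by (metis Collect_mono atLeast0LessThan)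
    show "\<forall>p\<in>{p. p permutes {0..<n}} - {p. p permutes S}. ?t p = 0"
    proof
      fix p assume "p \<in> {p. p permutes {0..<n}} - {p. p permutes S}"
      then have p: "p permutes {0..<n}" and np: "\<not> p permutes S" by auto
      then obtain i where i: "i \<notin> S" "p i \<noteq> i"
        using permutes_superset [OF p, of S] by blast
      then have "i < n" using p by (meson atLeastLessThan_iff permutes_not_in zero_le)
      moreover from this have "p i < n" using p by (metis atLeast0LessThan lessThan_iff permutes_in_image)
      ultimately have "?B $$ (i, p i) = 0" using i A by (simp add: row_mask_index [OF A])
      then have "(\<Prod>i = 0..<n. ?B $$ (i, p i)) = 0"
        using \<open>i < n\<close> by (intro prod_zero) auto
      then show "?t p = 0" by simp
    qed
  qed
  also have "\<dots> = (\<Sum>p | p permutes S. signof p * (\<Prod>i\<in>S. A $$ (i, p i)))"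
  proof (intro sum.cong refl arg_cong2 [where f = "(*)"])
    fix p assume "p \<in> {p. p permutes S}"
    then have p: "p permutes S" by simp
    have pn: "p i < n" if "i < n" for i
      using that S p by (metis lessThan_iff permutes_in_image permutes_not_in subsetD)
    have "(\<Prod>i = 0..<n. ?B $$ (i, p i)) = (\<Prod>i\<in>S. ?B $$ (i, p i))"
      using S p pn by (intro prod.mono_neutral_right)
        (auto simp: row_mask_index [OF A] permutes_not_in)
    also have "\<dots> = (\<Prod>i\<in>S. A $$ (i, p i))"
      using S pn by (intro prod.cong) (auto simp: row_mask_index [OF A])
    finally show "(\<Prod>i = 0..<n. ?B $$ (i, p i)) = (\<Prod>i\<in>S. A $$ (i, p i))" .
  qed
  finally show ?thesis .
qed

lemma bij_betw_pick:
  assumes "finite S"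
  shows "bij_betw (pick S) {..<card S} S"
proof -
  have inj: "inj_on (pick S) {..<card S}"
    by (rule linorder_inj_onI) (auto dest: pick_mono [OF disjI1])
  moreover have "pick S ` {..<card S} \<subseteq> S" by (auto intro: pick_in_set)
  ultimately have "pick S ` {..<card S} = S"
    using card_image [OF inj] assms by (intro card_subset_eq) auto
  then show ?thesis using inj by (simp add: bij_betw_def)
qed

text \<open>
  The increasing enumeration of \<open>S\<close> transports the Leibniz sum of the submatrix to the sum over the
  permutations of \<open>S\<close>; signs are preserved because conjugation by a bijection preserves transpositions.
\<close>

lemma det_row_mask_submatrix:
  fixes A :: "'a::comm_ring_1 mat"
  assumes A: "A \<in> carrier_mat n n" and S: "S \<subseteq> {..<n}"
  shows "det (row_mask S A) = det (submatrix A S S)"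
proof -
  let ?k = "card S" and ?f = "pick S"
  have finS: "finite S" using S finite_subset by blast
  have eq: "{i. i < n \<and> i \<in> S} = S" using S by auto
  have sub: "submatrix A S S = mat ?k ?k (\<lambda>(i, j). A $$ (?f i, ?f j))"
    using A by (simp add: submatrix_def eq)
  have bij: "bij_betw ?f {0..<?k} S"
    using bij_betw_pick [OF finS] by (simp add: lessThan_atLeast0)
  then have inj: "inj_on ?f {0..<?k}" and img: "?f ` {0..<?k} = S" by (simp_all add: bij_betw_def)
  have "map_permutation {0..<?k} ?f
      = (\<lambda>p x. if x \<in> S then ?f (p (inv_into {0..<?k} ?f x)) else x)"
    by (intro ext) (simp add: map_permutation_def restrict_id_def img)
  then have bijp: "bij_betw (map_permutation {0..<?k} ?f) {p. p permutes {0..<?k}} {p. p permutes S}"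
    using bij_betw_permutations [OF bij] by simp
  have "det (submatrix A S S)
      = (\<Sum>q | q permutes {0..<?k}. signof q * (\<Prod>i = 0..<?k. A $$ (?f i, ?f (q i))))"
    unfolding sub
    by (subst det_def' [of _ ?k])
       (auto intro!: sum.cong arg_cong2 [where f = "(*)"] prod.cong simp: permutes_in_image)
  also have "\<dots> = (\<Sum>q | q permutes {0..<?k}. signof (map_permutation {0..<?k} ?f q)
                    * (\<Prod>i\<in>S. A $$ (i, map_permutation {0..<?k} ?f q i)))"
  proof (intro sum.cong refl arg_cong2 [where f = "(*)"])
    fix q assume "q \<in> {q. q permutes {0..<?k}}"
    then have q: "q permutes {0..<?k}" by simp
    show "signof q = (signof (map_permutation {0..<?k} ?f q) :: 'a)"
      by (simp add: sign_map_permutation [OF inj q])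
    have "(\<Prod>i\<in>S. A $$ (i, map_permutation {0..<?k} ?f q i))
        = (\<Prod>i = 0..<?k. A $$ (?f i, map_permutation {0..<?k} ?f q (?f i)))"
      by (rule prod.reindex_bij_betw [OF bij, symmetric])
    also have "\<dots> = (\<Prod>i = 0..<?k. A $$ (?f i, ?f (q i)))"
      by (intro prod.cong refl) (simp add: map_permutation_apply [OF inj])
    finally show "(\<Prod>i = 0..<?k. A $$ (?f i, ?f (q i)))
        = (\<Prod>i\<in>S. A $$ (i, map_permutation {0..<?k} ?f q i))" ..
  qed
  also have "\<dots> = (\<Sum>p | p permutes S. signof p * (\<Prod>i\<in>S. A $$ (i, p i)))"
    using sum.reindex_bij_betw [OF bijp, of "\<lambda>p. signof p * (\<Prod>i\<in>S. A $$ (i, p i))"] by simp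
  finally show ?thesis by (simp add: det_row_mask_Leibniz [OF A S])
qed

lemma pminor_eq_row_mask:
  "A \<in> carrier_mat n n \<Longrightarrow> S \<subseteq> {..<n} \<Longrightarrow> pminor A S = Re (det (row_mask S A))"
  by (simp add: pminor_def det_row_mask_submatrix)

text \<open>
  The vector consists of the cofactors along row \<open>i\<close> of the masked matrix, that is, a column of its
  adjugate. The unit rows make it vanish outside \<open>S\<close>, and its \<open>i\<close>-th entry is the next
  smaller minor because deleting row and column \<open>i\<close> has the same effect on both masks.
\<close>

lemma cofactor_vector:
  fixes A :: "'a::comm_ring_1 mat"
  assumes A: "A \<in> carrier_mat n n" and S: "S \<subseteq> {..<n}" and i: "i \<in> S"
  obtains w where "\<And>j. j \<notin> S \<Longrightarrow> w j = 0" and "w i = det (row_mask (S - {i}) A)"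
    and "\<And>r. r \<in> S \<Longrightarrow> (\<Sum>j<n. A $$ (r, j) * w j) = (if r = i then det (row_mask S A) else 0)"
proof -
  let ?B = "row_mask S A" and ?C = "row_mask (S - {i}) A"
  define w where "w j = (if j < n then cofactor ?B i j else 0)" for j
  have B: "?B \<in> carrier_mat n n" and C: "?C \<in> carrier_mat n n" using A by auto
  have iN: "i < n" using S i by auto
  have row: "(\<Sum>j<n. ?B $$ (r, j) * w j) = (if r = i then det ?B else 0)" if r: "r < n" for r
  proof -
    have "(?B * adj_mat ?B) $$ (r, i) = (\<Sum>j<n. ?B $$ (r, j) * w j)"
      using A B r iN adj_mat(1) [OF B]
      by (auto simp: scalar_prod_def adj_mat_def w_def lessThan_atLeast0 intro!: sum.cong)
    moreover have "(?B * adj_mat ?B) $$ (r, i) = (if r = i then det ?B else 0)"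
      unfolding adj_mat(2) [OF B] using r iN by simp
    ultimately show ?thesis by simp
  qed
  show ?thesis
  proof
    show "w j = 0" if "j \<notin> S" for j
    proof (cases "j < n")
      case True
      have "(\<Sum>k<n. ?B $$ (j, k) * w k) = (\<Sum>k<n. if k = j then w k else 0)"
        using True that by (intro sum.cong) (auto simp: row_mask_index [OF A])
      also have "\<dots> = w j" using True by simp
      finally show ?thesis using row [OF True] that i by (metis (full_types))
    qed (simp add: w_def)
    have "det ?C = (\<Sum>j<n. ?C $$ (i, j) * cofactor ?C i j)"
      by (rule laplace_expansion_row [OF C iN])
    also have "\<dots> = (\<Sum>j<n. if j = i then cofactor ?C i j else 0)"
      using iN by (intro sum.cong) (auto simp: row_mask_index [OF A])
    also have "\<dots> = cofactor ?C i i" using iN by simp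
    also have "mat_delete ?C i i = mat_delete ?B i i"
      using A by (intro eq_matI) (auto simp: mat_delete_def row_mask_def)
    then have "cofactor ?C i i = cofactor ?B i i" by (simp add: cofactor_def)
    finally show "w i = det ?C" using iN by (simp add: w_def)
    show "(\<Sum>j<n. A $$ (r, j) * w j) = (if r = i then det ?B else 0)" if "r \<in> S" for r
    proof -
      have "r < n" using S that by auto
      then show ?thesis using row [of r] that by (simp add: row_mask_index [OF A])
    qed
  qed
qed

text \<open>
  Vectors are functions on all natural numbers here, so that support conditions and finite sums of vectors need no
  dimension bookkeeping.
\<close>

definition qform :: "complex mat \<Rightarrow> (nat \<Rightarrow> complex) \<Rightarrow> (nat \<Rightarrow> complex) \<Rightarrow> complex" where
  "qform A f g = (\<Sum>i<dim_row A. cnj (f i) * (\<Sum>j<dim_col A. A $$ (i, j) * g j))"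

lemma qform_add_left: "qform A (\<lambda>i. f i + g i) h = qform A f h + qform A g h"
  by (simp add: qform_def algebra_simps sum.distrib)

lemma qform_add_right: "qform A h (\<lambda>i. f i + g i) = qform A h f + qform A h g"
  by (simp add: qform_def algebra_simps sum.distrib)

lemma qform_scale: "qform A (\<lambda>i. c * f i) (\<lambda>i. c * f i) = of_real ((cmod c)\<^sup>2) * qform A f f"
proof -
  have "(\<Sum>j<dim_col A. A $$ (i, j) * (c * f j)) = c * (\<Sum>j<dim_col A. A $$ (i, j) * f j)" for i
    by (simp add: sum_distrib_left mult_ac)
  moreover have "complex_of_real ((cmod c)\<^sup>2) = c * cnj c"
    by (rule complex_norm_square)
  ultimately show ?thesis
    by (simp del: of_real_power add: qform_def sum_distrib_left mult_ac)
qed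

lemma pos_def_carrier: "pos_def n A \<Longrightarrow> A \<in> carrier_mat n n"
  by (simp add: pos_def_def)

lemma adjoint_index:
  assumes "A \<in> carrier_mat n m" "i < m" "j < n"
  shows "mat_adjoint A $$ (i, j) = cnj (A $$ (j, i))"
proof -
  have "mat_adjoint A $$ (i, j) = conjugate (col A i) $ j"
    using assms by (simp add: mat_adjoint_def mat_of_rows_index)
  then show ?thesis using assms by simp
qed

lemma adjoint_carrier: "A \<in> carrier_mat n m \<Longrightarrow> mat_adjoint A \<in> carrier_mat m n"
  by (auto simp: mat_adjoint_def)

lemma hermitian_iff_entries:
  assumes A: "A \<in> carrier_mat n n"
  shows "mat_adjoint A = A \<longleftrightarrow> (\<forall>i<n. \<forall>j<n. A $$ (i, j) = cnj (A $$ (j, i)))"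
proof -
  have "mat_adjoint A = A \<longleftrightarrow> (\<forall>i<n. \<forall>j<n. A $$ (i, j) = mat_adjoint A $$ (i, j))"
    using carrier_matD [OF A] carrier_matD [OF adjoint_carrier [OF A]] by (auto simp: mat_eq_iff)
  also have "\<dots> \<longleftrightarrow> (\<forall>i<n. \<forall>j<n. A $$ (i, j) = cnj (A $$ (j, i)))"
    by (simp add: adjoint_index [OF A] cong: imp_cong)
  finally show ?thesis .
qed

lemma pos_def_hermitian: "pos_def n A \<Longrightarrow> i < n \<Longrightarrow> j < n \<Longrightarrow> A $$ (i, j) = cnj (A $$ (j, i))"
  using hermitian_iff_entries [of A n] unfolding pos_def_def by blast

lemma qform_vec:
  assumes "A \<in> carrier_mat n n"
  shows "(A *\<^sub>v vec n f) \<bullet>c vec n f = qform A f f"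
  using assms by (auto simp: qform_def scalar_prod_def lessThan_atLeast0 mult_ac intro!: sum.cong)

lemma pos_def_iff_qform:
  assumes A: "A \<in> carrier_mat n n" and herm: "\<And>i j. i < n \<Longrightarrow> j < n \<Longrightarrow> A $$ (i, j) = cnj (A $$ (j, i))"
  shows "pos_def n A \<longleftrightarrow> (\<forall>f. (\<exists>i<n. f i \<noteq> 0) \<longrightarrow> Re (qform A f f) > 0)"
proof -
  have 1: "vec n f \<noteq> 0\<^sub>v n \<longleftrightarrow> (\<exists>i<n. f i \<noteq> 0)" for f :: "nat \<Rightarrow> complex"
    by (auto simp: vec_eq_iff)
  have 2: "(\<forall>v\<in>carrier_vec n. P v) \<longleftrightarrow> (\<forall>f. P (vec n f))" for P :: "complex vec \<Rightarrow> bool"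
  proof
    assume P: "\<forall>f. P (vec n f)"
    show "\<forall>v\<in>carrier_vec n. P v"
    proof
      fix v :: "complex vec" assume "v \<in> carrier_vec n"
      then have "v = vec n (\<lambda>i. v $ i)" by auto
      then show "P v" using P by metis
    qed
  qed auto
  have "mat_adjoint A = A" using hermitian_iff_entries [OF A] herm by blast
  then have "pos_def n A \<longleftrightarrow>
      (\<forall>v\<in>carrier_vec n. v \<noteq> 0\<^sub>v n \<longrightarrow> 0 < Re ((A *\<^sub>v v) \<bullet>c v))"
    using A by (simp only: pos_def_def) simp
  also have "\<dots> \<longleftrightarrow> (\<forall>f. vec n f \<noteq> 0\<^sub>v n \<longrightarrow> 0 < Re ((A *\<^sub>v vec n f) \<bullet>c vec n f))"
    by (rule 2)
  finally show ?thesis by (simp only: 1 qform_vec [OF A])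
qed

lemma pos_def_qform_pos:
  assumes "pos_def n A" "i < n" "f i \<noteq> 0"
  shows "Re (qform A f f) > 0"
  using pos_def_iff_qform [OF pos_def_carrier [OF assms(1)] pos_def_hermitian [OF assms(1)]] assms
  by blast

lemma qform_cnj:
  assumes "pos_def n A"
  shows "qform A f g = cnj (qform A g f)"
proof -
  have A: "A \<in> carrier_mat n n" using assms by (rule pos_def_carrier)
  have "qform A f g = (\<Sum>i<n. \<Sum>j<n. cnj (f i) * A $$ (i, j) * g j)"
    using A by (auto simp: qform_def sum_distrib_left mult_ac)
  also have "\<dots> = (\<Sum>j<n. \<Sum>i<n. cnj (f i) * A $$ (i, j) * g j)" by (rule sum.swap)
  also have "\<dots> = (\<Sum>j<n. \<Sum>i<n. cnj (cnj (g j) * A $$ (j, i) * f i))"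
    by (intro sum.cong refl) (simp add: pos_def_hermitian [OF assms, symmetric] mult_ac)
  also have "\<dots> = cnj (qform A g f)"
    using A by (simp add: qform_def sum_distrib_left mult_ac)
  finally show ?thesis .
qed

lemma pos_def_qform_nonneg:
  assumes "pos_def n A"
  shows "Re (qform A f f) \<ge> 0"
proof (cases "\<exists>i<n. f i \<noteq> 0")
  case True
  then show ?thesis using pos_def_qform_pos [OF assms] by (meson less_imp_le)
next
  case False
  then show ?thesis using pos_def_carrier [OF assms] by (simp add: qform_def)
qed

text \<open>
  Evaluating the form at the cofactor vector gives the product of the minors on \<open>S\<close> and on \<open>S -
  {i}\<close>, so positivity passes from the smaller minor to the larger one.
\<close>

lemma pminor_real_pos:
  assumes pd: "pos_def n A" and S: "S \<subseteq> {..<n}"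
  shows "det (row_mask S A) = of_real (pminor A S)" and "pminor A S > 0"
proof -
  have A: "A \<in> carrier_mat n n" using pd by (rule pos_def_carrier)
  have "finite S" using S finite_subset by blast
  then have "Im (det (row_mask S A)) = 0 \<and> Re (det (row_mask S A)) > 0" using S
  proof (induction S)
    case empty
    have "row_mask {} A = 1\<^sub>m n" using A by (intro eq_matI) (auto simp: row_mask_def)
    then show ?case by simp
  next
    case (insert i S)
    obtain w where w: "\<And>j. j \<notin> insert i S \<Longrightarrow> w j = 0" "w i = det (row_mask (insert i S - {i}) A)"
      and Aw: "\<And>r. r \<in> insert i S \<Longrightarrow>
        (\<Sum>j<n. A $$ (r, j) * w j) = (if r = i then det (row_mask (insert i S) A) else 0)"
      using cofactor_vector [OF A insert.prems insertI1] by metis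
    have wi: "w i = det (row_mask S A)" using w(2) insert.hyps by simp
    have "qform A w w = (\<Sum>r<n. if r = i then cnj (w i) * det (row_mask (insert i S) A) else 0)"
      unfolding qform_def
    proof (rule sum.cong)
      fix r
      show "cnj (w r) * (\<Sum>j<dim_col A. A $$ (r, j) * w j)
          = (if r = i then cnj (w i) * det (row_mask (insert i S) A) else 0)"
        using A Aw [of r] w(1) [of r] by (cases "r \<in> insert i S") auto
    qed (use A in auto)
    also have "\<dots> = cnj (w i) * det (row_mask (insert i S) A)" using insert.prems by simp
    finally have q: "qform A w w = cnj (w i) * det (row_mask (insert i S) A)" .
    have IH: "Im (w i) = 0" "Re (w i) > 0" using insert wi by auto
    then have "Re (qform A w w) > 0"
      using insert.prems by (intro pos_def_qform_pos [OF pd, of i]) auto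
    moreover have "Im (qform A w w) = 0"
      using arg_cong [OF qform_cnj [OF pd, of w w], of Im] by simp
    moreover have "Re (qform A w w) = Re (w i) * Re (det (row_mask (insert i S) A))"
      and "Im (qform A w w) = Re (w i) * Im (det (row_mask (insert i S) A))"
      unfolding q using IH by simp_all
    ultimately show ?case using IH(2) by (simp add: zero_less_mult_iff)
  qed
  then show "det (row_mask S A) = of_real (pminor A S)" "pminor A S > 0"
    using pminor_eq_row_mask [OF A S] by (auto simp: complex_eq_iff)
qed

section \<open>Quotients of minors as minima of the quadratic form\<close>

lemma pminor_empty [simp]: "pminor A {} = 1"
  by (simp add: pminor_def submatrix_def)

text \<open>
  The normalised cofactor vector \<open>w\<close> satisfies \<open>A w = c e\<^sub>i\<close> on \<open>S\<close>,
  where \<open>c\<close> is the quotient of the two minors. A competitor differs from \<open>w\<close> by a vector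
  supported on \<open>S - {i}\<close>, which is orthogonal to \<open>w\<close> for the form, so \<open>w\<close> is
  the minimiser and \<open>c\<close> is the minimum.
\<close>

lemma minor_quotient_minimizer:
  assumes pd: "pos_def n A" and S: "S \<subseteq> {..<n}" and i: "i \<in> S"
  obtains w where "w i = 1" and "\<And>j. j \<notin> S \<Longrightarrow> w j = 0"
    and "Re (qform A w w) = pminor A S / pminor A (S - {i})"
    and "\<And>v. v i = 1 \<Longrightarrow> (\<And>j. j \<notin> S \<Longrightarrow> v j = 0) \<Longrightarrow> Re (qform A w w) \<le> Re (qform A v v)"
proof -
  have A: "A \<in> carrier_mat n n" using pd by (rule pos_def_carrier)
  have Si: "S - {i} \<subseteq> {..<n}" using S by blast
  define m where "m = pminor A (S - {i})"
  define c where "c = pminor A S / m"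
  have m: "m > 0" using pminor_real_pos(2) [OF pd Si] by (simp add: m_def)
  obtain u where u: "\<And>j. j \<notin> S \<Longrightarrow> u j = 0" "u i = det (row_mask (S - {i}) A)"
    and Au: "\<And>r. r \<in> S \<Longrightarrow>
      (\<Sum>j<n. A $$ (r, j) * u j) = (if r = i then det (row_mask S A) else 0)"
    using cofactor_vector [OF A S i] by metis
  define w where "w j = u j / of_real m" for j
  have wi: "w i = 1" using u(2) m pminor_real_pos(1) [OF pd Si] by (simp add: w_def m_def)
  have w0: "w j = 0" if "j \<notin> S" for j using u(1) that by (simp add: w_def)
  have Aw: "(\<Sum>j<n. A $$ (r, j) * w j) = (if r = i then of_real c else 0)" if "r \<in> S" for r
  proof -
    have "(\<Sum>j<n. A $$ (r, j) * w j) = (\<Sum>j<n. A $$ (r, j) * u j) / of_real m"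
      by (simp add: w_def sum_divide_distrib)
    then show ?thesis using Au [OF that] pminor_real_pos(1) [OF pd S] by (simp add: c_def)
  qed
  have vw: "qform A v w = cnj (v i) * of_real c" if v: "\<And>j. j \<notin> S \<Longrightarrow> v j = 0" for v
  proof -
    have "qform A v w = (\<Sum>r<n. if r = i then cnj (v i) * of_real c else 0)"
      unfolding qform_def
    proof (rule sum.cong)
      fix r
      show "cnj (v r) * (\<Sum>j<dim_col A. A $$ (r, j) * w j) = (if r = i then cnj (v i) * of_real c else 0)"
        using A Aw [of r] v [of r] i by (cases "r \<in> S") auto
    qed (use A in auto)
    also have "\<dots> = cnj (v i) * of_real c" using S i by auto
    finally show ?thesis .
  qed
  show ?thesis
  proof
    show "w i = 1" by (rule wi)
    show "w j = 0" if "j \<notin> S" for j using that by (rule w0)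
    show "Re (qform A w w) = pminor A S / pminor A (S - {i})"
      using vw [OF w0] wi by (simp add: c_def m_def)
    show "Re (qform A w w) \<le> Re (qform A v v)" if vi: "v i = 1" and v: "\<And>j. j \<notin> S \<Longrightarrow> v j = 0" for v
    proof -
      define d where "d j = v j - w j" for j
      have dw: "qform A d w = 0"
        using vw [of d] w0 v vi wi by (simp add: d_def)
      have wd: "qform A w d = 0"
        unfolding qform_cnj [OF pd, of w d] dw by simp
      have "v = (\<lambda>j. w j + d j)" by (simp add: d_def)
      then have "qform A v v = qform A w w + qform A d d"
        by (simp add: qform_add_left qform_add_right dw wd)
      then show ?thesis using pos_def_qform_nonneg [OF pd, of d] by simp
    qed
  qed
qed

lemma minor_quotient_le_qform:
  assumes "pos_def n A" "S \<subseteq> {..<n}" "i \<in> S" "v i = 1" "\<And>j. j \<notin> S \<Longrightarrow> v j = 0"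
  shows "pminor A S / pminor A (S - {i}) \<le> Re (qform A v v)"
proof -
  obtain w where "Re (qform A w w) = pminor A S / pminor A (S - {i})"
    "\<And>v. v i = 1 \<Longrightarrow> (\<And>j. j \<notin> S \<Longrightarrow> v j = 0) \<Longrightarrow> Re (qform A w w) \<le> Re (qform A v v)"
    using minor_quotient_minimizer [OF assms(1-3)] by blast
  then show ?thesis using assms(4,5) by metis
qed

text \<open>
  A larger support set enlarges the set of competitors, so the minimum decreases.
\<close>

lemma minor_quotient_antimono:
  assumes pd: "pos_def n A" and S: "S \<subseteq> {..<n}" and T: "T \<subseteq> S" and i: "i \<in> T"
  shows "pminor A S * pminor A (T - {i}) \<le> pminor A T * pminor A (S - {i})"
proof -
  have Tn: "T \<subseteq> {..<n}" using S T by blast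
  obtain w where "w i = 1" "\<And>j. j \<notin> T \<Longrightarrow> w j = 0"
    and q: "Re (qform A w w) = pminor A T / pminor A (T - {i})"
    using minor_quotient_minimizer [OF pd Tn i] by metis
  then have "pminor A S / pminor A (S - {i}) \<le> pminor A T / pminor A (T - {i})"
    using minor_quotient_le_qform [OF pd S, of i w] T i q by (metis subsetD)
  moreover have "pminor A (S - {i}) > 0" "pminor A (T - {i}) > 0"
    using S Tn by (auto intro!: pminor_real_pos(2) [OF pd])
  ultimately show ?thesis by (simp add: field_simps)
qed

lemma Koteljanskii:
  assumes "pos_def n A" "K \<subseteq> {..<n}" "i < n" "j < n" "i \<notin> K" "j \<notin> K" "i \<noteq> j"
  shows "pminor A (insert i (insert j K)) * pminor A K \<le> pminor A (insert i K) * pminor A (insert j K)"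
proof -
  have "insert i (insert j K) - {i} = insert j K" "insert i K - {i} = K" using assms by auto
  then show ?thesis
    using minor_quotient_antimono [OF assms(1), of "insert i (insert j K)" "insert i K" i] assms by auto
qed

text \<open>
  Repeated use of the parallelogram bound \<open>Q (f + g) \<le> 2 Q f + 2 Q g\<close>, which doubles the constant
  with each summand.
\<close>

lemma qform_sum_bound:
  assumes pd: "pos_def n A" and "finite F"
  shows "Re (qform A (\<lambda>a. \<Sum>k\<in>F. x k a) (\<lambda>a. \<Sum>k\<in>F. x k a))
    \<le> 2 ^ card F * (\<Sum>k\<in>F. Re (qform A (x k) (x k)))"
  using \<open>finite F\<close>
proof (induction F)
  case empty
  then show ?case by (simp add: qform_def)
next
  case (insert k F)
  have two: "Re (qform A (\<lambda>a. f a + g a) (\<lambda>a. f a + g a)) \<le> 2 * Re (qform A f f) + 2 * Re (qform A g g)" for f g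
  proof -
    have m: "qform A (\<lambda>a. (-1) * g a) (\<lambda>a. (-1) * g a) = qform A g g"
      by (simp only: qform_scale) simp
    have s: "qform A f (\<lambda>a. (-1) * g a) = - qform A f g" "qform A (\<lambda>a. (-1) * g a) f = - qform A g f"
      by (simp_all add: qform_def sum_negf)
    have "0 \<le> Re (qform A (\<lambda>a. f a + (-1) * g a) (\<lambda>a. f a + (-1) * g a))"
      by (rule pos_def_qform_nonneg [OF pd])
    then show ?thesis
      by (simp only: qform_add_left qform_add_right m s) (simp add: qform_add_left qform_add_right)
  qed
  have nn: "0 \<le> Re (qform A (x k) (x k))" by (rule pos_def_qform_nonneg [OF pd])
  have "Re (qform A (\<lambda>a. \<Sum>k\<in>insert k F. x k a) (\<lambda>a. \<Sum>k\<in>insert k F. x k a))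
      \<le> 2 * Re (qform A (x k) (x k)) + 2 * Re (qform A (\<lambda>a. \<Sum>k\<in>F. x k a) (\<lambda>a. \<Sum>k\<in>F. x k a))"
    using two [of "x k" "\<lambda>a. \<Sum>k\<in>F. x k a"] insert.hyps by simp
  also have "\<dots> \<le> 2 * Re (qform A (x k) (x k)) + 2 * (2 ^ card F * (\<Sum>k\<in>F. Re (qform A (x k) (x k))))"
    using insert.IH by simp
  also have "\<dots> \<le> 2 ^ card (insert k F) * (\<Sum>k\<in>insert k F. Re (qform A (x k) (x k)))"
  proof -
    have "(1::real) \<le> 2 ^ card F" by simp
    then have "Re (qform A (x k) (x k)) \<le> 2 ^ card F * Re (qform A (x k) (x k))"
      using mult_right_mono [of 1 "2 ^ card F", OF _ nn] by simp
    then show ?thesis using insert.hyps by (simp add: algebra_simps)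
  qed
  finally show ?case .
qed

lemma qform_unit:
  assumes "pos_def n A" "i < n"
  shows "Re (qform A (\<lambda>a. if a = i then 1 else 0) (\<lambda>a. if a = i then 1 else 0)) = pminor A {i}"
proof -
  obtain w where w: "w i = 1" "\<And>j. j \<notin> {i} \<Longrightarrow> w j = 0"
    "Re (qform A w w) = pminor A {i} / pminor A ({i} - {i})"
    using minor_quotient_minimizer [OF assms(1), of "{i}" i] assms(2)
    by (metis empty_subsetI insert_subset lessThan_iff singletonI)
  moreover have "w = (\<lambda>a. if a = i then 1 else 0)" using w by auto
  ultimately show ?thesis by simp
qed

text \<open>
  Let \<open>w\<close> be the minimiser for \<open>S\<close> and \<open>i\<close>. The unit vector at \<open>i\<close>
  is \<open>w\<close> minus its other components, so its form value, the minor on \<open>{i}\<close>, is bounded by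
  the form values of these pieces. The component at \<open>k\<close> is small because \<open>w / w k\<close> competes
  in the minimum for \<open>S\<close> and \<open>k\<close>. For three indices this is the triangle inequality for the
  angles between three vectors, up to the constant.
\<close>

lemma complementary_product_bound:
  assumes pd: "pos_def n A" and S: "S \<subseteq> {..<n}" and i: "i \<in> S" and ne: "S \<noteq> {i}"
  shows "pminor A {i} * pminor A (S - {i})
    \<le> 2 ^ Suc (card S) * (\<Sum>j\<in>S - {i}. pminor A {j} * pminor A (S - {j}))"
proof -
  have finS: "finite S" using S finite_subset by blast
  have pos: "pminor A T > 0" if "T \<subseteq> S" for T
    using pminor_real_pos(2) [OF pd] that S by blast
  define m where "m = pminor A (S - {i})"
  have m: "m > 0" by (simp add: m_def pos)
  obtain w where wi: "w i = 1" and w0: "\<And>j. j \<notin> S \<Longrightarrow> w j = 0"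
    and Qw: "Re (qform A w w) = pminor A S / m"
    using minor_quotient_minimizer [OF pd S i] unfolding m_def by metis
  define e where "e (k::nat) = (\<lambda>a. if a = k then 1 else (0::complex))" for k
  \<comment> \<open>the pieces of the unit vector at \<open>i\<close>: the minimiser itself and the corrections at the other indices\<close>
  define x where "x k = (if k = i then w else (\<lambda>a. - w k * e k a))" for k
  have Qe: "Re (qform A (e k) (e k)) = pminor A {k}" if "k \<in> S" for k
    using qform_unit [OF pd, of k] that S by (auto simp: e_def)
  have wk: "(cmod (w k))\<^sup>2 \<le> pminor A (S - {k}) / m" if k: "k \<in> S" for k
  proof (cases "w k = 0")
    case True
    then show ?thesis using pos [of "S - {k}"] m by simp
  next
    case False
    have "pminor A S / pminor A (S - {k}) \<le> Re (qform A (\<lambda>a. (1 / w k) * w a) (\<lambda>a. (1 / w k) * w a))"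
      using False w0 by (intro minor_quotient_le_qform [OF pd S k]) auto
    also have "\<dots> = (pminor A S / m) / (cmod (w k))\<^sup>2"
      by (simp only: qform_scale) (simp add: Qw norm_divide power_divide del: of_real_power)
    finally show ?thesis
      using False m pos [of S] pos [of "S - {k}"] by (simp add: field_simps)
  qed
  have "e i = (\<lambda>a. \<Sum>k\<in>S. x k a)"
  proof
    fix a
    have "(\<Sum>k\<in>S. x k a) = w a + (\<Sum>k\<in>S - {i}. - w k * e k a)"
      using finS i by (subst sum.remove [of _ i]) (auto simp: x_def intro!: sum.cong)
    also have "(\<Sum>k\<in>S - {i}. - w k * e k a) = (\<Sum>k\<in>S - {i}. if k = a then - w a else 0)"
      by (intro sum.cong) (auto simp: e_def)
    also have "\<dots> = (if a \<in> S - {i} then - w a else 0)" using finS by simp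
    finally show "e i a = (\<Sum>k\<in>S. x k a)" using wi w0 [of a] by (auto simp: e_def)
  qed
  then have "pminor A {i} \<le> 2 ^ card S * (\<Sum>k\<in>S. Re (qform A (x k) (x k)))"
    using qform_sum_bound [OF pd finS, of x] Qe [OF i] by simp
  also have "(\<Sum>k\<in>S. Re (qform A (x k) (x k)))
      = pminor A S / m + (\<Sum>k\<in>S - {i}. (cmod (w k))\<^sup>2 * pminor A {k})"
  proof -
    have "Re (qform A (x k) (x k)) = (cmod (w k))\<^sup>2 * pminor A {k}" if "k \<in> S - {i}" for k
      using that Qe [of k] qform_scale [of A "- w k" "e k"] by (simp add: x_def)
    then show ?thesis
      using finS i by (subst sum.remove [of _ i]) (auto simp: x_def Qw intro!: sum.cong)
  qed
  also have "\<dots> \<le> pminor A S / m + (\<Sum>k\<in>S - {i}. pminor A (S - {k}) / m * pminor A {k})"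
  proof (intro add_left_mono sum_mono mult_right_mono)
    fix k assume k: "k \<in> S - {i}"
    show "(cmod (w k))\<^sup>2 \<le> pminor A (S - {k}) / m" using wk k by blast
    show "0 \<le> pminor A {k}" using pos [of "{k}"] k by auto
  qed
  finally have main: "pminor A {i} * m
      \<le> 2 ^ card S * (pminor A S + (\<Sum>k\<in>S - {i}. pminor A {k} * pminor A (S - {k})))"
    using m by (simp add: field_simps sum_distrib_right flip: sum_divide_distrib)
  \<comment> \<open>the minor on \<open>S\<close> left over from the minimiser is absorbed into one of the terms of the sum\<close>
  obtain j where j: "j \<in> S - {i}" using i ne by blast
  have "pminor A S * pminor A ({j} - {j}) \<le> pminor A {j} * pminor A (S - {j})"
    using j by (intro minor_quotient_antimono [OF pd S]) auto
  also have "\<dots> \<le> (\<Sum>k\<in>S - {i}. pminor A {k} * pminor A (S - {k}))"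
  proof (rule member_le_sum [OF j])
    fix k assume "k \<in> S - {i} - {j}"
    then have "0 < pminor A {k}" "0 < pminor A (S - {k})" by (blast intro: pos)+
    then show "0 \<le> pminor A {k} * pminor A (S - {k})" by simp
  qed (use finS in simp)
  finally have "pminor A S \<le> (\<Sum>k\<in>S - {i}. pminor A {k} * pminor A (S - {k}))" by simp
  then have "2 ^ card S * (pminor A S + (\<Sum>k\<in>S - {i}. pminor A {k} * pminor A (S - {k})))
     \<le> 2 ^ card S * (2 * (\<Sum>k\<in>S - {i}. pminor A {k} * pminor A (S - {k})))"
    by (intro mult_left_mono) auto
  from order_trans [OF main this] show ?thesis by (simp only: m_def power_Suc2 mult.assoc)
qed

lemma pos_def_inverse:
  assumes pd: "pos_def n A"
  obtains B where "pos_def n B" "B * A = 1\<^sub>m n"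
proof -
  have A: "A \<in> carrier_mat n n" using pd by (rule pos_def_carrier)
  have "row_mask {..<n} A = A" using A by (intro eq_matI) (auto simp: row_mask_def)
  then have "det A \<noteq> 0"
    using pminor_real_pos [OF pd subset_refl] by auto
  then obtain B where B: "B \<in> carrier_mat n n" and AB: "A * B = 1\<^sub>m n" and BA: "B * A = 1\<^sub>m n"
    using det_non_zero_imp_unit [OF A] by (auto simp: Units_def ring_mat_def)
  define H where "H = mat_adjoint B"
  have H: "H \<in> carrier_mat n n" using adjoint_carrier [OF B] by (simp add: H_def)
  have Hij: "H $$ (i, j) = cnj (B $$ (j, i))" if "i < n" "j < n" for i j
    using adjoint_index [OF B] that by (simp add: H_def)
  have HA: "H * A = 1\<^sub>m n"
  proof (rule eq_matI)
    fix i j assume "i < dim_row (1\<^sub>m n)" "j < dim_col (1\<^sub>m n)"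
    then have ij: "i < n" "j < n" by auto
    have "(H * A) $$ (i, j) = (\<Sum>k<n. H $$ (i, k) * A $$ (k, j))"
      using ij H A by (simp add: scalar_prod_def lessThan_atLeast0)
    also have "\<dots> = cnj (\<Sum>k<n. A $$ (j, k) * B $$ (k, i))"
      unfolding cnj_sum using ij
      by (intro sum.cong refl) (simp add: Hij pos_def_hermitian [OF pd, symmetric])
    also have "(\<Sum>k<n. A $$ (j, k) * B $$ (k, i)) = (A * B) $$ (j, i)"
      using ij B A by (simp add: scalar_prod_def lessThan_atLeast0)
    finally show "(H * A) $$ (i, j) = 1\<^sub>m n $$ (i, j)" using ij AB by simp
  qed (use H A in auto)
  have "H = H * (A * B)" using AB H by simp
  also have "\<dots> = (H * A) * B" using H A B by simp
  also have "\<dots> = B" using HA B by simp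
  finally have HB: "H = B" .
  have herm: "B $$ (i, j) = cnj (B $$ (j, i))" if "i < n" "j < n" for i j
    using Hij [OF that] HB by simp
  have "Re (qform B f f) > 0" if f: "\<exists>i<n. f i \<noteq> 0" for f
  proof -
    define g where "g i = (\<Sum>j<n. B $$ (i, j) * f j)" for i
    have ABf: "(\<Sum>j<n. A $$ (i, j) * g j) = f i" if i: "i < n" for i
    proof -
      have "(\<Sum>j<n. A $$ (i, j) * g j) = (\<Sum>j<n. \<Sum>k<n. A $$ (i, j) * B $$ (j, k) * f k)"
        by (simp add: g_def sum_distrib_left mult.assoc)
      also have "\<dots> = (\<Sum>k<n. (\<Sum>j<n. A $$ (i, j) * B $$ (j, k)) * f k)"
        by (subst sum.swap) (simp add: sum_distrib_right)
      also have "\<dots> = (\<Sum>k<n. if k = i then f k else 0)"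
      proof (intro sum.cong refl)
        fix k assume "k \<in> {..<n}"
        then have "(\<Sum>j<n. A $$ (i, j) * B $$ (j, k)) = (A * B) $$ (i, k)"
          using i A B by (simp add: scalar_prod_def lessThan_atLeast0)
        then show "(\<Sum>j<n. A $$ (i, j) * B $$ (j, k)) * f k = (if k = i then f k else 0)"
          using AB i \<open>k \<in> {..<n}\<close> by auto
      qed
      also have "\<dots> = f i" using i by simp
      finally show ?thesis .
    qed
    have "qform B f f = (\<Sum>i<n. cnj (f i) * g i)" using B by (simp add: qform_def g_def)
    also have "\<dots> = (\<Sum>i<n. cnj (cnj (g i) * (\<Sum>j<n. A $$ (i, j) * g j)))"
      using ABf by (intro sum.cong refl) simp
    also have "\<dots> = cnj (qform A g g)" using A by (simp add: qform_def)
    finally have q: "Re (qform B f f) = Re (qform A g g)" by simp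
    have "\<exists>i<n. g i \<noteq> 0"
    proof (rule ccontr)
      assume "\<not> (\<exists>i<n. g i \<noteq> 0)"
      then have "f i = 0" if "i < n" for i using ABf [OF that] by simp
      then show False using f by blast
    qed
    then show ?thesis using q pos_def_qform_pos [OF pd] by metis
  qed
  then have "pos_def n B" using pos_def_iff_qform [OF B herm] by blast
  then show ?thesis using BA that by blast
qed

text \<open>
  Multiplying the inverse, masked to \<open>S\<close>, by \<open>A\<close> turns the rows in \<open>S\<close> into
  unit rows and the others into the rows of \<open>A\<close>, which is \<open>A\<close> masked to the complement.
\<close>

lemma inverse_minor:
  assumes pd: "pos_def n A" and pdB: "pos_def n B" and BA: "B * A = 1\<^sub>m n" and S: "S \<subseteq> {..<n}"
  shows "pminor B S * pminor A {..<n} = pminor A ({..<n} - S)"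
proof -
  have A: "A \<in> carrier_mat n n" and B: "B \<in> carrier_mat n n"
    using pd pdB by (auto intro: pos_def_carrier)
  have "row_mask S B * A = row_mask ({..<n} - S) A"
  proof (rule eq_matI)
    fix i j assume "i < dim_row (row_mask ({..<n} - S) A)" "j < dim_col (row_mask ({..<n} - S) A)"
    then have ij: "i < n" "j < n" using A by (auto simp: row_mask_def)
    have "(row_mask S B * A) $$ (i, j) = (\<Sum>k<n. row_mask S B $$ (i, k) * A $$ (k, j))"
      using ij A B by (simp add: scalar_prod_def lessThan_atLeast0)
    also have "\<dots> = row_mask ({..<n} - S) A $$ (i, j)"
    proof (cases "i \<in> S")
      case True
      then have "(\<Sum>k<n. row_mask S B $$ (i, k) * A $$ (k, j)) = (B * A) $$ (i, j)"
        using ij A B by (simp add: scalar_prod_def lessThan_atLeast0 row_mask_index)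
      then show ?thesis using BA ij True A by (simp add: row_mask_index)
    next
      case False
      then have "(\<Sum>k<n. row_mask S B $$ (i, k) * A $$ (k, j))
          = (\<Sum>k<n. if k = i then A $$ (k, j) else 0)"
        using ij B by (intro sum.cong) (auto simp: row_mask_index)
      then show ?thesis using ij False A by (simp add: row_mask_index)
    qed
    finally show "(row_mask S B * A) $$ (i, j) = row_mask ({..<n} - S) A $$ (i, j)" .
  qed (use A B in \<open>auto simp: row_mask_def\<close>)
  then have "det (row_mask S B) * det A = det (row_mask ({..<n} - S) A)"
    using det_mult [OF row_mask_carrier [OF B] A] by metis
  moreover have "row_mask {..<n} A = A" using A by (intro eq_matI) (auto simp: row_mask_def)
  ultimately have "det (row_mask S B) * det (row_mask {..<n} A) = det (row_mask ({..<n} - S) A)"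
    by simp
  then have "complex_of_real (pminor B S * pminor A {..<n}) = complex_of_real (pminor A ({..<n} - S))"
    using pminor_real_pos(1) [OF pd, of "{..<n}"] pminor_real_pos(1) [OF pd, of "{..<n} - S"]
      pminor_real_pos(1) [OF pdB S] by simp
  then show ?thesis by (simp only: of_real_eq_iff)
qed

section \<open>Bounded ratios of order four\<close>

text \<open>
  An arbitrary naming of the four indices. Statements about such a naming carry the symmetry under all permutations of
  the indices.
\<close>

definition labels4 :: "nat \<Rightarrow> nat \<Rightarrow> nat \<Rightarrow> nat \<Rightarrow> bool" where
  "labels4 i j k l \<longleftrightarrow> distinct [i, j, k, l] \<and> {i, j, k, l} = {..<4}"

definition log_minor :: "complex mat \<Rightarrow> nat set \<Rightarrow> real" where
  "log_minor A S = ln (pminor A S)"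

lemma labels4_all_perms:
  assumes "labels4 i j k l"
  shows "labels4 i j l k" "labels4 i k j l" "labels4 i k l j" "labels4 i l j k" "labels4 i l k j"
    "labels4 j i k l" "labels4 j i l k" "labels4 j k i l" "labels4 j k l i" "labels4 j l i k" "labels4 j l k i"
    "labels4 k i j l" "labels4 k i l j" "labels4 k j i l" "labels4 k j l i" "labels4 k l i j" "labels4 k l j i"
    "labels4 l i j k" "labels4 l i k j" "labels4 l j i k" "labels4 l j k i" "labels4 l k i j" "labels4 l k j i"
  using assms by (simp_all add: labels4_def insert_commute)

lemma labels4_distinct:
  assumes "labels4 i j k l"
  shows "i \<noteq> j" "i \<noteq> k" "i \<noteq> l" "j \<noteq> k" "j \<noteq> l" "k \<noteq> l"
    "j \<noteq> i" "k \<noteq> i" "l \<noteq> i" "k \<noteq> j" "l \<noteq> j" "l \<noteq> k"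
  using assms by (auto simp: labels4_def)

lemma labels4_less:
  assumes "labels4 i j k l"
  shows "i < 4" "j < 4" "k < 4" "l < 4"
  using assms by (auto simp: labels4_def)

lemma log_minor_empty [simp]: "log_minor A {} = 0"
  by (simp add: log_minor_def)

lemma log_Koteljanskii:
  assumes "pos_def n A" "K \<subseteq> {..<n}" "i < n" "j < n" "i \<notin> K" "j \<notin> K" "i \<noteq> j"
  shows "log_minor A (insert i (insert j K)) + log_minor A K
    \<le> log_minor A (insert i K) + log_minor A (insert j K)"
proof -
  have pos: "pminor A S > 0" if "S \<subseteq> {..<n}" for S
    using pminor_real_pos(2) [OF assms(1) that] .
  have "ln (pminor A (insert i (insert j K)) * pminor A K)
      \<le> ln (pminor A (insert i K) * pminor A (insert j K))"
    using Koteljanskii [OF assms] assms(2-4) by (intro ln_mono mult_pos_pos pos) auto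
  then show ?thesis
    using assms(2-4) pos [of K] pos [of "insert i K"] pos [of "insert j K"] pos [of "insert i (insert j K)"]
    by (simp add: log_minor_def ln_mult)
qed

lemma pair_le_product:
  assumes "pos_def n A" "i < n" "j < n" "i \<noteq> j"
  shows "pminor A {i, j} \<le> pminor A {i} * pminor A {j}"
  using Koteljanskii [OF assms(1), of "{}" i j] assms by simp

lemma triangle_bound:
  assumes "pos_def n A" "i < n" "j < n" "k < n" "distinct [i, j, k]"
  shows "pminor A {i} * pminor A {j, k}
    \<le> 16 * (pminor A {j} * pminor A {i, k} + pminor A {k} * pminor A {i, j})"
proof -
  have ne: "i \<noteq> j" "i \<noteq> k" "j \<noteq> k" "j \<noteq> i" "k \<noteq> i" "k \<noteq> j" using assms by auto
  have "{i, j, k} - {i} = {j, k}" "{i, j, k} - {j} = {i, k}" "{i, j, k} - {k} = {i, j}"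
    by (auto simp: ne)
  then show ?thesis
    using complementary_product_bound [OF assms(1), of "{i, j, k}" i]
    by (simp add: assms(2-4) ne card_insert_if)
qed

text \<open>
  The triangle bound at \<open>i\<close> replaces \<open>a {i} * a {k, l}\<close> by two products, and each of the two
  resulting terms is at most the right hand side by two Koteljanskii inequalities. The constant is twice the
  \<open>16\<close> of the triangle bound.
\<close>

lemma log_Ingleton:
  assumes pd: "pos_def 4 A" and lab: "labels4 i j k l"
  defines "L \<equiv> log_minor A"
  shows "L {i} + L {j} + L {i, j, k} + L {i, j, l} + L {k, l}
    \<le> ln 32 + L {i, j} + L {i, k} + L {i, l} + L {j, k} + L {j, l}"
proof -
  note lt = labels4_less [OF lab] and ne = labels4_distinct [OF lab]
  let ?a = "pminor A"
  have pos: "?a S > 0" if "S \<subseteq> {..<4}" for S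
    using pminor_real_pos(2) [OF pd that] .
  have p: "?a {i} > 0" "?a {j} > 0" "?a {k} > 0" "?a {l} > 0" "?a {i, j} > 0" "?a {i, k} > 0"
    "?a {i, l} > 0" "?a {j, k} > 0" "?a {j, l} > 0" "?a {k, l} > 0" "?a {i, j, k} > 0" "?a {i, j, l} > 0"
    by (simp_all add: pos lt)
  have tri: "?a {i} * ?a {k, l} \<le> 16 * (?a {k} * ?a {i, l} + ?a {l} * ?a {i, k})"
    using triangle_bound [OF pd, of i k l] by (simp add: lt ne)
  have k1: "?a {i, j, k} * ?a {k} \<le> ?a {i, k} * ?a {j, k}"
    using Koteljanskii [OF pd, of "{k}" i j] by (simp add: lt ne)
  have k2: "?a {i, j, l} * ?a {j} \<le> ?a {i, j} * ?a {j, l}"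
    using Koteljanskii [OF pd, of "{j}" i l] by (simp add: lt ne insert_commute)
  have k3: "?a {i, j, l} * ?a {l} \<le> ?a {i, l} * ?a {j, l}"
    using Koteljanskii [OF pd, of "{l}" i j] by (simp add: lt ne)
  have k4: "?a {i, j, k} * ?a {j} \<le> ?a {i, j} * ?a {j, k}"
    using Koteljanskii [OF pd, of "{j}" i k] by (simp add: lt ne insert_commute)
  let ?R = "?a {i, j} * ?a {i, k} * ?a {i, l} * ?a {j, k} * ?a {j, l}"
  have "?a {i} * ?a {j} * ?a {i, j, k} * ?a {i, j, l} * ?a {k, l}
      = (?a {i} * ?a {k, l}) * (?a {j} * ?a {i, j, k} * ?a {i, j, l})" by simp
  also have "\<dots> \<le> 16 * (?a {k} * ?a {i, l} + ?a {l} * ?a {i, k}) * (?a {j} * ?a {i, j, k} * ?a {i, j, l})"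
    using p by (intro mult_right_mono [OF tri]) simp
  also have "\<dots> = 16 * ((?a {i, j, k} * ?a {k}) * (?a {i, j, l} * ?a {j}) * ?a {i, l}
      + (?a {i, j, l} * ?a {l}) * (?a {i, j, k} * ?a {j}) * ?a {i, k})"
    by (simp add: algebra_simps)
  also have "\<dots> \<le> 16 * ((?a {i, k} * ?a {j, k}) * (?a {i, j} * ?a {j, l}) * ?a {i, l}
      + (?a {i, l} * ?a {j, l}) * (?a {i, j} * ?a {j, k}) * ?a {i, k})"
    using p by (intro mult_left_mono add_mono mult_right_mono mult_mono k1 k2 k3 k4) auto
  also have "\<dots> = 32 * ?R" by (simp add: algebra_simps)
  finally have "ln (?a {i} * ?a {j} * ?a {i, j, k} * ?a {i, j, l} * ?a {k, l}) \<le> ln (32 * ?R)"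
    using p by (intro ln_mono) auto
  then show ?thesis using p by (simp add: L_def log_minor_def ln_mult)
qed

text \<open>
  The complementary product bound at \<open>i\<close> for all four indices has three terms on its right hand side;
  each of them is handled by one Koteljanskii inequality above an edge at \<open>i\<close> and two inequalities of the
  form \<open>a {i, k} \<le> a {i} * a {k}\<close>. The constant is three times \<open>32\<close>.
\<close>

lemma log_star_pair:
  assumes pd: "pos_def 4 A" and lab: "labels4 i j k l"
  defines "L \<equiv> log_minor A"
  shows "L {j, k, l} + L {i, j, k, l} + L {i, j} + L {i, k} + L {i, l}
    \<le> ln 96 + L {i, j, k} + L {i, j, l} + L {i, k, l} + L {i} + L {j} + L {k} + L {l}"
proof -
  note lt = labels4_less [OF lab] and ne = labels4_distinct [OF lab]
  let ?a = "pminor A"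
  have pos: "?a S > 0" if "S \<subseteq> {..<4}" for S
    using pminor_real_pos(2) [OF pd that] .
  have p: "?a {i} > 0" "?a {j} > 0" "?a {k} > 0" "?a {l} > 0" "?a {i, j} > 0" "?a {i, k} > 0"
    "?a {i, l} > 0" "?a {i, j, k} > 0" "?a {i, j, l} > 0" "?a {i, k, l} > 0" "?a {j, k, l} > 0"
    "?a {i, j, k, l} > 0"
    by (simp_all add: pos lt)
  have "{i, j, k, l} - {i} = {j, k, l}" "{i, j, k, l} - {j} = {i, k, l}"
    "{i, j, k, l} - {k} = {i, j, l}" "{i, j, k, l} - {l} = {i, j, k}"
    by (auto simp: ne)
  then have main: "?a {i} * ?a {j, k, l}
      \<le> 32 * (?a {j} * ?a {i, k, l} + ?a {k} * ?a {i, j, l} + ?a {l} * ?a {i, j, k})"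
    using complementary_product_bound [OF pd, of "{i, j, k, l}" i] by (simp add: lt ne card_insert_if)
  have kj: "?a {i, j, k, l} * ?a {i, j} \<le> ?a {i, j, k} * ?a {i, j, l}"
    using Koteljanskii [OF pd, of "{i, j}" k l] by (simp add: lt ne insert_commute)
  have kk: "?a {i, j, k, l} * ?a {i, k} \<le> ?a {i, j, k} * ?a {i, k, l}"
    using Koteljanskii [OF pd, of "{i, k}" j l] by (simp add: lt ne insert_commute)
  have kl: "?a {i, j, k, l} * ?a {i, l} \<le> ?a {i, j, l} * ?a {i, k, l}"
    using Koteljanskii [OF pd, of "{i, l}" j k] by (simp add: lt ne insert_commute)
  have ij: "?a {i, j} \<le> ?a {i} * ?a {j}" and ik: "?a {i, k} \<le> ?a {i} * ?a {k}"
    and il: "?a {i, l} \<le> ?a {i} * ?a {l}"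
    by (auto intro!: pair_le_product [OF pd] simp: lt ne)
  let ?X = "?a {i, j, k, l} * ?a {i, j} * ?a {i, k} * ?a {i, l}"
  let ?R = "?a {i, j, k} * ?a {i, j, l} * ?a {i, k, l} * ?a {i} * ?a {j} * ?a {k} * ?a {l}"
  have "?a {i} * (?a {j, k, l} * ?X) = (?a {i} * ?a {j, k, l}) * ?X" by simp
  also have "\<dots> \<le> 32 * (?a {j} * ?a {i, k, l} + ?a {k} * ?a {i, j, l} + ?a {l} * ?a {i, j, k}) * ?X"
    using p by (intro mult_right_mono [OF main]) simp
  also have "\<dots> = 32 * ((?a {i, j, k, l} * ?a {i, j}) * ?a {i, k} * ?a {i, l} * (?a {j} * ?a {i, k, l})
      + (?a {i, j, k, l} * ?a {i, k}) * ?a {i, j} * ?a {i, l} * (?a {k} * ?a {i, j, l})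
      + (?a {i, j, k, l} * ?a {i, l}) * ?a {i, j} * ?a {i, k} * (?a {l} * ?a {i, j, k}))"
    by (simp add: algebra_simps)
  also have "\<dots> \<le> 32 * ((?a {i, j, k} * ?a {i, j, l}) * (?a {i} * ?a {k}) * (?a {i} * ?a {l}) * (?a {j} * ?a {i, k, l})
      + (?a {i, j, k} * ?a {i, k, l}) * (?a {i} * ?a {j}) * (?a {i} * ?a {l}) * (?a {k} * ?a {i, j, l})
      + (?a {i, j, l} * ?a {i, k, l}) * (?a {i} * ?a {j}) * (?a {i} * ?a {k}) * (?a {l} * ?a {i, j, k}))"
    using p by (intro mult_left_mono add_mono mult_right_mono mult_mono kj kk kl ij ik il) auto
  also have "\<dots> = ?a {i} * (96 * ?R)" by (simp add: algebra_simps)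
  finally have "?a {j, k, l} * ?X \<le> 96 * ?R" using p by simp
  then have "ln (?a {j, k, l} * ?X) \<le> ln (96 * ?R)" using p by (intro ln_mono) auto
  then show ?thesis using p by (simp add: L_def log_minor_def ln_mult)
qed

text \<open>
  The statement is symmetric in \<open>i\<close>, \<open>j\<close>, \<open>k\<close>, so \<open>i\<close> may be taken
  to minimise the relative distance \<open>a {i, l} / a {i}\<close> from \<open>l\<close>. Then the triangle bounds at
  \<open>l\<close> for the pairs \<open>i, j\<close> and \<open>i, k\<close> are dominated by their terms for
  \<open>j\<close> and \<open>k\<close>, with constant \<open>32\<close> each.
\<close>

lemma log_star_square:
  assumes pd: "pos_def 4 A" and lab: "labels4 i j k l"
  defines "L \<equiv> log_minor A"
  shows "L {i, j, k, l} + L {i, j} + L {i, k} + L {j, k} + 2 * L {l}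
    \<le> ln 1024 + L {i, l} + L {j, l} + L {k, l} + L {i, j, k} + L {i} + L {j} + L {k}"
proof -
  define \<tau> where "\<tau> m = pminor A {m, l} / pminor A {m}" for m
  have ordered: "L {i, j, k, l} + L {i, j} + L {i, k} + L {j, k} + 2 * L {l}
    \<le> ln 1024 + L {i, l} + L {j, l} + L {k, l} + L {i, j, k} + L {i} + L {j} + L {k}"
    if lab: "labels4 i j k l" and min: "\<tau> i \<le> \<tau> j" "\<tau> i \<le> \<tau> k" for i j k
  proof -
    note lt = labels4_less [OF lab] and ne = labels4_distinct [OF lab]
    let ?a = "pminor A"
    have pos: "?a S > 0" if "S \<subseteq> {..<4}" for S
      using pminor_real_pos(2) [OF pd that] .
    have p: "?a {i} > 0" "?a {j} > 0" "?a {k} > 0" "?a {l} > 0" "?a {i, j} > 0" "?a {i, k} > 0"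
      "?a {i, l} > 0" "?a {j, k} > 0" "?a {j, l} > 0" "?a {k, l} > 0" "?a {i, j, k} > 0"
      "?a {i, j, k, l} > 0"
      by (simp_all add: pos lt)
    have mj: "?a {j} * ?a {i, l} \<le> ?a {i} * ?a {j, l}" and mk: "?a {k} * ?a {i, l} \<le> ?a {i} * ?a {k, l}"
      using min p by (simp_all add: \<tau>_def field_simps)
    have "?a {l} * ?a {i, j} \<le> 16 * (?a {i} * ?a {j, l} + ?a {j} * ?a {i, l})"
      "?a {l} * ?a {i, k} \<le> 16 * (?a {i} * ?a {k, l} + ?a {k} * ?a {i, l})"
      using triangle_bound [OF pd, of l i j] triangle_bound [OF pd, of l i k]
      by (simp_all add: lt ne insert_commute)
    then have lij: "?a {l} * ?a {i, j} \<le> 32 * (?a {i} * ?a {j, l})"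
      and lik: "?a {l} * ?a {i, k} \<le> 32 * (?a {i} * ?a {k, l})"
      using mj mk by auto
    have jk: "?a {j, k} \<le> ?a {j} * ?a {k}"
      by (intro pair_le_product [OF pd]) (simp_all add: lt ne)
    have "{i, j, k, l} - {l} = {i, j, k}" "{i, l} - {l} = {i}" by (auto simp: ne)
    then have top: "?a {i, j, k, l} * ?a {i} \<le> ?a {i, l} * ?a {i, j, k}"
      using minor_quotient_antimono [OF pd, of "{i, j, k, l}" "{i, l}" l] by (simp add: lt insert_commute)
    let ?X = "?a {i, j, k, l} * ?a {i, j} * ?a {i, k} * ?a {j, k} * ?a {l} * ?a {l}"
    let ?R = "?a {i, l} * ?a {j, l} * ?a {k, l} * ?a {i, j, k} * ?a {i} * ?a {j} * ?a {k}"
    have "?a {i} * ?X = (?a {i, j, k, l} * ?a {i}) * (?a {l} * ?a {i, j}) * (?a {l} * ?a {i, k}) * ?a {j, k}"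
      by simp
    also have "\<dots> \<le> (?a {i, l} * ?a {i, j, k}) * (32 * (?a {i} * ?a {j, l})) * (32 * (?a {i} * ?a {k, l}))
        * (?a {j} * ?a {k})"
      using p by (intro mult_mono top lij lik jk) auto
    also have "\<dots> = ?a {i} * (1024 * ?R)" by (simp add: algebra_simps)
    finally have "?X \<le> 1024 * ?R" using p by simp
    then have "ln ?X \<le> ln (1024 * ?R)" using p by (intro ln_mono) auto
    then show ?thesis using p by (simp add: L_def log_minor_def ln_mult)
  qed
  consider "\<tau> i \<le> \<tau> j" "\<tau> i \<le> \<tau> k" | "\<tau> j \<le> \<tau> i" "\<tau> j \<le> \<tau> k" | "\<tau> k \<le> \<tau> i" "\<tau> k \<le> \<tau> j"
    by linarith
  then show ?thesis
  proof cases
    case 1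
    then show ?thesis using ordered [OF lab] by simp
  next
    case 2
    then show ?thesis using ordered [OF labels4_all_perms(6) [OF lab]] by (simp add: insert_commute)
  next
    case 3
    then show ?thesis
      using ordered [OF labels4_all_perms(12) [OF lab]] by (simp add: insert_commute)
  qed
qed

lemma log_minor_inverse:
  assumes "pos_def n A" "pos_def n B" "B * A = 1\<^sub>m n" "S \<subseteq> {..<n}"
  shows "log_minor B S = log_minor A ({..<n} - S) - log_minor A {..<n}"
proof -
  have "pminor B S > 0" "pminor A {..<n} > 0"
    using assms by (auto intro: pminor_real_pos(2))
  then show ?thesis
    unfolding log_minor_def inverse_minor [OF assms, symmetric] by (simp add: ln_mult)
qed

text \<open>
  This is \<open>log_star_pair\<close> for the inverse matrix. Its minors are the complementary minors divided by the
  determinant, whose powers combine to the square of the full minor.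
\<close>

lemma log_star_pair_dual:
  assumes pd: "pos_def 4 A" and lab: "labels4 i j k l"
  defines "L \<equiv> log_minor A"
  shows "2 * L {i, j, k, l} + L {j, k} + L {j, l} + L {k, l} + L {i}
    \<le> ln 96 + L {i, j, k} + L {i, j, l} + L {i, k, l} + L {j, k, l} + L {j} + L {k} + L {l}"
proof -
  note ne = labels4_distinct [OF lab]
  have N: "{..<4} = {i, j, k, l}" using lab by (simp add: labels4_def)
  obtain B where B: "pos_def 4 B" "B * A = 1\<^sub>m 4" using pos_def_inverse [OF pd] .
  show ?thesis
    using log_star_pair [OF B(1) lab]
    by (simp add: ne log_minor_inverse [OF pd B] N L_def insert_Diff_if)
qed

lemma log_star_square_dual:
  assumes pd: "pos_def 4 A" and lab: "labels4 i j k l"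
  defines "L \<equiv> log_minor A"
  shows "2 * L {i, j, k} + L {i, j, k, l} + L {i, l} + L {j, l} + L {k, l}
    \<le> ln 1024 + L {i, j, l} + L {i, k, l} + L {j, k, l} + L {i, j} + L {i, k} + L {j, k} + L {l}"
proof -
  note ne = labels4_distinct [OF lab]
  have N: "{..<4} = {i, j, k, l}" using lab by (simp add: labels4_def)
  obtain B where B: "pos_def 4 B" "B * A = 1\<^sub>m 4" using pos_def_inverse [OF pd] .
  show ?thesis
    using log_star_square [OF B(1) lab]
    by (simp add: ne log_minor_inverse [OF pd B] N L_def insert_Diff_if)
qed

section \<open>Nullity as the order of vanishing of a minor\<close>

text \<open>
  If \<open>M\<^sup>* M v = 0\<close> then \<open>M v\<close> has norm zero.
\<close>

lemma mat_kernel_gram: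
  fixes M :: "complex mat"
  assumes M: "M \<in> carrier_mat m k"
  shows "mat_kernel (mat_adjoint M * M) = mat_kernel M"
proof
  have H: "mat_adjoint M \<in> carrier_mat k m" using M by (rule adjoint_carrier)
  show "mat_kernel M \<subseteq> mat_kernel (mat_adjoint M * M)"
    by (rule mat_kernel_mult_subset [OF M H])
  show "mat_kernel (mat_adjoint M * M) \<subseteq> mat_kernel M"
  proof
    fix v assume "v \<in> mat_kernel (mat_adjoint M * M)"
    then have v: "v \<in> carrier_vec k" and z: "mat_adjoint M * M *\<^sub>v v = 0\<^sub>v k"
      using mat_kernelD [of "mat_adjoint M * M" k k v] H M by auto
    define w where "w = M *\<^sub>v v"
    have w: "w \<in> carrier_vec m" using M v by (simp add: w_def)
    have "mat_adjoint M *\<^sub>v w = 0\<^sub>v k" using z H M v by (simp add: w_def)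
    then have row0: "(\<Sum>r<m. cnj (M $$ (r, i)) * w $ r) = 0" if "i < k" for i
    proof -
      have "(mat_adjoint M *\<^sub>v w) $ i = (\<Sum>r<m. cnj (M $$ (r, i)) * w $ r)"
        using H w that adjoint_index [OF M]
        by (auto simp: scalar_prod_def lessThan_atLeast0 intro!: sum.cong)
      then show ?thesis using \<open>mat_adjoint M *\<^sub>v w = 0\<^sub>v k\<close> that by simp
    qed
    have "w \<bullet>c w = (\<Sum>r<m. w $ r * cnj (\<Sum>i<k. M $$ (r, i) * v $ i))"
      using w M v by (auto simp: w_def scalar_prod_def lessThan_atLeast0 intro!: sum.cong)
    also have "\<dots> = (\<Sum>r<m. \<Sum>i<k. cnj (v $ i) * (cnj (M $$ (r, i)) * w $ r))"
      by (simp add: sum_distrib_left mult_ac)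
    also have "\<dots> = (\<Sum>i<k. cnj (v $ i) * (\<Sum>r<m. cnj (M $$ (r, i)) * w $ r))"
      by (subst sum.swap) (simp add: sum_distrib_left)
    also have "\<dots> = 0" by (simp add: row0)
    finally have "w = 0\<^sub>v m" using w by simp
    then show "v \<in> mat_kernel M" using mat_kernelI [OF M v] by (simp add: w_def)
  qed
qed

lemma kernel_dim_cong:
  "dim_col A = dim_col B \<Longrightarrow> mat_kernel A = mat_kernel B \<Longrightarrow> kernel_dim A = kernel_dim B"
  by (simp add: kernel_dim_def)

lemma gram_entries:
  fixes M :: "complex mat"
  assumes M: "M \<in> carrier_mat m k" and "i < k" "j < k"
  shows "(mat_adjoint M * M) $$ (i, j) = (\<Sum>r<m. cnj (M $$ (r, i)) * M $$ (r, j))"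
proof -
  have "mat_adjoint M \<in> carrier_mat k m" using M by (rule adjoint_carrier)
  then have "(mat_adjoint M * M) $$ (i, j) = (\<Sum>r<m. mat_adjoint M $$ (i, r) * M $$ (r, j))"
    using M assms by (simp add: scalar_prod_def lessThan_atLeast0)
  then show ?thesis using adjoint_index [OF M] assms by simp
qed

text \<open>
  For the Hermitian matrix \<open>B = M\<^sup>* M\<close> the kernels of \<open>B\<close> and \<open>B\<^sup>2\<close>
  coincide, so all Jordan blocks for the eigenvalue \<open>0\<close> have size one and the algebraic multiplicity of
  \<open>0\<close> is the dimension of the kernel.
\<close>

lemma order_char_poly_gram:
  fixes M :: "complex mat"
  assumes M: "M \<in> carrier_mat m k"
  shows "order 0 (char_poly (mat_adjoint M * M)) = kernel_dim M"
proof -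
  define B where "B = mat_adjoint M * M"
  have H: "mat_adjoint M \<in> carrier_mat k m" using M by (rule adjoint_carrier)
  have B: "B \<in> carrier_mat k k" using H M by (simp add: B_def)
  have herm: "mat_adjoint B = B"
    unfolding hermitian_iff_entries [OF B] using gram_entries [OF M]
    by (simp add: B_def mult_ac)
  have ker2: "kernel_dim (B * B) = kernel_dim B"
    using mat_kernel_gram [OF B] herm B by (intro kernel_dim_cong) auto
  obtain n_as where jnf: "jordan_nf B n_as"
    using jordan_nf_exists [OF B] char_poly_factorized [OF B] by blast
  define ns where "ns = map fst (filter (\<lambda>na. snd na = 0) n_as)"
  have "char_matrix B 0 = B" using B by (intro eq_matI) (auto simp: char_matrix_def)
  then have dims: "kernel_dim (B ^\<^sub>m j) = (\<Sum>n\<leftarrow>ns. min j n)" for j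
    using dim_gen_eigenspace [OF jnf, of 0 j]
    by (simp add: dim_gen_eigenspace_def ns_def case_prod_beta')
  have "(\<Sum>n\<leftarrow>ns. min 2 n) = (\<Sum>n\<leftarrow>ns. min 1 n)"
    using dims [of 1] dims [of 2] ker2 B by (simp add: numeral_2_eq_2)
  then have "\<forall>n\<in>set ns. n \<le> 1"
  proof (induction ns)
    case (Cons n ns)
    have "(\<Sum>n\<leftarrow>ns. min 1 n) \<le> (\<Sum>n\<leftarrow>ns. min 2 n)" by (rule sum_list_mono) simp
    moreover have "min 1 n \<le> min 2 n" by simp
    ultimately have "min 2 n = min 1 n" "(\<Sum>n\<leftarrow>ns. min 2 n) = (\<Sum>n\<leftarrow>ns. min 1 n)"
      using Cons.prems by auto
    then show ?case using Cons.IH by auto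
  qed simp
  then have "sum_list ns = (\<Sum>n\<leftarrow>ns. min 1 n)"
    by (intro arg_cong [where f = sum_list]) (auto intro: map_idI [symmetric])
  also have "\<dots> = kernel_dim B" using dims [of 1] B by simp
  also have "\<dots> = kernel_dim M"
    using mat_kernel_gram [OF M] M B by (intro kernel_dim_cong) (auto simp: B_def)
  finally show ?thesis using jordan_nf_order [OF jnf, of 0] by (simp add: B_def ns_def)
qed

text \<open>
  The matrix \<open>M\<^sup>* M + t I\<close>, written entrywise so that its principal submatrices are visibly of the
  same form.
\<close>

definition shifted_gram :: "complex mat \<Rightarrow> real \<Rightarrow> complex mat" where
  "shifted_gram M t = mat (dim_col M) (dim_col M)
     (\<lambda>(i, j). (\<Sum>r<dim_row M. cnj (M $$ (r, i)) * M $$ (r, j)) + (if i = j then of_real t else 0))"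

lemma pos_def_shifted_gram:
  assumes M: "dim_col M = n" and t: "t > 0"
  shows "pos_def n (shifted_gram M t)"
proof -
  let ?A = "shifted_gram M t"
  have A: "?A \<in> carrier_mat n n" using M by (simp add: shifted_gram_def)
  have herm: "?A $$ (i, j) = cnj (?A $$ (j, i))" if "i < n" "j < n" for i j
    using that M by (simp add: shifted_gram_def mult_ac)
  have "Re (qform ?A f f) > 0" if nz: "\<exists>i<n. f i \<noteq> 0" for f
  proof -
    let ?g = "\<lambda>r. \<Sum>j<n. M $$ (r, j) * f j"
    have "qform ?A f f = (\<Sum>i<n. \<Sum>j<n. cnj (f i) * (?A $$ (i, j) * f j))"
      using A by (simp add: qform_def sum_distrib_left)
    also have "\<dots> = (\<Sum>i<n. \<Sum>j<n.
        cnj (f i) * (\<Sum>r<dim_row M. cnj (M $$ (r, i)) * M $$ (r, j)) * f j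
        + (if i = j then of_real t * (cnj (f i) * f i) else 0))"
      using M by (intro sum.cong refl) (simp add: shifted_gram_def distrib_right distrib_left mult_ac)
    also have "\<dots>
        = (\<Sum>i<n. \<Sum>j<n. cnj (f i) * (\<Sum>r<dim_row M. cnj (M $$ (r, i)) * M $$ (r, j)) * f j)
        + (\<Sum>i<n. \<Sum>j<n. if i = j then of_real t * (cnj (f i) * f i) else 0)"
      by (simp only: sum.distrib)
    also have "(\<Sum>i<n. \<Sum>j<n. if i = j then of_real t * (cnj (f i) * f i) else 0)
        = of_real (t * (\<Sum>i<n. (cmod (f i))\<^sup>2))"
    proof -
      have "(\<Sum>i<n. \<Sum>j<n. if i = j then of_real t * (cnj (f i) * f i) else 0)
          = (\<Sum>i<n. of_real t * (cnj (f i) * f i))"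
        by (intro sum.cong refl) simp
      also have "\<dots> = (\<Sum>i<n. of_real t * of_real ((cmod (f i))\<^sup>2))"
        by (simp only: complex_norm_square mult.commute [of "cnj _"])
      finally show ?thesis by (simp add: sum_distrib_left)
    qed
    also have "(\<Sum>i<n. \<Sum>j<n. cnj (f i) * (\<Sum>r<dim_row M. cnj (M $$ (r, i)) * M $$ (r, j)) * f j)
        = (\<Sum>i<n. \<Sum>j<n. \<Sum>r<dim_row M. cnj (M $$ (r, i) * f i) * (M $$ (r, j) * f j))"
      by (simp add: sum_distrib_left sum_distrib_right mult_ac)
    also have "\<dots> = (\<Sum>i<n. \<Sum>r<dim_row M. cnj (M $$ (r, i) * f i) * ?g r)"
      unfolding sum_distrib_left by (intro sum.cong refl sum.swap)
    also have "\<dots> = (\<Sum>r<dim_row M. cnj (?g r) * ?g r)"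
      by (subst sum.swap) (simp add: sum_distrib_right cnj_sum)
    also have "\<dots> = of_real (\<Sum>r<dim_row M. (cmod (?g r))\<^sup>2)"
      unfolding of_real_sum by (intro sum.cong refl) (simp only: complex_norm_square mult.commute)
    finally have q: "Re (qform ?A f f)
        = (\<Sum>r<dim_row M. (cmod (?g r))\<^sup>2) + t * (\<Sum>i<n. (cmod (f i))\<^sup>2)"
      by (simp only: plus_complex.sel Re_complex_of_real)
    obtain i where i: "i < n" "f i \<noteq> 0" using nz by blast
    then have "0 < (\<Sum>i<n. (cmod (f i))\<^sup>2)" by (intro sum_pos2 [of _ i]) auto
    then have "0 < t * (\<Sum>i<n. (cmod (f i))\<^sup>2)" using t by simp
    moreover have "0 \<le> (\<Sum>r<dim_row M. (cmod (?g r))\<^sup>2)" by (simp add: sum_nonneg)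
    ultimately show ?thesis unfolding q by linarith
  qed
  then show ?thesis using pos_def_iff_qform [OF A herm] by blast
qed

lemma submatrix_shifted_gram:
  assumes M: "dim_col M = n" and S: "S \<subseteq> {..<n}"
  shows "submatrix (shifted_gram M t) S S = shifted_gram (submatrix M UNIV S) t"
proof -
  have eq: "{i. i < n \<and> i \<in> S} = S" using S by auto
  have pick: "pick S i < n" if "i < card S" for i
    using pick_in_set [OF disjI1 [OF that]] S by auto
  have inj: "pick S i = pick S j \<longleftrightarrow> i = j" if "i < card S" "j < card S" for i j
    using pick_mono [OF disjI1 [OF that(1)]] pick_mono [OF disjI1 [OF that(2)]]
    by (metis linorder_neqE_nat less_irrefl)
  show ?thesis
    using M pick inj by (intro eq_matI) (auto simp: shifted_gram_def submatrix_def eq pick_UNIV)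
qed

text \<open>
  Up to sign the determinant is the characteristic polynomial of \<open>M\<^sup>* M\<close> at \<open>- t\<close>;
  \<open>q\<close> is that polynomial without its zeros at the origin.
\<close>

lemma det_shifted_gram_order:
  obtains q :: "complex poly" where "poly q 0 \<noteq> 0"
    and "\<And>t. cmod (det (shifted_gram M t)) = \<bar>t\<bar> ^ kernel_dim M * cmod (poly q (of_real (- t)))"
proof -
  define m k where "m = dim_row M" and "k = dim_col M"
  have M: "M \<in> carrier_mat m k" by (simp add: m_def k_def)
  define B where "B = mat_adjoint M * M"
  have B: "B \<in> carrier_mat k k" using M adjoint_carrier [OF M] by (simp add: B_def)
  have "char_poly B \<noteq> 0"
    using char_poly_factorized [OF B] by (auto simp: prod_list_zero_iff)
  then obtain q where q: "char_poly B = [:- 0, 1:] ^ order 0 (char_poly B) * q"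
    and nd: "\<not> [:- 0, 1:] dvd q"
    using order_decomp by blast
  have q0: "poly q 0 \<noteq> 0" using nd by (simp add: poly_eq_0_iff_dvd)
  have ord: "order 0 (char_poly B) = kernel_dim M"
    using order_char_poly_gram [OF M] by (simp add: B_def)
  have "cmod (det (shifted_gram M t)) = \<bar>t\<bar> ^ kernel_dim M * cmod (poly q (of_real (- t)))" for t
  proof -
    have "- (char_matrix B (of_real (- t))) = (-1) \<cdot>\<^sub>m shifted_gram M t"
    proof (rule eq_matI)
      fix i j assume "i < dim_row ((-1) \<cdot>\<^sub>m shifted_gram M t)" "j < dim_col ((-1) \<cdot>\<^sub>m shifted_gram M t)"
      then have ij: "i < k" "j < k" by (auto simp: shifted_gram_def k_def)
      have Bij: "B $$ (i, j) = (\<Sum>r<m. cnj (M $$ (r, i)) * M $$ (r, j))"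
        unfolding B_def by (rule gram_entries [OF M ij])
      show "(- (char_matrix B (of_real (- t)))) $$ (i, j) = ((-1) \<cdot>\<^sub>m shifted_gram M t) $$ (i, j)"
        using B ij by (simp add: char_matrix_def shifted_gram_def Bij flip: m_def k_def)
    qed (use B in \<open>simp_all add: char_matrix_def shifted_gram_def k_def\<close>)
    then have "poly (char_poly B) (of_real (- t)) = (-1) ^ k * det (shifted_gram M t)"
      using char_poly_matrix [OF B, of "of_real (- t)"]
      by (simp add: shifted_gram_def k_def)
    then have "cmod (det (shifted_gram M t)) = cmod (poly (char_poly B) (of_real (- t)))"
      by (simp add: norm_mult norm_power)
    also have "poly (char_poly B) (of_real (- t)) = of_real (- t) ^ kernel_dim M * poly q (of_real (- t))"
      by (subst q) (simp add: ord)
    finally show ?thesis by (simp add: norm_mult norm_power)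
  qed
  then show ?thesis using q0 that by blast
qed

lemma log_minor_shifted_gram:
  assumes M: "dim_col M = n" and S: "S \<subseteq> {..<n}"
  shows "((\<lambda>t. log_minor (shifted_gram M t) S / ln t) \<longlongrightarrow> real (kernel_dim (submatrix M UNIV S)))
    (at_right 0)"
proof -
  define d where "d = kernel_dim (submatrix M UNIV S)"
  obtain q :: "complex poly" where q0: "poly q 0 \<noteq> 0"
    and q: "\<And>t. cmod (det (shifted_gram (submatrix M UNIV S) t)) = \<bar>t\<bar> ^ d * cmod (poly q (of_real (- t)))"
    using det_shifted_gram_order [of "submatrix M UNIV S"] unfolding d_def by metis
  have lim: "((\<lambda>t. cmod (poly q (of_real (- t)))) \<longlongrightarrow> cmod (poly q 0)) (at_right 0)"
    by (auto intro!: tendsto_eq_intros)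
  have "((\<lambda>t. ln (cmod (poly q (of_real (- t))))) \<longlongrightarrow> ln (cmod (poly q 0))) (at_right 0)"
    using q0 by (intro tendsto_ln lim) simp
  then have "((\<lambda>t. ln (cmod (poly q (of_real (- t)))) / ln t) \<longlongrightarrow> 0) (at_right 0)"
    by (rule tendsto_divide_0) (rule filterlim_mono [OF ln_at_0 at_bot_le_at_infinity order_refl])
  then have "((\<lambda>t. real d + ln (cmod (poly q (of_real (- t)))) / ln t) \<longlongrightarrow> real d + 0) (at_right 0)"
    by (intro tendsto_add tendsto_const)
  moreover have "\<forall>\<^sub>F t in at_right 0.
      real d + ln (cmod (poly q (of_real (- t)))) / ln t = log_minor (shifted_gram M t) S / ln t"
  proof -
    have "\<forall>\<^sub>F t in at_right 0. 0 < cmod (poly q (of_real (- t)))"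
      using q0 by (intro order_tendstoD(1) [OF lim]) simp
    moreover have "\<forall>\<^sub>F t in at_right (0::real). t \<in> {0<..<1}"
      by (rule eventually_at_right_real) simp
    ultimately show ?thesis
    proof eventually_elim
      case (elim t)
      have pd: "pos_def n (shifted_gram M t)" using M elim by (intro pos_def_shifted_gram) auto
      have "det (submatrix (shifted_gram M t) S S) = of_real (pminor (shifted_gram M t) S)"
        using pminor_real_pos(1) [OF pd S] det_row_mask_submatrix [OF pos_def_carrier [OF pd] S] by simp
      then have "pminor (shifted_gram M t) S = cmod (det (submatrix (shifted_gram M t) S S))"
        using pminor_real_pos(2) [OF pd S] by simp
      also have "\<dots> = t ^ d * cmod (poly q (of_real (- t)))"
        using elim by (simp add: submatrix_shifted_gram [OF M S] q)
      finally have "log_minor (shifted_gram M t) S = real d * ln t + ln (cmod (poly q (of_real (- t))))"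
        using elim by (simp add: log_minor_def ln_mult ln_realpow)
      moreover have "ln t \<noteq> 0" using elim by simp
      ultimately show ?case by (simp add: field_simps)
    qed
  qed
  ultimately show ?thesis by (simp add: d_def tendsto_cong)
qed

section \<open>Logarithms of ratios and the necessity of the inequalities\<close>

lemma prod_val_pos_ln:
  assumes pd: "pos_def n A" and "\<alpha> \<in> minor_prods n"
  shows "prod_val \<alpha> A > 0 \<and> ln (prod_val \<alpha> A) = (\<Sum>S\<in>Pow {..<n}. total_exp \<alpha> S * log_minor A S)"
  using assms(2)
proof (induction \<alpha>)
  case Nil
  then show ?case by (simp add: prod_val_def total_exp_def)
next
  case (Cons Te \<alpha>)
  obtain T e where Te: "Te = (T, e)" by force
  have T: "T \<subseteq> {..<n}" and \<alpha>: "\<alpha> \<in> minor_prods n"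
    using Cons.prems by (auto simp: minor_prods_def Te)
  have p: "pminor A T > 0" using pminor_real_pos(2) [OF pd T] .
  have cons: "prod_val (Te # \<alpha>) A = pminor A T powr e * prod_val \<alpha> A"
    by (simp add: prod_val_def Te)
  have "(\<Sum>S\<in>Pow {..<n}. total_exp (Te # \<alpha>) S * log_minor A S)
      = (\<Sum>S\<in>Pow {..<n}. (if S = T then e * log_minor A S else 0))
        + (\<Sum>S\<in>Pow {..<n}. total_exp \<alpha> S * log_minor A S)"
    unfolding sum.distrib [symmetric]
    by (intro sum.cong refl) (auto simp: total_exp_def Te algebra_simps)
  also have "(\<Sum>S\<in>Pow {..<n}. (if S = T then e * log_minor A S else 0)) = e * log_minor A T"
    using T by (subst sum.delta) auto
  finally show ?case
    using Cons.IH [OF \<alpha>] p by (simp add: cons ln_mult ln_powr log_minor_def)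
qed

lemma ln_ratio_val:
  assumes pd: "pos_def n A" and r: "r \<in> ratios n"
  shows "ratio_val r A > 0"
    and "ln (ratio_val r A) = set_inner n (formal_log n r) (log_minor A)"
proof -
  have r': "fst r \<in> minor_prods n" "snd r \<in> minor_prods n" using r by (auto simp: ratios_def)
  note 1 = prod_val_pos_ln [OF pd r'(1)] and 2 = prod_val_pos_ln [OF pd r'(2)]
  show "ratio_val r A > 0" using 1 2 by (simp add: ratio_val_def)
  have "ln (ratio_val r A) = (\<Sum>S\<in>Pow {..<n}. log_entry r S * log_minor A S)"
    using 1 2 by (simp add: ratio_val_def ln_div log_entry_def left_diff_distrib sum_subtractf)
  also have "\<dots> = set_inner n (formal_log n r) (log_minor A)"
    unfolding set_inner_def by (intro sum.cong refl) (auto simp: formal_log_def)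
  finally show "ln (ratio_val r A) = set_inner n (formal_log n r) (log_minor A)" .
qed

lemma bounded_ratio_iff:
  assumes r: "r \<in> ratios n"
  shows "bounded_ratio n r \<longleftrightarrow>
    (\<exists>C. \<forall>A. pos_def n A \<longrightarrow> set_inner n (formal_log n r) (log_minor A) \<le> C)"
proof
  assume "bounded_ratio n r"
  then obtain C where C: "\<And>A. pos_def n A \<Longrightarrow> ratio_val r A \<le> C"
    by (auto simp: bounded_ratio_def)
  have "set_inner n (formal_log n r) (log_minor A) \<le> ln C" if pd: "pos_def n A" for A
    using ln_mono [OF C [OF pd] ln_ratio_val(1) [OF pd r]] ln_ratio_val(2) [OF pd r] by simp
  then show "\<exists>C. \<forall>A. pos_def n A \<longrightarrow> set_inner n (formal_log n r) (log_minor A) \<le> C" by blast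
next
  assume "\<exists>C. \<forall>A. pos_def n A \<longrightarrow> set_inner n (formal_log n r) (log_minor A) \<le> C"
  then obtain C where C: "\<And>A. pos_def n A \<Longrightarrow> set_inner n (formal_log n r) (log_minor A) \<le> C" by blast
  have "ratio_val r A \<le> exp C" if pd: "pos_def n A" for A
  proof -
    have "ratio_val r A = exp (ln (ratio_val r A))" using ln_ratio_val(1) [OF pd r] by simp
    also have "\<dots> \<le> exp C" using C [OF pd] ln_ratio_val(2) [OF pd r] by simp
    finally show ?thesis .
  qed
  then show "bounded_ratio n r" unfolding bounded_ratio_def by blast
qed

lemma diagonal_minor:
  fixes D :: "complex mat"
  assumes D: "D \<in> carrier_mat n n" and diag: "diagonal_mat D" and S: "S \<subseteq> {..<n}"
  shows "det (row_mask S D) = (\<Prod>i\<in>S. D $$ (i, i))"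
proof -
  have "upper_triangular (row_mask S D)"
    using D diag by (auto simp: upper_triangular_def row_mask_def diagonal_mat_def)
  then have "det (row_mask S D) = prod_list (diag_mat (row_mask S D))"
    using D by (intro det_upper_triangular [of _ n]) simp_all
  also have "\<dots> = (\<Prod>i = 0..<n. if i \<in> S then D $$ (i, i) else 1)"
    using D by (auto simp: prod_list_diag_prod row_mask_def intro!: prod.cong)
  also have "\<dots> = (\<Prod>i\<in>S. D $$ (i, i))"
    using S by (intro prod.mono_neutral_cong_right) auto
  finally show ?thesis .
qed

definition index_degree :: "nat \<Rightarrow> ratio \<Rightarrow> nat \<Rightarrow> real" where
  "index_degree n r i = (\<Sum>S\<in>{S \<in> Pow {..<n}. i \<in> S}. formal_log n r S)"

lemma pos_def_diag_entries:
  assumes pd: "pos_def n D" and i: "i < n"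
  shows "Im (D $$ (i, i)) = 0" "Re (D $$ (i, i)) > 0"
proof -
  have D: "D \<in> carrier_mat n n" using pd by (rule pos_def_carrier)
  show "Im (D $$ (i, i)) = 0"
    using arg_cong [OF pos_def_hermitian [OF pd i i], of Im] by simp
  have "qform D (\<lambda>a. if a = i then 1 else 0) (\<lambda>a. if a = i then 1 else 0) = D $$ (i, i)"
  proof -
    have "(\<Sum>j<n. D $$ (a, j) * (if j = i then 1 else 0)) = D $$ (a, i)" for a
    proof -
      have "(\<Sum>j<n. D $$ (a, j) * (if j = i then 1 else 0)) = (\<Sum>j<n. if j = i then D $$ (a, j) else 0)"
        by (intro sum.cong) auto
      then show ?thesis using i by simp
    qed
    moreover have "(\<Sum>a<n. cnj (if a = i then 1 else 0) * D $$ (a, i))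
        = (\<Sum>a<n. if a = i then D $$ (a, i) else 0)"
      by (intro sum.cong) auto
    ultimately show ?thesis using i D by (simp add: qform_def)
  qed
  moreover have "Re (qform D (\<lambda>a. if a = i then 1 else 0) (\<lambda>a. if a = i then 1 else 0)) > 0"
    using i by (intro pos_def_qform_pos [OF pd]) auto
  ultimately show "Re (D $$ (i, i)) > 0" by simp
qed

text \<open>
  Minors of a diagonal matrix are products of diagonal entries, so each index contributes the logarithm of its entry,
  weighted by the total exponent of the sets that contain it.
\<close>

lemma log_ratio_diagonal:
  assumes pd: "pos_def n D" and diag: "diagonal_mat D"
  shows "set_inner n (formal_log n r) (log_minor D) = (\<Sum>i<n. index_degree n r i * ln (Re (D $$ (i, i))))"
proof -
  have D: "D \<in> carrier_mat n n" using pd by (rule pos_def_carrier)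
  have lm: "log_minor D S = (\<Sum>i<n. if i \<in> S then ln (Re (D $$ (i, i))) else 0)" if S: "S \<subseteq> {..<n}" for S
  proof -
    have eq: "D $$ (i, i) = of_real (Re (D $$ (i, i)))" if "i \<in> S" for i
      using pos_def_diag_entries(1) [OF pd, of i] that S by (auto simp: complex_eq_iff)
    have "pminor D S = Re (\<Prod>i\<in>S. of_real (Re (D $$ (i, i))))"
      using diagonal_minor [OF D diag S] eq by (simp add: pminor_eq_row_mask [OF D S])
    also have "\<dots> = (\<Prod>i\<in>S. Re (D $$ (i, i)))"
      by (simp flip: of_real_prod)
    finally have "log_minor D S = (\<Sum>i\<in>S. ln (Re (D $$ (i, i))))"
      unfolding log_minor_def
    proof (simp only:, intro ln_prod)
      show "finite S" using S finite_subset by blast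
      show "Re (D $$ (i, i)) \<noteq> 0" if "i \<in> S" for i
        using pos_def_diag_entries(2) [OF pd, of i] that S by force
    qed
    also have "\<dots> = (\<Sum>i<n. if i \<in> S then ln (Re (D $$ (i, i))) else 0)"
      using S by (intro sum.mono_neutral_cong_left) auto
    finally show ?thesis .
  qed
  have "set_inner n (formal_log n r) (log_minor D)
      = (\<Sum>S\<in>Pow {..<n}. \<Sum>i<n. if i \<in> S then formal_log n r S * ln (Re (D $$ (i, i))) else 0)"
    unfolding set_inner_def
    by (intro sum.cong refl) (auto simp: lm sum_distrib_left intro!: sum.cong)
  also have "\<dots> = (\<Sum>i<n. \<Sum>S\<in>Pow {..<n}. if i \<in> S then formal_log n r S * ln (Re (D $$ (i, i))) else 0)"
    by (rule sum.swap)
  also have "\<dots> = (\<Sum>i<n. index_degree n r i * ln (Re (D $$ (i, i))))"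
    by (intro sum.cong refl, simp only: index_degree_def sum_distrib_right, subst sum.inter_filter) auto
  finally show ?thesis .
qed

lemma pos_def_scaled_index:
  assumes "c > 0"
  shows "pos_def n (mat n n (\<lambda>(a, b). if a = b then (if a = i then of_real c else 1) else 0))"
    (is "pos_def n ?D")
proof -
  have D: "?D \<in> carrier_mat n n" by simp
  have herm: "?D $$ (a, b) = cnj (?D $$ (b, a))" if "a < n" "b < n" for a b
    using that by auto
  have "Re (qform ?D f f) > 0" if nz: "\<exists>a<n. f a \<noteq> 0" for f
  proof -
    have row: "(\<Sum>b<n. ?D $$ (a, b) * f b) = (if a = i then of_real c else 1) * f a" if "a < n" for a
    proof -
      have "(\<Sum>b<n. ?D $$ (a, b) * f b) = (\<Sum>b<n. if b = a then (if a = i then of_real c else 1) * f b else 0)"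
        using that by (intro sum.cong) auto
      then show ?thesis using that by simp
    qed
    have "Re (qform ?D f f) = (\<Sum>a<n. Re (cnj (f a) * ((if a = i then of_real c else 1) * f a)))"
      using row by (simp add: qform_def)
    also have "\<dots> = (\<Sum>a<n. (if a = i then c else 1) * (cmod (f a))\<^sup>2)"
      by (intro sum.cong refl) (simp only: cmod_power2, simp add: power2_eq_square algebra_simps)
    finally have "Re (qform ?D f f) = (\<Sum>a<n. (if a = i then c else 1) * (cmod (f a))\<^sup>2)" .
    moreover obtain a where "a < n" "f a \<noteq> 0" using nz by blast
    ultimately show ?thesis using assms by (auto intro!: sum_pos2 [of _ a])
  qed
  then show ?thesis using pos_def_iff_qform [OF D herm] by blast
qed

lemma log_ratio_scaled_index:
  assumes "i < n"
  obtains D where "pos_def n D" "diagonal_mat D"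
    and "set_inner n (formal_log n r) (log_minor D) = index_degree n r i * s"
proof -
  let ?D = "mat n n (\<lambda>(a, b). if a = b then (if a = i then of_real (exp s) else 1) else 0) :: complex mat"
  have pd: "pos_def n ?D" by (rule pos_def_scaled_index) simp
  have diag: "diagonal_mat ?D" by (simp add: diagonal_mat_def)
  have "(\<Sum>a<n. index_degree n r a * ln (Re (?D $$ (a, a)))) = (\<Sum>a<n. if a = i then index_degree n r a * s else 0)"
    by (intro sum.cong refl) auto
  then show ?thesis using that [OF pd diag] log_ratio_diagonal [OF pd diag, of r] assms by simp
qed

text \<open>
  On positive definite diagonal matrices the logarithm of the ratio is a linear form in the logarithms of the entries,
  with the degrees of the indices as coefficients; it vanishes identically exactly when all degrees do.
\<close>

lemma homogeneous_iff_degree: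
  "r \<in> homogeneous_ratios n \<longleftrightarrow> r \<in> ratios n \<and> (\<forall>i<n. index_degree n r i = 0)"
proof (intro iffI conjI allI impI)
  assume hom: "r \<in> homogeneous_ratios n"
  then show r: "r \<in> ratios n" by (simp add: homogeneous_ratios_def)
  fix i assume "i < n"
  then obtain D where D: "pos_def n D" "diagonal_mat D"
    "set_inner n (formal_log n r) (log_minor D) = index_degree n r i * 1"
    using log_ratio_scaled_index by blast
  moreover have "ratio_val r D = 1" using hom D by (simp add: homogeneous_ratios_def)
  ultimately show "index_degree n r i = 0" using ln_ratio_val(2) [OF D(1) r] by simp
next
  assume r: "r \<in> ratios n \<and> (\<forall>i<n. index_degree n r i = 0)"
  have "ratio_val r D = 1" if "pos_def n D" "diagonal_mat D" for D
  proof -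
    have "ln (ratio_val r D) = 0" using ln_ratio_val(2) [OF that(1)] log_ratio_diagonal [OF that] r by simp
    moreover have "ratio_val r D > 0" using ln_ratio_val(1) [OF that(1)] r by blast
    ultimately show ?thesis by simp
  qed
  then show "r \<in> homogeneous_ratios n" using r by (simp add: homogeneous_ratios_def)
qed

text \<open>
  Scaling the index \<open>i\<close> by \<open>exp s\<close> gives the logarithm the value \<open>s\<close> times the
  degree of \<open>i\<close>, which is unbounded in \<open>s\<close> unless the degree is zero.
\<close>

lemma bounded_imp_homogeneous:
  assumes "r \<in> bounded_ratios n"
  shows "r \<in> homogeneous_ratios n"
proof -
  have r: "r \<in> ratios n" and "bounded_ratio n r" using assms by (auto simp: bounded_ratios_def)
  then obtain C where C: "\<And>A. pos_def n A \<Longrightarrow> set_inner n (formal_log n r) (log_minor A) \<le> C"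
    using bounded_ratio_iff by blast
  have "index_degree n r i = 0" if i: "i < n" for i
  proof (rule ccontr)
    let ?h = "index_degree n r i"
    assume h: "?h \<noteq> 0"
    obtain D where "pos_def n D" "set_inner n (formal_log n r) (log_minor D) = ?h * ((\<bar>C\<bar> + 1) / ?h)"
      using log_ratio_scaled_index [OF i] by metis
    then have "\<bar>C\<bar> + 1 \<le> C" using C h by fastforce
    then show False by simp
  qed
  then show ?thesis using r by (simp add: homogeneous_iff_degree)
qed

text \<open>
  Along \<open>M\<^sup>* M + t I\<close> the logarithm of the ratio divided by \<open>ln t\<close> tends to the inner
  product, and an upper bound on the logarithm becomes a lower bound tending to zero, because \<open>ln t\<close> is
  negative.
\<close>

lemma bounded_imp_nullity_nonneg:
  assumes r: "r \<in> bounded_ratios n" and M: "dim_col M = n"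
  shows "set_inner n (formal_log n r) (nullity_type M) \<ge> 0"
proof -
  have "r \<in> ratios n" and "bounded_ratio n r" using r by (auto simp: bounded_ratios_def)
  then obtain C where C: "\<And>A. pos_def n A \<Longrightarrow> set_inner n (formal_log n r) (log_minor A) \<le> C"
    using bounded_ratio_iff by blast
  let ?f = "\<lambda>t. set_inner n (formal_log n r) (log_minor (shifted_gram M t)) / ln t"
  have "((\<lambda>t. \<Sum>S\<in>Pow {..<n}. formal_log n r S * (log_minor (shifted_gram M t) S / ln t))
      \<longlongrightarrow> (\<Sum>S\<in>Pow {..<n}. formal_log n r S * nullity_type M S)) (at_right 0)"
  proof (intro tendsto_sum tendsto_mult tendsto_const)
    fix S assume S: "S \<in> Pow {..<n}"
    show "((\<lambda>t. log_minor (shifted_gram M t) S / ln t) \<longlongrightarrow> nullity_type M S) (at_right 0)"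
      using log_minor_shifted_gram [OF M, of S] S M by (cases "S = {}") (auto simp: nullity_type_def)
  qed
  then have lim: "(?f \<longlongrightarrow> set_inner n (formal_log n r) (nullity_type M)) (at_right 0)"
    by (simp add: set_inner_def sum_divide_distrib)
  have "((\<lambda>t::real. C / ln t) \<longlongrightarrow> 0) (at_right 0)"
    by (rule tendsto_divide_0 [OF tendsto_const])
       (rule filterlim_mono [OF ln_at_0 at_bot_le_at_infinity order_refl])
  then show ?thesis
  proof (rule tendsto_le [OF trivial_limit_at_right_real lim])
    have "\<forall>\<^sub>F t in at_right (0::real). t \<in> {0<..<1}"
      by (rule eventually_at_right_real) simp
    then show "\<forall>\<^sub>F t in at_right 0. C / ln t \<le> ?f t"
    proof eventually_elim
      case (elim t)
      then have "pos_def n (shifted_gram M t)" using M by (intro pos_def_shifted_gram) auto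
      from C [OF this] show ?case using elim by (intro divide_right_mono_neg) auto
    qed
  qed
qed

theorem bounded_ratios_subset_D: "bounded_ratios n \<subseteq> D_ratios n"
  using bounded_imp_homogeneous bounded_imp_nullity_nonneg by (auto simp: D_ratios_def)

section \<open>Cones with a generator in every face\<close>

text \<open>
  The part of linearity that is preserved along rays; it avoids a vector space structure on functions.
\<close>

definition functional :: "(('a \<Rightarrow> real) \<Rightarrow> real) \<Rightarrow> bool" where
  "functional \<phi> \<longleftrightarrow> (\<forall>x g d. \<phi> (\<lambda>s. x s - d * g s) = \<phi> x - d * \<phi> g)"

text \<open>
  The inequalities \<open>\<phi> x \<ge> 0\<close> for \<open>\<phi>\<close> in \<open>F\<close> define a cone. If
  every nonzero face contains a generator, every point of the cone is a nonnegative combination of generators, here in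
  the dual form that a functional \<open>\<Phi>\<close> which is nonnegative on the generators is nonnegative on the
  cone. Let \<open>g\<close> be a generator in the smallest face containing \<open>x\<close> and subtract the largest
  multiple of \<open>g\<close> that stays in the cone. Tight inequalities stay tight and one more becomes tight, so
  the number of strict inequalities decreases.
\<close>

lemma peeling:
  fixes F :: "(('a \<Rightarrow> real) \<Rightarrow> real) set"
  assumes fin: "finite F" and lin: "\<And>\<phi>. \<phi> \<in> F \<Longrightarrow> functional \<phi>" and "functional \<Phi>"
    and genF: "\<And>\<phi> g. \<phi> \<in> F \<Longrightarrow> g \<in> G \<Longrightarrow> \<phi> g \<ge> 0"
    and gen: "\<And>g. g \<in> G \<Longrightarrow> \<Phi> g \<ge> 0"
    and zero: "\<And>x. (\<And>\<phi>. \<phi> \<in> F \<Longrightarrow> \<phi> x = 0) \<Longrightarrow> \<Phi> x \<ge> 0"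
    and face: "\<And>x. (\<And>\<phi>. \<phi> \<in> F \<Longrightarrow> \<phi> x \<ge> 0) \<Longrightarrow> \<exists>\<phi>\<in>F. \<phi> x \<noteq> 0 \<Longrightarrow>
      \<exists>g\<in>G. (\<exists>\<phi>\<in>F. \<phi> g \<noteq> 0) \<and> (\<forall>\<phi>\<in>F. \<phi> x = 0 \<longrightarrow> \<phi> g = 0)"
    and x: "\<And>\<phi>. \<phi> \<in> F \<Longrightarrow> \<phi> x \<ge> 0"
  shows "\<Phi> x \<ge> 0"
  using x
proof (induction "card {\<phi> \<in> F. \<phi> x \<noteq> 0}" arbitrary: x rule: less_induct)
  case less
  show ?case
  proof (cases "\<exists>\<phi>\<in>F. \<phi> x \<noteq> 0")
    case False
    then show ?thesis using zero by blast
  next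
    case True
    then obtain g where g: "g \<in> G" "\<exists>\<phi>\<in>F. \<phi> g \<noteq> 0" and tight: "\<And>\<phi>. \<phi> \<in> F \<Longrightarrow> \<phi> x = 0 \<Longrightarrow> \<phi> g = 0"
      using face [of x] less.prems by blast
    let ?P = "{\<phi> \<in> F. \<phi> g > 0}"
    define d where "d = Min ((\<lambda>\<phi>. \<phi> x / \<phi> g) ` ?P)"
    have P: "finite ?P" "?P \<noteq> {}" using fin g genF by (auto simp: order_le_less)
    have dle: "d \<le> \<phi> x / \<phi> g" if "\<phi> \<in> ?P" for \<phi>
      unfolding d_def using P that by (intro Min_le) auto
    have "d \<in> (\<lambda>\<phi>. \<phi> x / \<phi> g) ` ?P" unfolding d_def using P by (intro Min_in) auto
    then obtain \<phi>0 where \<phi>0: "\<phi>0 \<in> F" "\<phi>0 g > 0" "d = \<phi>0 x / \<phi>0 g" by auto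
    have pos0: "\<phi>0 x > 0" using tight [OF \<phi>0(1)] less.prems [OF \<phi>0(1)] \<phi>0(2) by force
    then have d: "d > 0" using \<phi>0 by simp
    define x' where "x' = (\<lambda>s. x s - d * g s)"
    have val: "\<phi> x' = \<phi> x - d * \<phi> g" if "functional \<phi>" for \<phi>
      using that by (simp add: functional_def x'_def)
    have nonneg: "\<phi> x' \<ge> 0" if "\<phi> \<in> F" for \<phi>
    proof (cases "\<phi> g > 0")
      case True
      then show ?thesis using dle [of \<phi>] that by (simp add: val lin field_simps)
    next
      case False
      then have "\<phi> g = 0" using genF [OF that g(1)] by simp
      then show ?thesis using less.prems [OF that] by (simp add: val lin that)
    qed
    have "\<phi>0 x' = 0" using \<phi>0 by (simp add: val lin)
    moreover have "\<phi> x \<noteq> 0" if "\<phi> \<in> F" "\<phi> x' \<noteq> 0" for \<phi>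
      using that tight by (auto simp: val lin)
    ultimately have "card {\<phi> \<in> F. \<phi> x' \<noteq> 0} < card {\<phi> \<in> F. \<phi> x \<noteq> 0}"
      using fin \<phi>0(1) pos0 by (intro psubset_card_mono) auto
    then have "\<Phi> x' \<ge> 0" using less.hyps [of x'] nonneg by blast
    moreover have "\<Phi> x = \<Phi> x' + d * \<Phi> g" using val [OF \<open>functional \<Phi>\<close>] by simp
    ultimately show ?thesis using gen [OF g(1)] d by simp
  qed
qed

section \<open>The cone of the 23 inequalities and its generators\<close>

definition low_sets :: "nat \<Rightarrow> nat set set" where
  "low_sets m = {Q. Q \<subseteq> {..<4} \<and> card Q = m}"

text \<open>
  The 23 functionals, in the order of the list in the introductory text. The vertex numbers are the values at
  singletons and the edge numbers the values at pairs.
\<close>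

definition facets :: "(set_vec \<Rightarrow> real) set" where
  "facets =
     {\<lambda>v. v {}} \<union> (\<lambda>d v. v {d}) ` {..<4} \<union> (\<lambda>Q v. v Q) ` low_sets 2
   \<union> (\<lambda>d v. (\<Sum>c\<in>{..<4} - {d}. v {c, d}) - v {d}) ` {..<4}
   \<union> {\<lambda>v. (\<Sum>Q\<in>low_sets 2. v Q) + v {} - (\<Sum>d<4. v {d})}
   \<union> (\<lambda>Q v. v ({..<4} - Q) + (\<Sum>c\<in>Q. v {c}) - v {}) ` low_sets 2
   \<union> {\<lambda>v. (\<Sum>d<4. v {d}) - 2 * v {}}"

definition unit_at :: "nat set \<Rightarrow> set_vec" where
  "unit_at Q = (\<lambda>S. if S = Q then 1 else 0)"

text \<open>
  In terms of ratios: the first, second and fourth vector are the Koteljanskii ratios on \<open>{i, j}\<close> given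
  \<open>{k, l}\<close>, given \<open>{l}\<close> and given the empty set; the third is the Ingleton ratio; the last
  four are supported on the star at \<open>l\<close> and are the ratios bounded in \<open>log_star_pair_dual\<close>,
  \<open>log_star_square\<close>, \<open>log_star_square_dual\<close> and \<open>log_star_pair\<close>.
\<close>

definition generators_at :: "nat \<Rightarrow> nat \<Rightarrow> nat \<Rightarrow> nat \<Rightarrow> set_vec set" where
  "generators_at i j k l = {
     (\<lambda>S. unit_at {k, l} S),
     (\<lambda>S. unit_at {k, l} S + unit_at {l} S),
     (\<lambda>S. unit_at {i, j} S + unit_at {k, l} S + unit_at {k} S + unit_at {l} S),
     (\<lambda>S. unit_at {k, l} S + unit_at {k} S + unit_at {l} S + unit_at {} S),
     (\<lambda>S. unit_at {i, l} S + unit_at {j, l} S + unit_at {k, l} S + 2 * unit_at {l} S + unit_at {} S),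
     (\<lambda>S. unit_at {i, l} S + unit_at {j, l} S + unit_at {k, l} S + 3 * unit_at {l} S + unit_at {} S),
     (\<lambda>S. unit_at {i, l} S + unit_at {j, l} S + unit_at {k, l} S
            + unit_at {i} S + unit_at {j} S + unit_at {k} S + unit_at {} S),
     (\<lambda>S. unit_at {i, l} S + unit_at {j, l} S + unit_at {k, l} S
            + unit_at {i} S + unit_at {j} S + unit_at {k} S + unit_at {l} S + 2 * unit_at {} S)}"

definition cone_generators :: "set_vec set" where
  "cone_generators = {g. \<exists>i j k l. labels4 i j k l \<and> g \<in> generators_at i j k l}"

lemma Pow_labels:
  assumes lab: "labels4 i j k l"
  shows "Pow {..<4} = {{}, {i}, {j}, {k}, {l}, {i, j}, {i, k}, {i, l}, {j, k}, {j, l}, {k, l},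
    {i, j, k}, {i, j, l}, {i, k, l}, {j, k, l}, {i, j, k, l}}"
proof -
  have "{..<4} = {i, j, k, l}" using lab by (simp add: labels4_def)
  then show ?thesis by (simp add: Pow_insert) auto
qed

lemma low_sets_labels:
  assumes lab: "labels4 i j k l"
  shows "low_sets 2 = {{i, j}, {i, k}, {i, l}, {j, k}, {j, l}, {k, l}}"
proof -
  note ne = labels4_distinct [OF lab]
  have "low_sets 2 = {Q \<in> Pow {..<4}. card Q = 2}" by (auto simp: low_sets_def)
  also have "\<dots> = {{i, j}, {i, k}, {i, l}, {j, k}, {j, l}, {k, l}}"
    unfolding Pow_labels [OF lab] by (auto simp: ne card_insert_if)
  finally show ?thesis .
qed

text \<open>
  All 23 functionals in a fixed naming of the indices. The relation \<open>R\<close> is a parameter because the values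
  at two vectors have to be compared: for nonnegativity one of them is ignored, and for membership in a face the zeros
  of one must be zeros of the other.
\<close>

lemma facets_relation:
  assumes lab: "labels4 i j k l"
  shows "(\<forall>\<phi>\<in>facets. R (\<phi> x) (\<phi> g)) \<longleftrightarrow>
    R (x {}) (g {}) \<and> R (x {i}) (g {i}) \<and> R (x {j}) (g {j}) \<and> R (x {k}) (g {k}) \<and> R (x {l}) (g {l}) \<and>
    R (x {i, j}) (g {i, j}) \<and> R (x {i, k}) (g {i, k}) \<and> R (x {i, l}) (g {i, l}) \<and>
    R (x {j, k}) (g {j, k}) \<and> R (x {j, l}) (g {j, l}) \<and> R (x {k, l}) (g {k, l}) \<and>
    R (x {i, j} + x {i, k} + x {i, l} - x {i}) (g {i, j} + g {i, k} + g {i, l} - g {i}) \<and>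
    R (x {i, j} + x {j, k} + x {j, l} - x {j}) (g {i, j} + g {j, k} + g {j, l} - g {j}) \<and>
    R (x {i, k} + x {j, k} + x {k, l} - x {k}) (g {i, k} + g {j, k} + g {k, l} - g {k}) \<and>
    R (x {i, l} + x {j, l} + x {k, l} - x {l}) (g {i, l} + g {j, l} + g {k, l} - g {l}) \<and>
    R (x {i, j} + x {i, k} + x {i, l} + x {j, k} + x {j, l} + x {k, l} + x {} - (x {i} + x {j} + x {k} + x {l}))
      (g {i, j} + g {i, k} + g {i, l} + g {j, k} + g {j, l} + g {k, l} + g {} - (g {i} + g {j} + g {k} + g {l})) \<and>
    R (x {k, l} + x {i} + x {j} - x {}) (g {k, l} + g {i} + g {j} - g {}) \<and>
    R (x {j, l} + x {i} + x {k} - x {}) (g {j, l} + g {i} + g {k} - g {}) \<and>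
    R (x {j, k} + x {i} + x {l} - x {}) (g {j, k} + g {i} + g {l} - g {}) \<and>
    R (x {i, l} + x {j} + x {k} - x {}) (g {i, l} + g {j} + g {k} - g {}) \<and>
    R (x {i, k} + x {j} + x {l} - x {}) (g {i, k} + g {j} + g {l} - g {}) \<and>
    R (x {i, j} + x {k} + x {l} - x {}) (g {i, j} + g {k} + g {l} - g {}) \<and>
    R (x {i} + x {j} + x {k} + x {l} - 2 * x {}) (g {i} + g {j} + g {k} + g {l} - 2 * g {})"
proof -
  note ne = labels4_distinct [OF lab]
  have N: "{..<4} = {i, j, k, l}" using lab by (simp add: labels4_def)
  have comm: "{j, i} = {i, j}" "{k, i} = {i, k}" "{l, i} = {i, l}" "{k, j} = {j, k}" "{l, j} = {j, l}" "{l, k} = {k, l}"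
    by auto
  show ?thesis
    unfolding facets_def low_sets_labels [OF lab] N
    by (simp only: ball_Un ball_simps image_insert image_empty,
        simp add: ne insert_Diff_if comm doubleton_eq_iff add.assoc)
qed

lemma sorted_labels:
  fixes z :: "nat \<Rightarrow> real"
  obtains i j k l where "labels4 i j k l" "z i \<le> z j" "z j \<le> z k" "z k \<le> z l"
proof -
  let ?s = "sort_key z [0, 1, 2, 3]"
  have "\<exists>i j k l. xs = [i, j, k, l]" if "length xs = 4" for xs :: "nat list"
    using that by (auto simp: eval_nat_numeral length_Suc_conv)
  moreover have "length ?s = 4" by simp
  ultimately obtain i j k l where s: "?s = [i, j, k, l]" by blast
  have "set ?s = {0, 1, 2, 3}" "distinct ?s" "sorted (map z ?s)"
    by (simp_all only: set_sort distinct_sort sorted_sort_key) simp_all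
  then have "labels4 i j k l" "z i \<le> z j" "z j \<le> z k" "z k \<le> z l"
    unfolding s by (auto simp: labels4_def)
  then show ?thesis using that by blast
qed


lemma facets_nonneg_labels:
  assumes lab: "labels4 i j k l" and K: "\<forall>\<phi>\<in>facets. \<phi> x \<ge> 0"
  shows "x {} \<ge> 0" "x {i} \<ge> 0" "x {j} \<ge> 0" "x {k} \<ge> 0" "x {l} \<ge> 0"
    "x {i, j} \<ge> 0" "x {i, k} \<ge> 0" "x {i, l} \<ge> 0" "x {j, k} \<ge> 0" "x {j, l} \<ge> 0" "x {k, l} \<ge> 0"
    "x {i} \<le> x {i, j} + x {i, k} + x {i, l}" "x {j} \<le> x {i, j} + x {j, k} + x {j, l}"
    "x {k} \<le> x {i, k} + x {j, k} + x {k, l}" "x {l} \<le> x {i, l} + x {j, l} + x {k, l}"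
    "x {i} + x {j} + x {k} + x {l}
      \<le> x {i, j} + x {i, k} + x {i, l} + x {j, k} + x {j, l} + x {k, l} + x {}"
    "x {} \<le> x {k, l} + x {i} + x {j}" "x {} \<le> x {j, l} + x {i} + x {k}"
    "x {} \<le> x {j, k} + x {i} + x {l}" "x {} \<le> x {i, l} + x {j} + x {k}"
    "x {} \<le> x {i, k} + x {j} + x {l}" "x {} \<le> x {i, j} + x {k} + x {l}"
    "2 * x {} \<le> x {i} + x {j} + x {k} + x {l}"
  using K unfolding facets_relation [OF lab, of "\<lambda>a b. a \<ge> 0" x x]
  by (elim conjE, linarith)+

text \<open>
  The vector \<open>g\<close> is nonzero and lies in the linear span of the smallest face that contains
  \<open>x\<close>.
\<close>

definition in_face :: "set_vec \<Rightarrow> set_vec \<Rightarrow> bool" where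
  "in_face x g \<longleftrightarrow> (\<exists>\<phi>\<in>facets. \<phi> g \<noteq> 0) \<and> (\<forall>\<phi>\<in>facets. \<phi> x = 0 \<longrightarrow> \<phi> g = 0)"

lemma in_faceI:
  assumes lab: "labels4 i j k l" and "g {k, l} \<noteq> 0" and "\<forall>\<phi>\<in>facets. \<phi> x = 0 \<longrightarrow> \<phi> g = 0"
  shows "in_face x g"
proof -
  have "{k, l} \<in> low_sets 2" using low_sets_labels [OF lab] by simp
  then have "(\<lambda>v. v {k, l}) \<in> facets" unfolding facets_def by blast
  then show ?thesis using assms(2,3) unfolding in_face_def by (intro conjI bexI [of _ "\<lambda>v. v {k, l}"]) simp_all
qed

text \<open>
  Each of the following eight lemmas provides one of the generators: under the stated conditions every inequality that
  is strict at the generator is strict at \<open>x\<close>.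
\<close>

lemma face_edge:
  assumes lab: "labels4 i j k l" and K: "\<forall>\<phi>\<in>facets. \<phi> x \<ge> 0"
    and h: "x {} = 0" "x {i} = 0" "x {j} = 0" "x {k} = 0" "x {l} = 0" "x {k, l} > 0"
  shows "\<exists>g\<in>cone_generators. in_face x g"
proof
  note ne = labels4_distinct [OF lab] and F = facets_nonneg_labels [OF lab K]
  let ?g = "\<lambda>S. unit_at {k, l} S"
  show "?g \<in> cone_generators" using lab unfolding cone_generators_def generators_at_def by blast
  show "in_face x ?g"
  proof (rule in_faceI [OF lab])
    show "?g {k, l} \<noteq> 0" by (simp add: unit_at_def ne)
    show "\<forall>\<phi>\<in>facets. \<phi> x = 0 \<longrightarrow> \<phi> ?g = 0"
      unfolding facets_relation [OF lab, of "\<lambda>a b. a = 0 \<longrightarrow> b = 0"]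
      by (simp add: unit_at_def ne doubleton_eq_iff) (use h F in \<open>intro conjI notI; linarith\<close>)
  qed
qed

lemma face_edge_vertex:
  assumes lab: "labels4 i j k l" and K: "\<forall>\<phi>\<in>facets. \<phi> x \<ge> 0"
    and h: "x {} = 0" "x {k, l} > 0" "x {l} > 0" "x {k} < x {i, k} + x {j, k} + x {k, l}"
  shows "\<exists>g\<in>cone_generators. in_face x g"
proof
  note ne = labels4_distinct [OF lab] and F = facets_nonneg_labels [OF lab K]
  let ?g = "\<lambda>S. unit_at {k, l} S + unit_at {l} S"
  show "?g \<in> cone_generators" using lab unfolding cone_generators_def generators_at_def by blast
  show "in_face x ?g"
  proof (rule in_faceI [OF lab])
    show "?g {k, l} \<noteq> 0" by (simp add: unit_at_def ne)
    show "\<forall>\<phi>\<in>facets. \<phi> x = 0 \<longrightarrow> \<phi> ?g = 0"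
      unfolding facets_relation [OF lab, of "\<lambda>a b. a = 0 \<longrightarrow> b = 0"]
      by (simp add: unit_at_def ne doubleton_eq_iff) (use h F in \<open>intro conjI notI; linarith\<close>)
  qed
qed

lemma face_Ingleton:
  assumes lab: "labels4 i j k l" and K: "\<forall>\<phi>\<in>facets. \<phi> x \<ge> 0"
    and h: "x {} = 0" "x {k, l} > 0" "x {l} > 0" "x {k} > 0"
      "x {k} = x {i, k} + x {j, k} + x {k, l}" "x {l} = x {i, l} + x {j, l} + x {k, l}"
  shows "\<exists>g\<in>cone_generators. in_face x g"
proof
  note ne = labels4_distinct [OF lab] and F = facets_nonneg_labels [OF lab K]
  have key: "x {i} + x {j} + x {k, l} \<le> x {i, j}" using h F(16) by linarith
  let ?g = "\<lambda>S. unit_at {i, j} S + unit_at {k, l} S + unit_at {k} S + unit_at {l} S"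
  show "?g \<in> cone_generators" using lab unfolding cone_generators_def generators_at_def by blast
  show "in_face x ?g"
  proof (rule in_faceI [OF lab])
    show "?g {k, l} \<noteq> 0" by (simp add: unit_at_def ne)
    show "\<forall>\<phi>\<in>facets. \<phi> x = 0 \<longrightarrow> \<phi> ?g = 0"
      unfolding facets_relation [OF lab, of "\<lambda>a b. a = 0 \<longrightarrow> b = 0"]
      by (simp add: unit_at_def ne doubleton_eq_iff) (use key h(1-4) F(2,3,6-11) in \<open>intro conjI notI; linarith\<close>)
  qed
qed

lemma face_edge_both_vertices:
  assumes lab: "labels4 i j k l" and K: "\<forall>\<phi>\<in>facets. \<phi> x \<ge> 0"
    and h: "x {} > 0" "x {k, l} > 0" "x {k} > 0" "x {l} > 0" "x {} < x {i, j} + x {k} + x {l}"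
  shows "\<exists>g\<in>cone_generators. in_face x g"
proof
  note ne = labels4_distinct [OF lab] and F = facets_nonneg_labels [OF lab K]
  let ?g = "\<lambda>S. unit_at {k, l} S + unit_at {k} S + unit_at {l} S + unit_at {} S"
  show "?g \<in> cone_generators" using lab unfolding cone_generators_def generators_at_def by blast
  show "in_face x ?g"
  proof (rule in_faceI [OF lab])
    show "?g {k, l} \<noteq> 0" by (simp add: unit_at_def ne)
    show "\<forall>\<phi>\<in>facets. \<phi> x = 0 \<longrightarrow> \<phi> ?g = 0"
      unfolding facets_relation [OF lab, of "\<lambda>a b. a = 0 \<longrightarrow> b = 0"]
      by (simp add: unit_at_def ne doubleton_eq_iff) (use h F in \<open>intro conjI notI; linarith\<close>)
  qed
qed

lemma face_star_double:
  assumes lab: "labels4 i j k l" and K: "\<forall>\<phi>\<in>facets. \<phi> x \<ge> 0"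
    and h: "x {} > 0" "x {i} = 0" "x {j} = 0" "x {k} = 0"
      "x {l} < x {i, l} + x {j, l} + x {k, l}"
  shows "\<exists>g\<in>cone_generators. in_face x g"
proof
  note ne = labels4_distinct [OF lab] and F = facets_nonneg_labels [OF lab K]
  let ?g = "\<lambda>S. unit_at {i, l} S + unit_at {j, l} S + unit_at {k, l} S + 2 * unit_at {l} S + unit_at {} S"
  show "?g \<in> cone_generators" using lab unfolding cone_generators_def generators_at_def by blast
  show "in_face x ?g"
  proof (rule in_faceI [OF lab])
    show "?g {k, l} \<noteq> 0" by (simp add: unit_at_def ne)
    show "\<forall>\<phi>\<in>facets. \<phi> x = 0 \<longrightarrow> \<phi> ?g = 0"
      unfolding facets_relation [OF lab, of "\<lambda>a b. a = 0 \<longrightarrow> b = 0"]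
      by (simp add: unit_at_def ne doubleton_eq_iff) (use h F in \<open>intro conjI notI; linarith\<close>)
  qed
qed

lemma face_star_triple:
  assumes lab: "labels4 i j k l" and K: "\<forall>\<phi>\<in>facets. \<phi> x \<ge> 0"
    and h: "x {} > 0" "x {i} = 0" "x {j} = 0" "x {k} = 0"
      "x {l} = x {i, l} + x {j, l} + x {k, l}"
  shows "\<exists>g\<in>cone_generators. in_face x g"
proof
  note ne = labels4_distinct [OF lab] and F = facets_nonneg_labels [OF lab K]
  let ?g = "\<lambda>S. unit_at {i, l} S + unit_at {j, l} S + unit_at {k, l} S + 3 * unit_at {l} S + unit_at {} S"
  show "?g \<in> cone_generators" using lab unfolding cone_generators_def generators_at_def by blast
  show "in_face x ?g"
  proof (rule in_faceI [OF lab])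
    show "?g {k, l} \<noteq> 0" by (simp add: unit_at_def ne)
    show "\<forall>\<phi>\<in>facets. \<phi> x = 0 \<longrightarrow> \<phi> ?g = 0"
      unfolding facets_relation [OF lab, of "\<lambda>a b. a = 0 \<longrightarrow> b = 0"]
      by (simp add: unit_at_def ne doubleton_eq_iff) (use h F in \<open>intro conjI notI; linarith\<close>)
  qed
qed

lemma face_star_leaves:
  assumes lab: "labels4 i j k l" and K: "\<forall>\<phi>\<in>facets. \<phi> x \<ge> 0"
    and h: "x {} > 0" "x {i} > 0" "x {j} > 0" "x {k} > 0" "x {l} = 0"
      "x {i, j} = 0" "x {i, k} = 0" "x {j, k} = 0"
  shows "\<exists>g\<in>cone_generators. in_face x g"
proof
  note ne = labels4_distinct [OF lab] and F = facets_nonneg_labels [OF lab K]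
  let ?g = "\<lambda>S. unit_at {i, l} S + unit_at {j, l} S + unit_at {k, l} S
      + unit_at {i} S + unit_at {j} S + unit_at {k} S + unit_at {} S"
  show "?g \<in> cone_generators" using lab unfolding cone_generators_def generators_at_def by blast
  show "in_face x ?g"
  proof (rule in_faceI [OF lab])
    show "?g {k, l} \<noteq> 0" by (simp add: unit_at_def ne)
    show "\<forall>\<phi>\<in>facets. \<phi> x = 0 \<longrightarrow> \<phi> ?g = 0"
      unfolding facets_relation [OF lab, of "\<lambda>a b. a = 0 \<longrightarrow> b = 0"]
      by (simp add: unit_at_def ne doubleton_eq_iff) (use h F in \<open>intro conjI notI; linarith\<close>)
  qed
qed

lemma face_star_all:
  assumes lab: "labels4 i j k l" and K: "\<forall>\<phi>\<in>facets. \<phi> x \<ge> 0"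
    and h: "x {} > 0" "x {i} > 0" "x {j} > 0" "x {k} > 0" "x {l} > 0"
      "x {i, j} = 0" "x {i, k} = 0" "x {j, k} = 0" "x {i, l} > 0" "x {j, l} > 0" "x {k, l} > 0"
      "x {} = x {k} + x {l}" "x {} = x {j} + x {l}" "x {} = x {i} + x {l}"
  shows "\<exists>g\<in>cone_generators. in_face x g"
proof
  note ne = labels4_distinct [OF lab] and F = facets_nonneg_labels [OF lab K]
  have key: "x {j} = x {i}" "x {k} = x {i}" "x {} = x {i} + x {l}" "x {l} \<le> x {i}"
    "x {i} \<le> x {i, l}" "x {i} \<le> x {j, l}" "x {i} \<le> x {k, l}"
    using h F(12-14) F(23) by linarith+
  let ?g = "\<lambda>S. unit_at {i, l} S + unit_at {j, l} S + unit_at {k, l} S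
      + unit_at {i} S + unit_at {j} S + unit_at {k} S + unit_at {l} S + 2 * unit_at {} S"
  show "?g \<in> cone_generators" using lab unfolding cone_generators_def generators_at_def by blast
  show "in_face x ?g"
  proof (rule in_faceI [OF lab])
    show "?g {k, l} \<noteq> 0" by (simp add: unit_at_def ne)
    show "\<forall>\<phi>\<in>facets. \<phi> x = 0 \<longrightarrow> \<phi> ?g = 0"
      unfolding facets_relation [OF lab, of "\<lambda>a b. a = 0 \<longrightarrow> b = 0"]
      by (simp add: unit_at_def ne doubleton_eq_iff) (use key h(1-11) in \<open>intro conjI notI; linarith\<close>)
  qed
qed


text \<open>
  If \<open>w = 0\<close>, an edge \<open>c d\<close> with \<open>e > 0\<close> and \<open>z > 0\<close> at
  \<open>c\<close> gives a generator with one vertex unless the star inequalities at both \<open>c\<close> and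
  \<open>d\<close> are tight, and then the global inequality makes the opposite edge positive and the Ingleton
  generator is available. Otherwise all \<open>z\<close> vanish and a single edge is available.

  If \<open>w > 0\<close>, the number of vertices with \<open>z > 0\<close> decides. With one such vertex, a star with
  weight two or three at its centre is available, according to whether the star inequality there is strict. With two,
  the edge between them is. With three, either one of the edges between them or the star at the fourth vertex is. With
  all four, suppose that no edge with both ends is available. Then the positive edges contain at most one of each pair
  of opposite edges but meet every vertex, so they form a star, and the star with all vertices is available.
\<close>

lemma every_face_has_generator:
  assumes K: "\<forall>\<phi>\<in>facets. \<phi> x \<ge> 0" and nz: "\<exists>\<phi>\<in>facets. \<phi> x \<noteq> 0"
  shows "\<exists>g\<in>cone_generators. in_face x g"
proof (rule ccontr)
  assume none: "\<not> ?thesis"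
  obtain i j k l where lab: "labels4 i j k l"
    and sorted: "x {i} \<le> x {j}" "x {j} \<le> x {k}" "x {k} \<le> x {l}"
    using sorted_labels [of "\<lambda>m. x {m}"] by blast
  note F = facets_nonneg_labels [OF lab K] and perm = labels4_all_perms [OF lab]
  have comm: "{j, i} = {i, j}" "{k, i} = {i, k}" "{l, i} = {i, l}" "{k, j} = {j, k}" "{l, j} = {j, l}" "{l, k} = {k, l}"
    by auto
  show False
  proof (cases "x {} = 0")
    case w0: True
    have edge: "x {c} = 0"
      if abcd: "labels4 a b c d" and "x {c, d} > 0" for a b c d
    proof (rule ccontr)
      assume "x {c} \<noteq> 0"
      note F' = facets_nonneg_labels [OF abcd K]
      have c: "x {c} > 0" using \<open>x {c} \<noteq> 0\<close> F' by simp
      have dc: "{d, c} = {c, d}" by auto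
      have "\<not> x {d} < x {a, d} + x {b, d} + x {c, d}"
        using face_edge_vertex [OF labels4_all_perms(1) [OF abcd] K w0] none that c by (auto simp: dc)
      then have d: "x {d} = x {a, d} + x {b, d} + x {c, d}" "x {d} > 0" using F' that by linarith+
      have "\<not> x {c} < x {a, c} + x {b, c} + x {c, d}"
        using face_edge_vertex [OF abcd K w0] none that d by auto
      then have "x {c} = x {a, c} + x {b, c} + x {c, d}" using F' that by linarith
      then show False using face_Ingleton [OF abcd K w0 that(2) d(2) c _ d(1)] none by blast
    qed
    have z: "x {c} = 0" if abcd: "labels4 a b c d" for a b c d
    proof (rule ccontr)
      assume "x {c} \<noteq> 0"
      note F' = facets_nonneg_labels [OF abcd K]
      have comm: "{c, a} = {a, c}" "{c, b} = {b, c}" by auto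
      have "x {c, d} > 0 \<or> x {a, c} > 0 \<or> x {b, c} > 0" using \<open>x {c} \<noteq> 0\<close> F' by linarith
      then show False
        using edge [OF abcd] edge [of b d c a] edge [of a d c b] labels4_all_perms [OF abcd]
          \<open>x {c} \<noteq> 0\<close> by (auto simp: comm)
    qed
    have z0: "x {i} = 0" "x {j} = 0" "x {k} = 0" "x {l} = 0"
      using z perm lab by blast+
    have "\<not> x {c, d} > 0" if abcd: "labels4 a b c d" for a b c d
    proof -
      have "x {a} = 0" "x {b} = 0" "x {c} = 0" "x {d} = 0"
        using z abcd labels4_all_perms [OF abcd] by blast+
      then show ?thesis using face_edge [OF abcd K w0] none by blast
    qed
    then have e0: "x {i, j} = 0" "x {i, k} = 0" "x {i, l} = 0" "x {j, k} = 0" "x {j, l} = 0" "x {k, l} = 0"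
      using perm lab F by (metis order_le_less)+
    have "\<forall>\<phi>\<in>facets. \<phi> x = 0"
      unfolding facets_relation [OF lab, of "\<lambda>a b. a = 0" x x] by (simp add: w0 z0 e0)
    then show False using nz by blast
  next
    case False
    then have w: "x {} > 0" using F(1) by simp
    have match: "x {c, d} = 0 \<or> x {c} = 0 \<or> x {d} = 0 \<or> x {} = x {a, b} + x {c} + x {d}"
      if abcd: "labels4 a b c d" for a b c d
      using face_edge_both_vertices [OF abcd K w] none facets_nonneg_labels [OF abcd K]
      by (metis order_le_less)
    have m: "x {k, l} = 0 \<or> x {k} = 0 \<or> x {l} = 0 \<or> x {} = x {i, j} + x {k} + x {l}"
      "x {j, l} = 0 \<or> x {j} = 0 \<or> x {l} = 0 \<or> x {} = x {i, k} + x {j} + x {l}"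
      "x {i, l} = 0 \<or> x {i} = 0 \<or> x {l} = 0 \<or> x {} = x {j, k} + x {i} + x {l}"
      "x {j, k} = 0 \<or> x {j} = 0 \<or> x {k} = 0 \<or> x {} = x {i, l} + x {j} + x {k}"
      "x {i, k} = 0 \<or> x {i} = 0 \<or> x {k} = 0 \<or> x {} = x {j, l} + x {i} + x {k}"
      "x {i, j} = 0 \<or> x {i} = 0 \<or> x {j} = 0 \<or> x {} = x {k, l} + x {i} + x {j}"
      using match lab perm by blast+
    consider "x {k} = 0" | "x {j} = 0" "x {k} > 0" | "x {i} = 0" "x {j} > 0" | "x {i} > 0"
      using F(2-5) by linarith
    then show False
    proof cases
      case 1
      then have "x {i} = 0" "x {j} = 0" using sorted F by linarith+
      then show False
        using face_star_double [OF lab K w _ _ 1] face_star_triple [OF lab K w _ _ 1] none F(15)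
        by (metis order_le_less)
    next
      case 2
      then have "x {i} = 0" using sorted F by linarith
      then show False using m(1) 2 sorted w F by (smt (verit))
    next
      case 3
      have p: "x {k} > 0" "x {l} > 0" using 3 sorted by linarith+
      have "x {j, k} = 0" "x {j, l} = 0" "x {k, l} = 0"
        using m(1,2,4) 3 p w F by (smt (verit))+
      then show False
        using face_star_leaves [OF perm(9) K w] none 3 p by (simp add: comm) 
    next
      case 4
      note pi = 4
      have p: "x {j} > 0" "x {k} > 0" "x {l} > 0" using 4 sorted by linarith+
      have m': "x {k, l} = 0 \<or> x {} = x {i, j} + x {k} + x {l}" "x {j, l} = 0 \<or> x {} = x {i, k} + x {j} + x {l}"
        "x {i, l} = 0 \<or> x {} = x {j, k} + x {i} + x {l}" "x {j, k} = 0 \<or> x {} = x {i, l} + x {j} + x {k}"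
        "x {i, k} = 0 \<or> x {} = x {j, l} + x {i} + x {k}" "x {i, j} = 0 \<or> x {} = x {k, l} + x {i} + x {j}"
        using m 4 p by auto
      have ex: "x {i, j} = 0 \<or> x {k, l} = 0" "x {i, k} = 0 \<or> x {j, l} = 0" "x {i, l} = 0 \<or> x {j, k} = 0"
        using m' F(6-11) F(23) by linarith+
      have st: "x {i, j} \<noteq> 0 \<or> x {i, k} \<noteq> 0 \<or> x {i, l} \<noteq> 0" "x {i, j} \<noteq> 0 \<or> x {j, k} \<noteq> 0 \<or> x {j, l} \<noteq> 0"
        "x {i, k} \<noteq> 0 \<or> x {j, k} \<noteq> 0 \<or> x {k, l} \<noteq> 0" "x {i, l} \<noteq> 0 \<or> x {j, l} \<noteq> 0 \<or> x {k, l} \<noteq> 0"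
        using 4 p F(12-15) by linarith+
      have gt: "x {i, j} \<noteq> 0 \<Longrightarrow> x {i, j} > 0" "x {i, k} \<noteq> 0 \<Longrightarrow> x {i, k} > 0" "x {i, l} \<noteq> 0 \<Longrightarrow> x {i, l} > 0"
        "x {j, k} \<noteq> 0 \<Longrightarrow> x {j, k} > 0" "x {j, l} \<noteq> 0 \<Longrightarrow> x {j, l} > 0" "x {k, l} \<noteq> 0 \<Longrightarrow> x {k, l} > 0"
        using F(6-11) by auto
      consider
          "x {i, j} = 0" "x {i, k} = 0" "x {j, k} = 0" "x {i, l} \<noteq> 0" "x {j, l} \<noteq> 0" "x {k, l} \<noteq> 0"
        | "x {i, j} = 0" "x {i, l} = 0" "x {j, l} = 0" "x {i, k} \<noteq> 0" "x {j, k} \<noteq> 0" "x {k, l} \<noteq> 0"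
        | "x {i, k} = 0" "x {i, l} = 0" "x {k, l} = 0" "x {i, j} \<noteq> 0" "x {j, k} \<noteq> 0" "x {j, l} \<noteq> 0"
        | "x {j, k} = 0" "x {j, l} = 0" "x {k, l} = 0" "x {i, j} \<noteq> 0" "x {i, k} \<noteq> 0" "x {i, l} \<noteq> 0"
        using ex st by argo
      then show False
      proof cases
        case 1
        have "x {} = x {k} + x {l}" "x {} = x {j} + x {l}" "x {} = x {i} + x {l}"
          using 1 m' by auto
        moreover have "x {i, l} > 0" "x {j, l} > 0" "x {k, l} > 0" using 1 gt by blast+
        ultimately have "\<exists>g\<in>cone_generators. in_face x g"
          by (intro face_star_all [OF lab K w])
            (simp_all add: comm add.commute pi p 1(1-3))
        then show False using none by blast
      next
        case 2
        have "x {} = x {l} + x {k}" "x {} = x {j} + x {k}" "x {} = x {i} + x {k}"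
          using 2 m' by auto
        moreover have "x {i, k} > 0" "x {j, k} > 0" "x {k, l} > 0" using 2 gt by blast+
        ultimately have "\<exists>g\<in>cone_generators. in_face x g"
          by (intro face_star_all [OF perm(1) K w])
            (simp_all add: comm add.commute pi p 2(1-3))
        then show False using none by blast
      next
        case 3
        have "x {} = x {l} + x {j}" "x {} = x {k} + x {j}" "x {} = x {i} + x {j}"
          using 3 m' by auto
        moreover have "x {i, j} > 0" "x {j, k} > 0" "x {j, l} > 0" using 3 gt by blast+
        ultimately have "\<exists>g\<in>cone_generators. in_face x g"
          by (intro face_star_all [OF perm(3) K w])
            (simp_all add: comm add.commute pi p 3(1-3))
        then show False using none by blast
      next
        case 4
        have "x {} = x {l} + x {i}" "x {} = x {k} + x {i}" "x {} = x {j} + x {i}"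
          using 4 m' by auto
        moreover have "x {i, j} > 0" "x {i, k} > 0" "x {i, l} > 0" using 4 gt by blast+
        ultimately have "\<exists>g\<in>cone_generators. in_face x g"
          by (intro face_star_all [OF perm(9) K w])
            (simp_all add: comm add.commute pi p 4(1-3))
        then show False using none by blast
      qed
    qed
  qed
qed

section \<open>Boundedness of the ratios in the cone\<close>

lemma sum_Pow_insert:
  assumes "finite A" "a \<notin> A"
  shows "sum f (Pow (insert a A)) = sum f (Pow A) + (\<Sum>S\<in>Pow A. f (insert a S))"
proof -
  have "inj_on (insert a) (Pow A)" using assms(2) by (auto simp: inj_on_def)
  then have "sum f (insert a ` Pow A) = (\<Sum>S\<in>Pow A. f (insert a S))"
    by (simp add: sum.reindex)
  moreover have "Pow A \<inter> insert a ` Pow A = {}" using assms(2) by auto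
  ultimately show ?thesis using assms(1) by (simp add: Pow_insert sum.union_disjoint)
qed

lemma sum_Pow_labels:
  fixes f :: "nat set \<Rightarrow> real"
  assumes lab: "labels4 i j k l"
  shows "sum f (Pow {..<4}) = f {} + f {i} + f {j} + f {k} + f {l}
    + f {i, j} + f {i, k} + f {i, l} + f {j, k} + f {j, l} + f {k, l}
    + f {i, j, k} + f {i, j, l} + f {i, k, l} + f {j, k, l} + f {i, j, k, l}"
proof -
  have "{..<4} = {i, j, k, l}" using lab by (simp add: labels4_def)
  then show ?thesis using labels4_distinct [OF lab] by (simp add: sum_Pow_insert)
qed

text \<open>
  The coefficient of \<open>v Q\<close> when the inner product of \<open>x\<close> and \<open>L\<close> is rewritten
  in terms of the subset sums \<open>v\<close> of \<open>x\<close>.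
\<close>

definition mobius :: "set_vec \<Rightarrow> nat set \<Rightarrow> real" where
  "mobius L Q = (\<Sum>S\<in>Pow {..<4}. if Q \<subseteq> S then (-1) ^ (card S - card Q) * L S else 0)"

text \<open>
  Only the sets with at most two elements occur, because the subset sums of a homogeneous exponent vector vanish on
  all larger sets.
\<close>

definition pairing :: "set_vec \<Rightarrow> set_vec \<Rightarrow> real" where
  "pairing L v = v {} * mobius L {} + (\<Sum>d<4. v {d} * mobius L {d}) + (\<Sum>Q\<in>low_sets 2. v Q * mobius L Q)"

definition subset_sums :: "set_vec \<Rightarrow> set_vec" where
  "subset_sums x Q = (\<Sum>S\<in>Pow Q. x S)"

lemma mobius_labels:
  assumes lab: "labels4 i j k l"
  shows "mobius L {k, l} = L {k, l} - L {i, k, l} - L {j, k, l} + L {i, j, k, l}"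
    and "mobius L {l} = L {l} - L {i, l} - L {j, l} - L {k, l}
      + L {i, j, l} + L {i, k, l} + L {j, k, l} - L {i, j, k, l}"
    and "mobius L {} = L {} - L {i} - L {j} - L {k} - L {l}
      + L {i, j} + L {i, k} + L {i, l} + L {j, k} + L {j, l} + L {k, l}
      - L {i, j, k} - L {i, j, l} - L {i, k, l} - L {j, k, l} + L {i, j, k, l}"
  unfolding mobius_def sum_Pow_labels [OF lab]
  using labels4_distinct [OF lab] by (simp_all add: card_insert_if)

lemma mobius_all_labels:
  assumes lab: "labels4 i j k l"
  shows "mobius L {k, l} = L {k, l} - L {i, k, l} - L {j, k, l} + L {i, j, k, l}"
    and "mobius L {j, l} = L {j, l} - L {i, j, l} - L {j, k, l} + L {i, j, k, l}"
    and "mobius L {i, l} = L {i, l} - L {i, j, l} - L {i, k, l} + L {i, j, k, l}"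
    and "mobius L {i, j} = L {i, j} - L {i, j, k} - L {i, j, l} + L {i, j, k, l}"
    and "mobius L {i, k} = L {i, k} - L {i, j, k} - L {i, k, l} + L {i, j, k, l}"
    and "mobius L {j, k} = L {j, k} - L {i, j, k} - L {j, k, l} + L {i, j, k, l}"
    and "mobius L {l} = L {l} - L {i, l} - L {j, l} - L {k, l}
      + L {i, j, l} + L {i, k, l} + L {j, k, l} - L {i, j, k, l}"
    and "mobius L {k} = L {k} - L {i, k} - L {j, k} - L {k, l}
      + L {i, j, k} + L {i, k, l} + L {j, k, l} - L {i, j, k, l}"
    and "mobius L {j} = L {j} - L {i, j} - L {j, k} - L {j, l}
      + L {i, j, k} + L {i, j, l} + L {j, k, l} - L {i, j, k, l}"
    and "mobius L {i} = L {i} - L {i, j} - L {i, k} - L {i, l}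
      + L {i, j, k} + L {i, j, l} + L {i, k, l} - L {i, j, k, l}"
    and "mobius L {} = L {} - L {i} - L {j} - L {k} - L {l}
      + L {i, j} + L {i, k} + L {i, l} + L {j, k} + L {j, l} + L {k, l}
      - L {i, j, k} - L {i, j, l} - L {i, k, l} - L {j, k, l} + L {i, j, k, l}"
proof -
  note perm = labels4_all_perms [OF lab]
  show "mobius L {k, l} = L {k, l} - L {i, k, l} - L {j, k, l} + L {i, j, k, l}"
    "mobius L {j, l} = L {j, l} - L {i, j, l} - L {j, k, l} + L {i, j, k, l}"
    "mobius L {i, l} = L {i, l} - L {i, j, l} - L {i, k, l} + L {i, j, k, l}"
    "mobius L {i, j} = L {i, j} - L {i, j, k} - L {i, j, l} + L {i, j, k, l}"
    "mobius L {i, k} = L {i, k} - L {i, j, k} - L {i, k, l} + L {i, j, k, l}"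
    "mobius L {j, k} = L {j, k} - L {i, j, k} - L {j, k, l} + L {i, j, k, l}"
    using mobius_labels(1) [OF lab, of L] mobius_labels(1) [OF perm(2), of L]
      mobius_labels(1) [OF perm(8), of L] mobius_labels(1) [OF perm(16), of L]
      mobius_labels(1) [OF perm(10), of L] mobius_labels(1) [OF perm(4), of L]
    by (simp_all add: insert_commute)
  show "mobius L {l} = L {l} - L {i, l} - L {j, l} - L {k, l}
      + L {i, j, l} + L {i, k, l} + L {j, k, l} - L {i, j, k, l}"
    "mobius L {k} = L {k} - L {i, k} - L {j, k} - L {k, l}
      + L {i, j, k} + L {i, k, l} + L {j, k, l} - L {i, j, k, l}"
    "mobius L {j} = L {j} - L {i, j} - L {j, k} - L {j, l}
      + L {i, j, k} + L {i, j, l} + L {j, k, l} - L {i, j, k, l}"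
    "mobius L {i} = L {i} - L {i, j} - L {i, k} - L {i, l}
      + L {i, j, k} + L {i, j, l} + L {i, k, l} - L {i, j, k, l}"
    using mobius_labels(2) [OF lab, of L] mobius_labels(2) [OF perm(1), of L]
      mobius_labels(2) [OF perm(3), of L] mobius_labels(2) [OF perm(9), of L]
    by (simp_all add: insert_commute)
qed (rule mobius_labels(3) [OF lab])

lemma sum_low_sets_labels:
  fixes f :: "nat set \<Rightarrow> real"
  assumes lab: "labels4 i j k l"
  shows "sum f (low_sets 2) = f {i, j} + f {i, k} + f {i, l} + f {j, k} + f {j, l} + f {k, l}"
  unfolding low_sets_labels [OF lab] using labels4_distinct [OF lab] by (simp add: doubleton_eq_iff)

lemma pairing_labels:
  assumes lab: "labels4 i j k l"
  shows "pairing L v = v {} * mobius L {} + (v {i} * mobius L {i} + v {j} * mobius L {j}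
      + v {k} * mobius L {k} + v {l} * mobius L {l})
    + (v {i, j} * mobius L {i, j} + v {i, k} * mobius L {i, k} + v {i, l} * mobius L {i, l}
      + v {j, k} * mobius L {j, k} + v {j, l} * mobius L {j, l} + v {k, l} * mobius L {k, l})"
proof -
  have "{..<4} = {i, j, k, l}" using lab by (simp add: labels4_def)
  then show ?thesis using labels4_distinct [OF lab]
    by (simp add: pairing_def sum_low_sets_labels [OF lab])
qed

text \<open>
  The pairing with a generator is the logarithm of the corresponding ratio. Each generator has at least one edge, so
  the largest of the constants, multiplied by the total edge weight, bounds all of them.
\<close>

lemma generator_bounded:
  assumes pd: "pos_def 4 A" and g: "g \<in> cone_generators"
  shows "pairing (log_minor A) g \<le> ln 1024 * (\<Sum>Q\<in>low_sets 2. g Q)"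
proof -
  obtain i j k l where lab: "labels4 i j k l" and g: "g \<in> generators_at i j k l"
    using g unfolding cone_generators_def by blast
  note ne = labels4_distinct [OF lab] and lt = labels4_less [OF lab]
  note perm = labels4_all_perms [OF lab]
  let ?L = "log_minor A"
  define c where "c = ln (1024::real)"
  have lns: "0 \<le> c" "ln 32 \<le> c" "ln 96 \<le> c" by (simp_all add: c_def)
  have val: "pairing ?L g = g {} * mobius ?L {} + (g {i} * mobius ?L {i} + g {j} * mobius ?L {j}
      + g {k} * mobius ?L {k} + g {l} * mobius ?L {l})
    + (g {i, j} * mobius ?L {i, j} + g {i, k} * mobius ?L {i, k} + g {i, l} * mobius ?L {i, l}
      + g {j, k} * mobius ?L {j, k} + g {j, l} * mobius ?L {j, l} + g {k, l} * mobius ?L {k, l})"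
    by (rule pairing_labels [OF lab])
  note eval = val sum_low_sets_labels [OF lab] mobius_all_labels [OF lab]
  have a: "?L {i, j, k, l} + ?L {k, l} \<le> ?L {i, k, l} + ?L {j, k, l}"
    using log_Koteljanskii [OF pd, of "{k, l}" i j] by (simp add: lt ne)
  have b: "?L {i, j, l} + ?L {l} \<le> ?L {i, l} + ?L {j, l}"
    using log_Koteljanskii [OF pd, of "{l}" i j] by (simp add: lt ne)
  have d: "?L {i, j} \<le> ?L {i} + ?L {j}"
    using log_Koteljanskii [OF pd, of "{}" i j] by (simp add: lt ne)
  have "pairing ?L g \<le> c * (\<Sum>Q\<in>low_sets 2. g Q)"
    using g unfolding generators_at_def
  proof (elim insertE emptyE)
    assume "g = (\<lambda>S. unit_at {k, l} S)"
    then show ?thesis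
      unfolding eval using a lns
      by (simp add: unit_at_def ne doubleton_eq_iff insert_commute)
  next
    assume "g = (\<lambda>S. unit_at {k, l} S + unit_at {l} S)"
    then show ?thesis
      unfolding eval using b lns
      by (simp add: unit_at_def ne doubleton_eq_iff insert_commute)
  next
    assume "g = (\<lambda>S. unit_at {i, j} S + unit_at {k, l} S + unit_at {k} S + unit_at {l} S)"
    then show ?thesis
      unfolding eval using log_Ingleton [OF pd perm(16)] lns
      by (simp add: unit_at_def ne doubleton_eq_iff insert_commute)
  next
    assume "g = (\<lambda>S. unit_at {k, l} S + unit_at {k} S + unit_at {l} S + unit_at {} S)"
    then show ?thesis
      unfolding eval using d lns
      by (simp add: unit_at_def ne doubleton_eq_iff insert_commute)
  next
    assume "g = (\<lambda>S. unit_at {i, l} S + unit_at {j, l} S + unit_at {k, l} S + 2 * unit_at {l} S + unit_at {} S)"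
    then show ?thesis
      unfolding eval using log_star_pair_dual [OF pd perm(18)] lns
      by (simp add: unit_at_def ne doubleton_eq_iff insert_commute)
  next
    assume "g = (\<lambda>S. unit_at {i, l} S + unit_at {j, l} S + unit_at {k, l} S + 3 * unit_at {l} S + unit_at {} S)"
    then show ?thesis
      unfolding eval using log_star_square [OF pd lab, folded c_def] lns
      by (simp add: unit_at_def ne doubleton_eq_iff insert_commute)
  next
    assume "g = (\<lambda>S. unit_at {i, l} S + unit_at {j, l} S + unit_at {k, l} S
            + unit_at {i} S + unit_at {j} S + unit_at {k} S + unit_at {} S)"
    then show ?thesis
      unfolding eval using log_star_square_dual [OF pd lab, folded c_def] lns
      by (simp add: unit_at_def ne doubleton_eq_iff insert_commute)
  next
    assume "g = (\<lambda>S. unit_at {i, l} S + unit_at {j, l} S + unit_at {k, l} S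
            + unit_at {i} S + unit_at {j} S + unit_at {k} S + unit_at {l} S + 2 * unit_at {} S)"
    then show ?thesis
      unfolding eval using log_star_pair [OF pd perm(18)] lns
      by (simp add: unit_at_def ne doubleton_eq_iff insert_commute)
  qed
  then show ?thesis by (simp add: c_def)
qed

lemma labels4_exist: "\<exists>i j k l. labels4 i j k l"
  by (intro exI [of _ 0] exI [of _ 1] exI [of _ 2] exI [of _ 3]) (auto simp: labels4_def)

text \<open>
  Inclusion and exclusion recovers \<open>x\<close> from its subset sums.
\<close>

lemma Mobius_inversion:
  assumes top: "\<forall>Q\<subseteq>{..<4}. 3 \<le> card Q \<longrightarrow> subset_sums x Q = 0"
  shows "(\<Sum>S\<in>Pow {..<4}. x S * L S) = pairing L (subset_sums x)"
proof -
  obtain i j k l where lab: "labels4 i j k l" using labels4_exist by blast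
  note ne = labels4_distinct [OF lab] and perm = labels4_all_perms [OF lab]
  have small: "x {} = subset_sums x {}" "x {a} = subset_sums x {a} - subset_sums x {}" for a
    by (simp_all add: subset_sums_def Pow_insert)
  have pair: "x {a, b} = subset_sums x {a, b} - subset_sums x {a} - subset_sums x {b} + subset_sums x {}"
    if "a \<noteq> b" for a b
    using that by (simp add: subset_sums_def sum_Pow_insert)
  have triple: "x {a, b, c} = - (x {} + x {a} + x {b} + x {c} + x {a, b} + x {a, c} + x {b, c})"
    if "labels4 a b c d" for a b c d
    using top [rule_format, of "{a, b, c}"] labels4_distinct [OF that] labels4_less [OF that]
    by (simp add: subset_sums_def sum_Pow_insert)
  have N: "{..<4} = {i, j, k, l}" using lab by (simp add: labels4_def)
  have full: "x {i, j, k, l} = - (x {} + x {i} + x {j} + x {k} + x {l}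
    + x {i, j} + x {i, k} + x {i, l} + x {j, k} + x {j, l} + x {k, l}
    + x {i, j, k} + x {i, j, l} + x {i, k, l} + x {j, k, l})"
    using top [rule_format, of "{..<4}"] sum_Pow_labels [OF lab, of x] by (simp add: subset_sums_def)
  show ?thesis
    unfolding sum_Pow_labels [OF lab] pairing_labels [OF lab] full
      triple [OF lab] triple [OF perm(1)] triple [OF perm(3)] triple [OF perm(9)]
      pair [OF ne(1)] pair [OF ne(2)] pair [OF ne(3)] pair [OF ne(4)] pair [OF ne(5)] pair [OF ne(6)]
      small mobius_all_labels [OF lab]
    by (simp add: algebra_simps)
qed

lemma generator_in_cone:
  assumes g: "g \<in> cone_generators"
  shows "\<forall>\<phi>\<in>facets. \<phi> g \<ge> 0"
proof -
  obtain i j k l where lab: "labels4 i j k l" and g: "g \<in> generators_at i j k l"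
    using g unfolding cone_generators_def by blast
  note ne = labels4_distinct [OF lab]
  show ?thesis
    unfolding facets_relation [OF lab, of "\<lambda>a b. 0 \<le> b" g g]
    using g unfolding generators_at_def by (elim insertE emptyE) (simp_all add: unit_at_def ne doubleton_eq_iff)
qed

lemma functional_facets: "\<phi> \<in> facets \<Longrightarrow> functional \<phi>"
  by (auto simp: facets_def functional_def sum_subtractf sum_distrib_left algebra_simps sum.distrib)

lemma finite_facets: "finite facets"
proof -
  have "low_sets 2 \<subseteq> Pow {..<4}" by (auto simp: low_sets_def)
  then have "finite (low_sets 2)" by (rule finite_subset) simp
  then show ?thesis by (simp add: facets_def)
qed

lemma functional_pairing: "functional (\<lambda>v. c * (\<Sum>Q\<in>low_sets 2. v Q) - pairing L v)"
  by (simp add: functional_def pairing_def sum_subtractf sum_distrib_left algebra_simps sum.distrib)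

text \<open>
  Subtracting the pairing from a large multiple of the total edge weight gives a functional that is nonnegative on the
  generators, hence on the cone. The resulting bound depends on \<open>v\<close> but not on \<open>A\<close>.
\<close>

lemma pairing_bounded:
  assumes pd: "pos_def 4 A" and K: "\<forall>\<phi>\<in>facets. \<phi> v \<ge> 0"
  shows "pairing (log_minor A) v \<le> ln 1024 * (\<Sum>Q\<in>low_sets 2. v Q)"
proof -
  let ?\<Phi> = "\<lambda>v. ln 1024 * (\<Sum>Q\<in>low_sets 2. v Q) - pairing (log_minor A) v"
  obtain i j k l where lab: "labels4 i j k l" using labels4_exist by blast
  have "?\<Phi> v \<ge> 0"
  proof (rule peeling [OF finite_facets functional_facets functional_pairing, where G = cone_generators])
    fix \<phi> g assume "\<phi> \<in> facets" "g \<in> cone_generators"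
    then show "\<phi> g \<ge> 0" using generator_in_cone by blast
  next
    fix g assume "g \<in> cone_generators"
    then show "?\<Phi> g \<ge> 0" using generator_bounded [OF pd] by simp
  next
    fix x assume "\<And>\<phi>. \<phi> \<in> facets \<Longrightarrow> \<phi> x = 0"
    then have "\<forall>\<phi>\<in>facets. \<phi> x = 0" by blast
    then show "?\<Phi> x \<ge> 0"
      unfolding facets_relation [OF lab, of "\<lambda>a b. a = 0" x x]
      by (simp add: pairing_labels [OF lab] sum_low_sets_labels [OF lab])
  next
    fix x assume "\<And>\<phi>. \<phi> \<in> facets \<Longrightarrow> \<phi> x \<ge> 0" "\<exists>\<phi>\<in>facets. \<phi> x \<noteq> 0"
    then show "\<exists>g\<in>cone_generators. (\<exists>\<phi>\<in>facets. \<phi> g \<noteq> 0) \<and> (\<forall>\<phi>\<in>facets. \<phi> x = 0 \<longrightarrow> \<phi> g = 0)"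
      using every_face_has_generator [of x] unfolding in_face_def by blast
  next
    fix \<phi> assume "\<phi> \<in> facets"
    then show "\<phi> v \<ge> 0" by (rule bspec [OF K])
  qed
  then show ?thesis by simp
qed

section \<open>The nullity types of the seven matrices\<close>

text \<open>
  Permuting columns is multiplication by an invertible matrix from the right.
\<close>

lemma kernel_dim_reindex_cols:
  fixes A :: "'a::field mat"
  assumes A: "A \<in> carrier_mat m k" and \<sigma>: "bij_betw \<sigma> {..<k} {..<k}"
  shows "kernel_dim (mat m k (\<lambda>(i, j). A $$ (i, \<sigma> j))) = kernel_dim A"
proof -
  define P where "P = mat k k (\<lambda>(a, j). if a = \<sigma> j then 1 else (0::'a))"
  define C where "C = mat k k (\<lambda>(j, b). if b = \<sigma> j then 1 else (0::'a))"
  have P: "P \<in> carrier_mat k k" and C: "C \<in> carrier_mat k k" by (simp_all add: P_def C_def)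
  have \<sigma>k: "\<sigma> j < k" if "j < k" for j using \<sigma> that by (auto simp: bij_betw_def)
  have "P * C = 1\<^sub>m k"
  proof (rule eq_matI)
    fix a b assume "a < dim_row (1\<^sub>m k)" "b < dim_col (1\<^sub>m k)"
    then have ab: "a < k" "b < k" by auto
    have "(P * C) $$ (a, b) = (\<Sum>j<k. (\<lambda>c. if a = c \<and> b = c then 1 else 0) (\<sigma> j))"
      using ab by (auto simp: P_def C_def scalar_prod_def lessThan_atLeast0 intro!: sum.cong)
    also have "\<dots> = (\<Sum>c<k. if a = c \<and> b = c then 1 else 0)"
      by (rule sum.reindex_bij_betw [OF \<sigma>])
    also have "\<dots> = (\<Sum>c<k. if c = a then (if a = b then 1 else 0) else 0)"
      by (intro sum.cong) auto
    also have "\<dots> = 1\<^sub>m k $$ (a, b)" using ab by simp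
    finally show "(P * C) $$ (a, b) = 1\<^sub>m k $$ (a, b)" .
  qed (use P C in auto)
  moreover have "mat m k (\<lambda>(i, j). A $$ (i, \<sigma> j)) = A * P"
  proof (rule eq_matI)
    fix i j assume "i < dim_row (A * P)" "j < dim_col (A * P)"
    then have ij: "i < m" "j < k" using A P by auto
    have "(A * P) $$ (i, j) = (\<Sum>c<k. A $$ (i, c) * (if c = \<sigma> j then 1 else 0))"
      using ij A by (simp add: P_def scalar_prod_def lessThan_atLeast0)
    also have "\<dots> = (\<Sum>c<k. if c = \<sigma> j then A $$ (i, c) else 0)"
      by (intro sum.cong) auto
    also have "\<dots> = A $$ (i, \<sigma> j)" using \<sigma>k [OF ij(2)] by simp
    finally show "mat m k (\<lambda>(i, j). A $$ (i, \<sigma> j)) $$ (i, j) = (A * P) $$ (i, j)" using ij by simp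
  qed (use A P in auto)
  ultimately show ?thesis
    using mat_kernel_dim_mult_eq_right [OF A P C] A P by (simp add: kernel_dim_def)
qed

lemma sum_pick:
  assumes "T \<subseteq> {..<n}"
  shows "(\<Sum>a<card T. f (pick T a)) = (\<Sum>j\<in>T. f j)"
proof -
  have "finite T" using assms finite_subset by blast
  then show ?thesis by (rule sum.reindex_bij_betw [OF bij_betw_pick])
qed

text \<open>
  The columns \<open>T\<close> of the permuted matrix and the columns \<open>p ` T\<close> of the original one agree
  up to their order.
\<close>

lemma nullity_type_permute_cols:
  assumes M: "dim_col M = n" and p: "p permutes {..<n}" and T: "T \<subseteq> {..<n}"
  shows "nullity_type (permute_cols p M) T = nullity_type M (p ` T)"
proof -
  have finT: "finite T" using T finite_subset by blast
  have pT: "p ` T \<subseteq> {..<n}" using p T permutes_in_image by fastforce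
  have inj: "inj_on p T" using p by (meson permutes_inj_on)
  have card: "card (p ` T) = card T" by (rule card_image [OF inj])
  let ?k = "card T"
  define \<sigma> where "\<sigma> = inv_into {..<?k} (pick (p ` T)) \<circ> (p \<circ> pick T)"
  have b1: "bij_betw (pick (p ` T)) {..<?k} (p ` T)"
    using bij_betw_pick [of "p ` T"] finT by (simp add: card)
  have "bij_betw (p \<circ> pick T) {..<?k} (p ` T)"
    using bij_betw_pick [OF finT] inj by (intro bij_betw_trans) (auto simp: bij_betw_def)
  then have \<sigma>: "bij_betw \<sigma> {..<?k} {..<?k}"
    unfolding \<sigma>_def using bij_betw_inv_into [OF b1] by (rule bij_betw_trans)
  have pick: "pick (p ` T) (\<sigma> j) = p (pick T j)" if "j < ?k" for j
  proof -
    have "p (pick T j) \<in> p ` T" using that pick_in_set by blast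
    then show ?thesis using bij_betw_inv_into_right [OF b1] by (simp add: \<sigma>_def)
  qed
  have \<sigma>k: "\<sigma> j < ?k" if "j < ?k" for j using \<sigma> that by (auto simp: bij_betw_def)
  have eqT: "{j. j < n \<and> j \<in> T} = T" "{j. j < n \<and> j \<in> p ` T} = p ` T" using T pT by auto
  have Tn: "pick T j < n" if "j < ?k" for j using pick_in_set [OF disjI1 [OF that]] T by auto
  have "submatrix (permute_cols p M) UNIV T
      = mat (dim_row M) ?k (\<lambda>(i, j). submatrix M UNIV (p ` T) $$ (i, \<sigma> j))"
    using M pick \<sigma>k Tn by (intro eq_matI) (auto simp: submatrix_def permute_cols_def eqT card pick_UNIV)
  moreover have "submatrix M UNIV (p ` T) \<in> carrier_mat (dim_row M) ?k"
    by (rule carrier_matI) (simp_all only: dim_submatrix M eqT card, simp)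
  ultimately have "kernel_dim (submatrix (permute_cols p M) UNIV T) = kernel_dim (submatrix M UNIV (p ` T))"
    using kernel_dim_reindex_cols [OF _ \<sigma>] by simp
  then show ?thesis using T pT M by (simp add: nullity_type_def permute_cols_def)
qed

lemma kernel_dim_line:
  fixes A :: "complex mat"
  assumes A: "A \<in> carrier_mat m k" and w: "w \<in> carrier_vec k" and ker: "mat_kernel A = range (\<lambda>c. c \<cdot>\<^sub>v w)"
  shows "kernel_dim A = (if w = 0\<^sub>v k then 0 else 1)"
proof -
  interpret K: kernel m k A by unfold_locales (rule A)
  have wk: "w \<in> mat_kernel A" using ker w by (metis one_smult_vec rangeI)
  have "K.span {w} = mat_kernel A"
  proof
    show "K.span {w} \<subseteq> mat_kernel A" using wk K.Ker.span_is_subset2 [of "{w}"] by simp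
    show "mat_kernel A \<subseteq> K.span {w}"
    proof
      fix v assume "v \<in> mat_kernel A"
      then obtain c where "v = c \<cdot>\<^sub>v w" using ker by blast
      moreover have "w \<in> K.span {w}" using wk K.Ker.in_own_span [of "{w}"] by simp
      ultimately show "v \<in> K.span {w}" using submodule.smult_closed [OF K.Ker.span_is_submodule [of "{w}"], of c w] wk by simp
    qed
  qed
  then have "K.dim = (if w = 0\<^sub>v k then 0 else 1)"
    using K.Ker.dim1I [of w] K.Ker.dim0I wk by auto
  then show ?thesis by simp
qed

text \<open>
  If the kernel of \<open>M\<close> is a line spanned by a vector with support \<open>P\<close>, then the kernel of a
  set \<open>T\<close> of columns consists of the multiples of that vector that vanish outside \<open>T\<close>.
\<close>

lemma nullity_type_circuit:
  fixes u :: "nat \<Rightarrow> complex"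
  assumes M: "M \<in> carrier_mat m n" and P: "P \<subseteq> {..<n}" "P \<noteq> {}" and u: "\<And>j. j < n \<Longrightarrow> u j \<noteq> 0 \<longleftrightarrow> j \<in> P"
    and ker: "\<And>f. (\<forall>i<m. (\<Sum>j<n. M $$ (i, j) * f j) = 0) \<longleftrightarrow> (\<exists>c. \<forall>j<n. f j = c * u j)"
    and T: "T \<subseteq> {..<n}" "T \<noteq> {}"
  shows "nullity_type M T = (if P \<subseteq> T then 1 else 0)"
proof -
  have finT: "finite T" using T finite_subset by blast
  let ?k = "card T" and ?N = "submatrix M UNIV T"
  define w where "w = vec ?k (\<lambda>a. if P \<subseteq> T then u (pick T a) else 0)"
  have eqT: "{j. j < n \<and> j \<in> T} = T" using T by auto
  have N: "?N \<in> carrier_mat m ?k" using M by (intro carrier_matI) (simp_all add: dim_submatrix eqT)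
  have pickT: "pick T a \<in> T" if "a < ?k" for a using pick_in_set [OF disjI1 [OF that]] .
  have index: "\<exists>a<?k. pick T a = j" if "j \<in> T" for j
  proof -
    have "card {a \<in> T. a < j} < ?k" using that finT by (intro psubset_card_mono) auto
    then show ?thesis using pick_card_in_set [OF that] by blast
  qed
  have Nv: "?N *\<^sub>v vec ?k (\<lambda>a. f (pick T a)) = 0\<^sub>v m
      \<longleftrightarrow> (\<exists>c. \<forall>j<n. (if j \<in> T then f j else 0) = c * u j)" for f
  proof -
    have row: "(?N *\<^sub>v vec ?k (\<lambda>a. f (pick T a))) $ i = (\<Sum>j<n. M $$ (i, j) * (if j \<in> T then f j else 0))"
      if i: "i < m" for i
    proof -
      have "(?N *\<^sub>v vec ?k (\<lambda>a. f (pick T a))) $ i = (\<Sum>a<?k. M $$ (i, pick T a) * f (pick T a))"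
        using N M i by (auto simp: scalar_prod_def lessThan_atLeast0 submatrix_def eqT pick_UNIV intro!: sum.cong)
      also have "\<dots> = (\<Sum>j\<in>T. M $$ (i, j) * f j)" by (rule sum_pick [OF T(1)])
      also have "\<dots> = (\<Sum>j<n. M $$ (i, j) * (if j \<in> T then f j else 0))"
        using T by (intro sum.mono_neutral_cong_left) auto
      finally show ?thesis .
    qed
    have "?N *\<^sub>v vec ?k (\<lambda>a. f (pick T a)) = 0\<^sub>v m
        \<longleftrightarrow> (\<forall>i<m. (?N *\<^sub>v vec ?k (\<lambda>a. f (pick T a))) $ i = 0)"
      using N by (auto simp: vec_eq_iff)
    then show ?thesis using row ker [of "\<lambda>j. if j \<in> T then f j else 0"] by simp
  qed
  have "mat_kernel ?N = range (\<lambda>c. c \<cdot>\<^sub>v w)"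
  proof (intro equalityI subsetI)
    fix v assume "v \<in> mat_kernel ?N"
    then have v: "v \<in> carrier_vec ?k" "?N *\<^sub>v v = 0\<^sub>v m" using mat_kernelD [OF N] by auto
    define f where "f j = v $ card {a \<in> T. a < j}" for j
    have "v = vec ?k (\<lambda>a. f (pick T a))"
      using v card_pick by (intro eq_vecI) (auto simp: f_def)
    then obtain c where c: "\<And>j. j < n \<Longrightarrow> (if j \<in> T then f j else 0) = c * u j"
      using Nv v by metis
    have c0: "c = 0" if nPT: "\<not> P \<subseteq> T"
    proof -
      obtain j where "j \<in> P" "j \<notin> T" using nPT by blast
      then show ?thesis using c [of j] u [of j] P by auto
    qed
    have "v = c \<cdot>\<^sub>v w"
    proof (rule eq_vecI)
      fix a assume "a < dim_vec (c \<cdot>\<^sub>v w)"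
      then have a: "a < ?k" by (simp add: w_def)
      have "v $ a = f (pick T a)" using a card_pick [OF disjI1 [OF a]] by (simp add: f_def)
      also have "\<dots> = c * u (pick T a)" using c [of "pick T a"] pickT [OF a] T by auto
      finally show "v $ a = (c \<cdot>\<^sub>v w) $ a" using a c0 by (auto simp: w_def)
    qed (use v in \<open>simp add: w_def\<close>)
    then show "v \<in> range (\<lambda>c. c \<cdot>\<^sub>v w)" by blast
  next
    fix v assume "v \<in> range (\<lambda>c. c \<cdot>\<^sub>v w)"
    then obtain c where v: "v = c \<cdot>\<^sub>v w" by blast
    define f where "f j = (if P \<subseteq> T then c * u j else 0)" for j
    have vf: "v = vec ?k (\<lambda>a. f (pick T a))" unfolding v w_def f_def by (intro eq_vecI) auto
    have "\<forall>j<n. (if j \<in> T then f j else 0) = (if P \<subseteq> T then c else 0) * u j"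
      using u by (auto simp: f_def)
    then have "?N *\<^sub>v v = 0\<^sub>v m" unfolding vf Nv by blast
    then show "v \<in> mat_kernel ?N" using mat_kernelI [OF N] vf by simp
  qed
  then have "kernel_dim ?N = (if w = 0\<^sub>v ?k then 0 else 1)"
    using kernel_dim_line [OF N] by (simp add: w_def)
  moreover have "w = 0\<^sub>v ?k \<longleftrightarrow> \<not> P \<subseteq> T"
  proof
    assume w0: "w = 0\<^sub>v ?k"
    show "\<not> P \<subseteq> T"
    proof
      assume PT: "P \<subseteq> T"
      obtain j where j: "j \<in> P" using P by blast
      then obtain a where "a < ?k" "pick T a = j" using index PT by blast
      then have "w $ a = u j" using PT by (simp add: w_def)
      then show False using w0 u [of j] j P \<open>a < ?k\<close> by auto
    qed
  qed (auto simp: w_def)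
  ultimately show ?thesis using T M by (simp add: nullity_type_def)
qed

lemma pick_sorted_list:
  assumes js: "sorted_wrt (<) js" and j: "j < length js"
  shows "pick (set js) j = js ! j"
proof -
  have "{a \<in> set js. a < js ! j} = (!) js ` {..<j}"
  proof (intro equalityI subsetI)
    fix a assume "a \<in> {a \<in> set js. a < js ! j}"
    then obtain i where i: "i < length js" "a = js ! i" "js ! i < js ! j" by (auto simp: in_set_conv_nth)
    then have "i < j"
      using sorted_wrt_nth_less [OF js, of j i] j by (metis linorder_neqE_nat order_less_asym order_less_irrefl)
    then show "a \<in> (!) js ` {..<j}" using i by blast
  next
    fix a assume "a \<in> (!) js ` {..<j}"
    then show "a \<in> {a \<in> set js. a < js ! j}"
      using sorted_wrt_nth_less [OF js, of _ j] j by auto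
  qed
  moreover have "inj_on ((!) js) {..<j}"
    using j strict_sorted_iff js by (auto intro!: inj_on_nth)
  ultimately have "card {a \<in> set js. a < js ! j} = j" by (simp add: card_image)
  then show ?thesis using pick_card_in_set [of "js ! j" "set js"] j by simp
qed

lemma nullity_type_rows_list:
  assumes js: "sorted_wrt (<) js" "js \<noteq> []" "set js \<subseteq> {..<n}"
  shows "nullity_type (mat_of_rows_list n rs) (set js)
    = real (kernel_dim (mat_of_rows_list (length js) (map (\<lambda>r. map ((!) r) js) rs)))"
proof -
  let ?M = "mat_of_rows_list n rs"
  have card: "card (set js) = length js" using js(1) by (simp add: distinct_card strict_sorted_iff)
  have eq: "{j. j < n \<and> j \<in> set js} = set js" using js(3) by auto
  have "js ! j < n" if "j < length js" for j using js(3) that by (meson lessThan_iff nth_mem subsetD)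
  then have "submatrix ?M UNIV (set js) = mat_of_rows_list (length js) (map (\<lambda>r. map ((!) r) js) rs)"
    by (intro eq_matI)
      (auto simp: submatrix_def mat_of_rows_list_def eq card pick_UNIV pick_sorted_list [OF js(1)])
  then show ?thesis using js by (simp add: nullity_type_def mat_of_rows_list_def)
qed

text \<open>
  The nullities for a single row whose nonzero entries are in the columns \<open>P\<close>.
\<close>

definition row_nullity :: "nat set \<Rightarrow> nat set \<Rightarrow> nat" where
  "row_nullity P T = card T - (if P \<inter> T = {} then 0 else 1)"

text \<open>
  The nullities for a matrix whose kernel is a line spanned by a vector with support \<open>P\<close>.
\<close>

definition circuit_nullity :: "nat set \<Rightarrow> nat set \<Rightarrow> nat" where
  "circuit_nullity P T = (if P \<subseteq> T then 1 else 0)"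

text \<open>
  The nullities for four vectors in the plane of which exactly the two in \<open>P\<close> are proportional.
\<close>

definition parallel_nullity :: "nat set \<Rightarrow> nat set \<Rightarrow> nat" where
  "parallel_nullity P T = card T - min 2 (card T - (if P \<subseteq> T then 1 else 0))"

text \<open>
  The nullities for four pairwise independent vectors in the plane.
\<close>

definition uniform_nullity :: "nat set \<Rightarrow> nat" where
  "uniform_nullity T = card T - 2"

definition set_vec4 :: "(nat set \<Rightarrow> nat) \<Rightarrow> set_vec" where
  "set_vec4 f = (\<lambda>T. if T \<subseteq> {..<4} then real (f T) else 0)"

definition sublists4 :: "nat list list" where
  "sublists4 = [[0], [1], [2], [3], [0, 1], [0, 2], [0, 3], [1, 2], [1, 3], [2, 3], [0, 1, 2], [0, 1, 3], [0, 2, 3], [1, 2, 3], [0, 1, 2, 3]]"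

lemma subset4_sublist:
  assumes "T \<subseteq> {..<4}" "T \<noteq> {}"
  obtains js where "js \<in> set sublists4" "T = set js" "sorted_wrt (<) js"
proof -
  have lab: "labels4 0 1 2 3" by (auto simp: labels4_def)
  have "Pow {..<4} = insert {} (set ` set sublists4)"
    unfolding Pow_labels [OF lab] by (simp add: sublists4_def)
  then have "T \<in> set ` set sublists4" using assms by blast
  then obtain js where "js \<in> set sublists4" "T = set js" by blast
  moreover have "\<forall>js\<in>set sublists4. sorted_wrt (<) js" by (simp add: sublists4_def)
  ultimately show ?thesis using that by blast
qed

text \<open>
  The nullity of the listed columns, in a form whose value Gaussian elimination computes.
\<close>

definition columns_nullity :: "complex list list \<Rightarrow> nat list \<Rightarrow> nat" where
  "columns_nullity rs js = kernel_dim (mat_of_rows_list (length js) (map (\<lambda>r. map ((!) r) js) rs))"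

text \<open>
  Finitely many nullities determine the nullity type. For matrices with one or two rows they are computed by Gaussian
  elimination; the two matrices with three rows have one-dimensional kernels and are treated by
  \<open>nullity_type_circuit\<close>.
\<close>

lemma nullity_type_by_columns:
  assumes "list_all (\<lambda>js. columns_nullity rs js = f (set js)) sublists4" and f0: "f {} = 0"
  shows "nullity_type (mat_of_rows_list 4 rs) = set_vec4 f"
proof
  fix T
  show "nullity_type (mat_of_rows_list 4 rs) T = set_vec4 f T"
  proof (cases "T \<noteq> {} \<and> T \<subseteq> {..<4}")
    case False
    then show ?thesis using f0 by (auto simp: nullity_type_def set_vec4_def mat_of_rows_list_def)
  next
    case True
    then obtain js where js: "js \<in> set sublists4" "T = set js" "sorted_wrt (<) js"
      using subset4_sublist by blast
    then have "columns_nullity rs js = f (set js)" using assms(1) by (simp add: list_all_iff)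
    then show ?thesis using True js nullity_type_rows_list [of js 4 rs]
      by (auto simp: set_vec4_def columns_nullity_def)
  qed
qed

lemma nullity_type_row_full: "nullity_type (mat_of_rows_list 4 [[1,1,1,1]]) = set_vec4 (row_nullity {0,1,2,3})"
proof (rule nullity_type_by_columns)
  show "list_all (\<lambda>js. columns_nullity [[1,1,1,1]] js = row_nullity {0,1,2,3} (set js)) sublists4"
    by code_simp
qed (simp add: row_nullity_def parallel_nullity_def uniform_nullity_def)

lemma nullity_type_row_one_zero: "nullity_type (mat_of_rows_list 4 [[0,1,1,1]]) = set_vec4 (row_nullity {1,2,3})"
proof (rule nullity_type_by_columns)
  show "list_all (\<lambda>js. columns_nullity [[0,1,1,1]] js = row_nullity {1,2,3} (set js)) sublists4"
    by code_simp
qed (simp add: row_nullity_def parallel_nullity_def uniform_nullity_def)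

lemma nullity_type_row_two_zeros: "nullity_type (mat_of_rows_list 4 [[0,0,1,1]]) = set_vec4 (row_nullity {2,3})"
proof (rule nullity_type_by_columns)
  show "list_all (\<lambda>js. columns_nullity [[0,0,1,1]] js = row_nullity {2,3} (set js)) sublists4"
    by code_simp
qed (simp add: row_nullity_def parallel_nullity_def uniform_nullity_def)

lemma nullity_type_plane_parallel: "nullity_type (mat_of_rows_list 4 [[1,0,1,1], [0,1,1,1]]) = set_vec4 (parallel_nullity {2,3})"
proof (rule nullity_type_by_columns)
  show "list_all (\<lambda>js. columns_nullity [[1,0,1,1], [0,1,1,1]] js = parallel_nullity {2,3} (set js)) sublists4"
    by code_simp
qed (simp add: row_nullity_def parallel_nullity_def uniform_nullity_def)

lemma nullity_type_plane_uniform: "nullity_type (mat_of_rows_list 4 [[1,1,1,1], [0,1,2,3]]) = set_vec4 (uniform_nullity)"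
proof (rule nullity_type_by_columns)
  show "list_all (\<lambda>js. columns_nullity [[1,1,1,1], [0,1,2,3]] js = uniform_nullity (set js)) sublists4"
    by code_simp
qed (simp add: row_nullity_def parallel_nullity_def uniform_nullity_def)

lemma nullity_type_triangle_coloop: "nullity_type (mat_of_rows_list 4 [[1,0,1,0], [0,1,1,0], [0,0,0,1]]) = set_vec4 (circuit_nullity {0,1,2})"
proof
  fix T
  have "nullity_type (mat_of_rows_list 4 [[1,0,1,0], [0,1,1,0], [0,0,0,1]]) T = (if {0,1,2} \<subseteq> T then 1 else 0)"
    if assms: "T \<subseteq> {..<4}" "T \<noteq> {}"
  proof (rule nullity_type_circuit [OF _ _ _ _ _ assms, of _ 3 _ "\<lambda>j. if j = 0 \<or> j = 1 then 1 else if j = 2 then -1 else 0"])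
    fix f :: "nat \<Rightarrow> complex"
    have N: "{..<4} = {0, 1, 2, 3::nat}" "{..<3} = {0, 1, 2::nat}" by auto
    have all: "(\<forall>i<3. Q i) \<longleftrightarrow> Q 0 \<and> Q 1 \<and> Q 2" "(\<forall>i<4. Q i) \<longleftrightarrow> Q 0 \<and> Q 1 \<and> Q 2 \<and> Q 3" for Q :: "nat \<Rightarrow> bool"
      by (auto simp: eval_nat_numeral less_Suc_eq)
    show "(\<forall>i<3. (\<Sum>j<4. mat_of_rows_list 4 [[1,0,1,0], [0,1,1,0], [0,0,0,1]] $$ (i, j) * f j) = 0) \<longleftrightarrow>
      (\<exists>c. \<forall>j<4. f j = c * (if j = 0 \<or> j = 1 then 1 else if j = 2 then - 1 else 0))"
      unfolding all by (auto simp: N mat_of_rows_list_def add_eq_0_iff)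
  qed (auto simp: mat_of_rows_list_def)
  then show "nullity_type (mat_of_rows_list 4 [[1,0,1,0], [0,1,1,0], [0,0,0,1]]) T = set_vec4 (circuit_nullity {0,1,2}) T"
    by (cases "T \<subseteq> {..<4} \<and> T \<noteq> {}")
      (auto simp: nullity_type_def set_vec4_def circuit_nullity_def mat_of_rows_list_def)
qed

lemma nullity_type_circuit4: "nullity_type (mat_of_rows_list 4 [[1,0,0,1], [0,1,0,1], [0,0,1,1]]) = set_vec4 (circuit_nullity {0,1,2,3})"
proof
  fix T
  have "nullity_type (mat_of_rows_list 4 [[1,0,0,1], [0,1,0,1], [0,0,1,1]]) T = (if {0,1,2,3} \<subseteq> T then 1 else 0)"
    if assms: "T \<subseteq> {..<4}" "T \<noteq> {}"
  proof (rule nullity_type_circuit [OF _ _ _ _ _ assms, of _ 3 _ "\<lambda>j. if j = 3 then -1 else 1"])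
    fix f :: "nat \<Rightarrow> complex"
    have N: "{..<4} = {0, 1, 2, 3::nat}" "{..<3} = {0, 1, 2::nat}" by auto
    have all: "(\<forall>i<3. Q i) \<longleftrightarrow> Q 0 \<and> Q 1 \<and> Q 2" "(\<forall>i<4. Q i) \<longleftrightarrow> Q 0 \<and> Q 1 \<and> Q 2 \<and> Q 3" for Q :: "nat \<Rightarrow> bool"
      by (auto simp: eval_nat_numeral less_Suc_eq)
    show "(\<forall>i<3. (\<Sum>j<4. mat_of_rows_list 4 [[1,0,0,1], [0,1,0,1], [0,0,1,1]] $$ (i, j) * f j) = 0) \<longleftrightarrow>
      (\<exists>c. \<forall>j<4. f j = c * (if j = 3 then - 1 else 1))"
      unfolding all by (auto simp: N mat_of_rows_list_def add_eq_0_iff)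
  qed (auto simp: mat_of_rows_list_def)
  then show "nullity_type (mat_of_rows_list 4 [[1,0,0,1], [0,1,0,1], [0,0,1,1]]) T = set_vec4 (circuit_nullity {0,1,2,3}) T"
    by (cases "T \<subseteq> {..<4} \<and> T \<noteq> {}")
      (auto simp: nullity_type_def set_vec4_def circuit_nullity_def mat_of_rows_list_def)
qed

lemma permutes_onto:
  assumes N: "finite N" and P: "P \<subseteq> N" "P0 \<subseteq> N" "card P = card P0"
  obtains p where "p permutes N" "p ` P = P0"
proof -
  have fin: "finite P" "finite P0" using N P finite_subset by blast+
  obtain f where f: "bij_betw f P P0" using finite_same_card_bij [OF fin P(3)] by blast
  have "card (N - P) = card (N - P0)" using P fin N by (simp add: card_Diff_subset)
  then obtain g where g: "bij_betw g (N - P) (N - P0)"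
    using finite_same_card_bij [of "N - P" "N - P0"] N by blast
  define p where "p x = (if x \<in> P then f x else if x \<in> N then g x else x)" for x
  have "bij_betw p P P0" using f by (rule bij_betw_cong [THEN iffD1, rotated]) (simp add: p_def)
  moreover have "bij_betw p (N - P) (N - P0)"
    using g by (rule bij_betw_cong [THEN iffD1, rotated]) (simp add: p_def)
  ultimately have "bij_betw p (P \<union> (N - P)) (P0 \<union> (N - P0))"
    by (intro bij_betw_combine) auto
  then have "bij_betw p N N" using P by (simp add: Un_absorb1)
  then have "p permutes N" using P by (intro bij_imp_permutes) (auto simp: p_def)
  moreover have "p ` P = P0" using \<open>bij_betw p P P0\<close> by (simp add: bij_betw_def)
  ultimately show ?thesis using that by blast
qed

definition nullity_functions4 :: "(nat set \<Rightarrow> nat) set" where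
  "nullity_functions4 = row_nullity ` {P. P \<subseteq> {..<4} \<and> 2 \<le> card P}
     \<union> circuit_nullity ` {P. P \<subseteq> {..<4} \<and> 3 \<le> card P}
     \<union> parallel_nullity ` {P. P \<subseteq> {..<4} \<and> card P = 2} \<union> {uniform_nullity}"

text \<open>
  The four families are permuted by relabelling the columns.
\<close>

lemma nullity_functions_image:
  assumes "bij p"
  shows "row_nullity (p ` P) (p ` T) = row_nullity P T"
    and "circuit_nullity (p ` P) (p ` T) = circuit_nullity P T"
    and "parallel_nullity (p ` P) (p ` T) = parallel_nullity P T"
    and "uniform_nullity (p ` T) = uniform_nullity T"
proof -
  have inj: "inj p" using assms by (simp add: bij_is_inj)
  have "p ` P \<inter> p ` T = {} \<longleftrightarrow> P \<inter> T = {}" using inj by (auto simp flip: image_Int)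
  moreover have "p ` P \<subseteq> p ` T \<longleftrightarrow> P \<subseteq> T" using inj by (simp add: inj_image_subset_iff)
  moreover have "card (p ` T) = card T" using inj by (meson card_image inj_on_subset subset_UNIV)
  ultimately show "row_nullity (p ` P) (p ` T) = row_nullity P T"
    "circuit_nullity (p ` P) (p ` T) = circuit_nullity P T"
    "parallel_nullity (p ` P) (p ` T) = parallel_nullity P T"
    "uniform_nullity (p ` T) = uniform_nullity T"
    by (simp_all add: row_nullity_def circuit_nullity_def parallel_nullity_def uniform_nullity_def)
qed

lemma nullity_type_permuted:
  assumes M: "dim_col M = 4" "nullity_type M = set_vec4 f" and p: "p permutes {..<4}"
    and f: "\<And>T. f (p ` T) = g T"
  shows "nullity_type (permute_cols p M) = set_vec4 g"
proof
  fix T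
  show "nullity_type (permute_cols p M) T = set_vec4 g T"
  proof (cases "T \<subseteq> {..<4}")
    case True
    then have "p ` T \<subseteq> {..<4}" using p permutes_in_image by fastforce
    then show ?thesis
      using True nullity_type_permute_cols [OF M(1) p True] M(2) f by (simp add: set_vec4_def)
  next
    case False
    then show ?thesis using M(1) by (simp add: nullity_type_def set_vec4_def permute_cols_def)
  qed
qed

text \<open>
  The seven matrices represent the orbits of these functions: rows with four, three and two nonzero entries, circuits
  with three and four elements, one parallel pair, and the uniform case.
\<close>

lemma nullity_types4_eq: "nullity_types4 = set_vec4 ` nullity_functions4"
proof
  let ?N = "{..<4} :: nat set"
  note base = nullity_type_row_full nullity_type_row_one_zero nullity_type_row_two_zeros
    nullity_type_triangle_coloop nullity_type_circuit4 nullity_type_plane_parallel nullity_type_plane_uniform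
  have dim: "dim_col (mat_of_rows_list 4 rs :: complex mat) = 4" for rs by (simp add: mat_of_rows_list_def)
  show "nullity_types4 \<subseteq> set_vec4 ` nullity_functions4"
  proof
    fix \<mu> assume "\<mu> \<in> nullity_types4"
    then obtain p M where \<mu>: "\<mu> = nullity_type (permute_cols p M)" and M: "M \<in> base_mats4"
      and p: "p permutes ?N" unfolding nullity_types4_def by blast
    define q where "q = Hilbert_Choice.inv p"
    have bij: "bij p" and q: "q permutes ?N" using p by (auto simp: q_def permutes_bij permutes_inv)
    have pq: "p ` q ` P = P" for P
      using permutes_inverses(1) [OF p] by (simp add: q_def image_image)
    have qP: "q ` P \<subseteq> ?N \<and> card (q ` P) = card P" if "P \<subseteq> ?N" for P
      using image_mono [OF that, of q] permutes_image [OF q] card_image [OF permutes_inj_on [OF q]] by simp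
    have hit: "\<mu> \<in> set_vec4 ` nullity_functions4"
      if "nullity_type M = set_vec4 (row_nullity P)" "P \<subseteq> ?N" "2 \<le> card P" "dim_col M = 4" for P
    proof -
      have "\<mu> = set_vec4 (row_nullity (q ` P))"
        unfolding \<mu> by (rule nullity_type_permuted [OF that(4,1) p])
          (rule nullity_functions_image(1) [OF bij, of "q ` P", unfolded pq])
      then show ?thesis unfolding nullity_functions4_def using qP [of P] that by auto
    qed
    have circ: "\<mu> \<in> set_vec4 ` nullity_functions4"
      if "nullity_type M = set_vec4 (circuit_nullity P)" "P \<subseteq> ?N" "3 \<le> card P" "dim_col M = 4" for P
    proof -
      have "\<mu> = set_vec4 (circuit_nullity (q ` P))"
        unfolding \<mu> by (rule nullity_type_permuted [OF that(4,1) p])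
          (rule nullity_functions_image(2) [OF bij, of "q ` P", unfolded pq])
      then show ?thesis unfolding nullity_functions4_def using qP [of P] that by auto
    qed
    have par: "\<mu> \<in> set_vec4 ` nullity_functions4"
      if "nullity_type M = set_vec4 (parallel_nullity P)" "P \<subseteq> ?N" "card P = 2" "dim_col M = 4" for P
    proof -
      have "\<mu> = set_vec4 (parallel_nullity (q ` P))"
        unfolding \<mu> by (rule nullity_type_permuted [OF that(4,1) p])
          (rule nullity_functions_image(3) [OF bij, of "q ` P", unfolded pq])
      then show ?thesis unfolding nullity_functions4_def using qP [of P] that by auto
    qed
    have uni: "\<mu> \<in> set_vec4 ` nullity_functions4"
      if "nullity_type M = set_vec4 uniform_nullity" "dim_col M = 4"
    proof -
      have "\<mu> = set_vec4 uniform_nullity"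
        unfolding \<mu> by (rule nullity_type_permuted [OF that(2,1) p])
          (rule nullity_functions_image(4) [OF bij])
      then show ?thesis unfolding nullity_functions4_def by blast
    qed
    have dimM: "dim_col M = 4" using M by (auto simp: base_mats4_def dim)
    have "nullity_type M \<in> set_vec4 ` {row_nullity {0,1,2,3}, row_nullity {1,2,3}, row_nullity {2,3},
        circuit_nullity {0,1,2}, circuit_nullity {0,1,2,3}, parallel_nullity {2,3}, uniform_nullity}"
      using M unfolding base_mats4_def image_insert image_empty
      by (elim insertE emptyE) (simp_all only: base insert_iff simp_thms)
    then obtain f where fM: "nullity_type M = set_vec4 f"
      and f: "f \<in> {row_nullity {0,1,2,3}, row_nullity {1,2,3}, row_nullity {2,3},
        circuit_nullity {0,1,2}, circuit_nullity {0,1,2,3}, parallel_nullity {2,3}, uniform_nullity}"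
      by blast
    from f show "\<mu> \<in> set_vec4 ` nullity_functions4"
    proof (elim insertE emptyE)
      assume "f = row_nullity {0,1,2,3}"
      then show ?thesis using hit [of "{0,1,2,3}"] fM dimM by simp
    next
      assume "f = row_nullity {1,2,3}"
      then show ?thesis using hit [of "{1,2,3}"] fM dimM by simp
    next
      assume "f = row_nullity {2,3}"
      then show ?thesis using hit [of "{2,3}"] fM dimM by simp
    next
      assume "f = circuit_nullity {0,1,2}"
      then show ?thesis using circ [of "{0,1,2}"] fM dimM by simp
    next
      assume "f = circuit_nullity {0,1,2,3}"
      then show ?thesis using circ [of "{0,1,2,3}"] fM dimM by simp
    next
      assume "f = parallel_nullity {2,3}"
      then show ?thesis using par [of "{2,3}"] fM dimM by simp
    next
      assume "f = uniform_nullity"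
      then show ?thesis using uni fM dimM by simp
    qed
  qed
  show "set_vec4 ` nullity_functions4 \<subseteq> nullity_types4"
  proof
    fix \<mu> assume "\<mu> \<in> set_vec4 ` nullity_functions4"
    then obtain f where f: "f \<in> nullity_functions4" and \<mu>: "\<mu> = set_vec4 f" by blast
    have mem: "\<mu> \<in> nullity_types4"
      if "nullity_type (mat_of_rows_list 4 rs) = set_vec4 g" "mat_of_rows_list 4 rs \<in> base_mats4"
        "p permutes ?N" "\<And>T. g (p ` T) = f T" for rs g p
    proof -
      have "\<mu> = nullity_type (permute_cols p (mat_of_rows_list 4 rs))"
        using nullity_type_permuted [OF dim that(1,3,4)] \<mu> by simp
      then show ?thesis using that(2,3) unfolding nullity_types4_def by blast
    qed
    have to: "\<exists>p. p permutes ?N \<and> p ` P = P0" if "P \<subseteq> ?N" "P0 \<subseteq> ?N" "card P = card P0" for P P0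
      using permutes_onto [OF _ that] by blast
    consider (hit) P where "f = row_nullity P" "P \<subseteq> ?N" "2 \<le> card P"
      | (circ) P where "f = circuit_nullity P" "P \<subseteq> ?N" "3 \<le> card P"
      | (par) P where "f = parallel_nullity P" "P \<subseteq> ?N" "card P = 2"
      | (uni) "f = uniform_nullity"
      using f unfolding nullity_functions4_def by blast
    then show "\<mu> \<in> nullity_types4"
    proof cases
      case hit
      have "card P \<le> 4" using card_mono [of ?N P] hit by simp
      then consider "card P = 4" | "card P = 3" | "card P = 2" using hit by linarith
      then show ?thesis
      proof cases
        case 1
        then obtain p where p: "p permutes ?N" "p ` P = {0,1,2,3}" using to [of P "{0,1,2,3}"] hit by auto
        show ?thesis
          using nullity_functions_image(1) [OF permutes_bij [OF p(1)], of P, unfolded p(2)] hit(1)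
          by (intro mem [OF base(1) _ p(1)]) (simp_all add: base_mats4_def)
      next
        case 2
        then obtain p where p: "p permutes ?N" "p ` P = {1,2,3}" using to [of P "{1,2,3}"] hit by auto
        show ?thesis
          using nullity_functions_image(1) [OF permutes_bij [OF p(1)], of P, unfolded p(2)] hit(1)
          by (intro mem [OF base(2) _ p(1)]) (simp_all add: base_mats4_def)
      next
        case 3
        then obtain p where p: "p permutes ?N" "p ` P = {2,3}" using to [of P "{2,3}"] hit by auto
        show ?thesis
          using nullity_functions_image(1) [OF permutes_bij [OF p(1)], of P, unfolded p(2)] hit(1)
          by (intro mem [OF base(3) _ p(1)]) (simp_all add: base_mats4_def)
      qed
    next
      case circ
      have "card P \<le> 4" using card_mono [of ?N P] circ by simp
      then consider "card P = 3" | "card P = 4" using circ by linarith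
      then show ?thesis
      proof cases
        case 1
        then obtain p where p: "p permutes ?N" "p ` P = {0,1,2}" using to [of P "{0,1,2}"] circ by auto
        show ?thesis
          using nullity_functions_image(2) [OF permutes_bij [OF p(1)], of P, unfolded p(2)] circ(1)
          by (intro mem [OF base(4) _ p(1)]) (simp_all add: base_mats4_def)
      next
        case 2
        then obtain p where p: "p permutes ?N" "p ` P = {0,1,2,3}" using to [of P "{0,1,2,3}"] circ by auto
        show ?thesis
          using nullity_functions_image(2) [OF permutes_bij [OF p(1)], of P, unfolded p(2)] circ(1)
          by (intro mem [OF base(5) _ p(1)]) (simp_all add: base_mats4_def)
      qed
    next
      case par
      then obtain p where p: "p permutes ?N" "p ` P = {2,3}" using to [of P "{2,3}"] by auto
      show ?thesis
        using nullity_functions_image(3) [OF permutes_bij [OF p(1)], of P, unfolded p(2)] par(1)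
        by (intro mem [OF base(6) _ p(1)]) (simp_all add: base_mats4_def)
    next
      case uni
      show ?thesis
        using uni by (intro mem [OF base(7) _ permutes_id]) (auto simp: base_mats4_def)
    qed
  qed
qed

text \<open>
  There are 11 subsets with at least two elements, 5 with at least three and 6 with exactly two, and one uniform
  function. The 23 functions are distinguished by their values on the nonempty sets.
\<close>

lemma card_nullity_types4: "card nullity_types4 = 23"
proof -
  let ?P4 = "[{0,1,2,3::nat}]" and ?P3 = "[{0,1,2}, {0,1,3}, {0,2,3}, {1,2,3::nat}]"
    and ?P1 = "[{0}, {1}, {2}, {3::nat}]" and ?P2 = "[{0,1}, {0,2}, {0,3}, {1,2}, {1,3}, {2,3::nat}]"
  let ?Ps = "?P2 @ ?P3 @ ?P4"
  let ?fs = "map row_nullity ?Ps @ map circuit_nullity (?P3 @ ?P4) @ map parallel_nullity ?P2 @ [uniform_nullity]"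
  have lab: "labels4 0 1 2 3" by (auto simp: labels4_def)
  have Pow4: "Pow {..<4} = set ([{}] @ ?P1 @ ?Ps)"
    unfolding Pow_labels [OF lab] by simp
  have filter: "{P. P \<subseteq> {..<4} \<and> Q (card P)} = set (filter (\<lambda>P. Q (card P)) ([{}] @ ?P1 @ ?Ps))"
    for Q :: "nat \<Rightarrow> bool"
    unfolding set_filter Pow4 [symmetric] by blast
  have "{P. P \<subseteq> {..<4} \<and> 2 \<le> card P} = set ?Ps"
    "{P. P \<subseteq> {..<4} \<and> 3 \<le> card P} = set (?P3 @ ?P4)"
    "{P. P \<subseteq> {..<4} \<and> card P = 2} = set ?P2"
    unfolding filter [of "\<lambda>m. 2 \<le> m"] filter [of "\<lambda>m. 3 \<le> m"] filter [of "\<lambda>m. m = 2"]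
    by (simp_all add: card_insert_if del: set_filter)
  then have "nullity_functions4 = set ?fs"
    unfolding nullity_functions4_def by (simp only: set_append set_map list.set Un_assoc)
  then have eq: "nullity_types4 = set (map set_vec4 ?fs)" unfolding nullity_types4_eq by (simp only: set_map)
  define sig :: "set_vec \<Rightarrow> real list" where "sig v = map v (?P1 @ ?Ps)" for v
  have inj_map: "inj (map real)" by (rule list.inj_map) (simp add: inj_def)
  have "distinct (map (\<lambda>f. map f (?P1 @ ?Ps)) ?fs)" by code_simp
  then have "distinct (map (map real) (map (\<lambda>f. map f (?P1 @ ?Ps)) ?fs))"
    unfolding distinct_map [of "map real"]
    using inj_on_subset [OF inj_map subset_UNIV] by (rule conjI)
  also have "map (map real) (map (\<lambda>f. map f (?P1 @ ?Ps)) ?fs) = map sig (map set_vec4 ?fs)"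
    by (simp add: sig_def set_vec4_def)
  finally have "distinct (map set_vec4 ?fs)" by (rule distinct_map [THEN iffD1, THEN conjunct1])
  then have "card nullity_types4 = length (map set_vec4 ?fs)"
    unfolding eq by (rule distinct_card)
  then show ?thesis by simp
qed

section \<open>From nullity types to boundedness\<close>

lemma subset_sums_labels:
  assumes lab: "labels4 i j k l"
  shows "subset_sums x {i, j, k}
      = x {} + x {i} + x {j} + x {k} + x {i, j} + x {i, k} + x {j, k} + x {i, j, k}"
    and "subset_sums x {..<4} = x {} + x {i} + x {j} + x {k} + x {l}
      + x {i, j} + x {i, k} + x {i, l} + x {j, k} + x {j, l} + x {k, l}
      + x {i, j, k} + x {i, j, l} + x {i, k, l} + x {j, k, l} + x {i, j, k, l}"
  unfolding subset_sums_def using labels4_distinct [OF lab]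
  by (simp_all only: sum_Pow_labels [OF lab]) (simp add: sum_Pow_insert)

text \<open>
  Each of the 23 functionals is the pairing with one nullity type; for example \<open>v {}\<close> belongs to the row
  of ones. The identities hold modulo the vanishing of the subset sums on the five large sets.
\<close>

lemma nullity_facet_values:
  assumes top: "\<forall>Q\<subseteq>{..<4}. 3 \<le> card Q \<longrightarrow> subset_sums x Q = 0" and lab: "labels4 i j k l"
  defines "v \<equiv> subset_sums x"
  shows "set_inner 4 x (set_vec4 (row_nullity {i, j, k, l})) = v {}"
    and "set_inner 4 x (set_vec4 (row_nullity {i, j, k})) = v {l}"
    and "set_inner 4 x (set_vec4 (row_nullity {i, j})) = v {k, l}"
    and "set_inner 4 x (set_vec4 (circuit_nullity {i, j, k})) = v {i, l} + v {j, l} + v {k, l} - v {l}"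
    and "set_inner 4 x (set_vec4 (circuit_nullity {i, j, k, l}))
      = v {i, j} + v {i, k} + v {i, l} + v {j, k} + v {j, l} + v {k, l} + v {} - (v {i} + v {j} + v {k} + v {l})"
    and "set_inner 4 x (set_vec4 (parallel_nullity {i, j})) = v {i, j} + v {k} + v {l} - v {}"
    and "set_inner 4 x (set_vec4 uniform_nullity) = v {i} + v {j} + v {k} + v {l} - 2 * v {}"
proof -
  note ne = labels4_distinct [OF lab] and perm = labels4_all_perms [OF lab]
  have v: "v {} = x {}" "v {i} = x {} + x {i}" "v {j} = x {} + x {j}" "v {k} = x {} + x {k}" "v {l} = x {} + x {l}"
    "v {i, j} = x {} + x {i} + x {j} + x {i, j}" "v {i, k} = x {} + x {i} + x {k} + x {i, k}"
    "v {i, l} = x {} + x {i} + x {l} + x {i, l}" "v {j, k} = x {} + x {j} + x {k} + x {j, k}"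
    "v {j, l} = x {} + x {j} + x {l} + x {j, l}" "v {k, l} = x {} + x {k} + x {l} + x {k, l}"
    unfolding v_def using ne by (simp_all add: subset_sums_def sum_Pow_insert)
  have triple: "x {} + x {a} + x {b} + x {c} + x {a, b} + x {a, c} + x {b, c} + x {a, b, c} = 0"
    if "labels4 a b c d" for a b c d
    using top [rule_format, of "{a, b, c}"] labels4_distinct [OF that] labels4_less [OF that]
      subset_sums_labels(1) [OF that, of x] by simp
  have top0: "x {} + x {i} + x {j} + x {k} + x {l}
      + x {i, j} + x {i, k} + x {i, l} + x {j, k} + x {j, l} + x {k, l}
      + x {i, j, k} + x {i, j, l} + x {i, k, l} + x {j, k, l} + x {i, j, k, l} = 0"
    using top [rule_format, of "{..<4}"] subset_sums_labels(2) [OF lab, of x] by simp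
  note eqs = triple [OF lab] triple [OF perm(1)] triple [OF perm(3)] triple [OF perm(9)] top0
  have inner: "set_inner 4 x (set_vec4 f) = x {} * real (f {}) + x {i} * real (f {i}) + x {j} * real (f {j})
      + x {k} * real (f {k}) + x {l} * real (f {l})
      + x {i, j} * real (f {i, j}) + x {i, k} * real (f {i, k}) + x {i, l} * real (f {i, l})
      + x {j, k} * real (f {j, k}) + x {j, l} * real (f {j, l}) + x {k, l} * real (f {k, l})
      + x {i, j, k} * real (f {i, j, k}) + x {i, j, l} * real (f {i, j, l}) + x {i, k, l} * real (f {i, k, l})
      + x {j, k, l} * real (f {j, k, l}) + x {i, j, k, l} * real (f {i, j, k, l})" for f
    unfolding set_inner_def sum_Pow_labels [OF lab]
    using labels4_less [OF lab] by (simp add: set_vec4_def)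
  note simps = inner v ne row_nullity_def circuit_nullity_def parallel_nullity_def uniform_nullity_def card_insert_if
  show "set_inner 4 x (set_vec4 (row_nullity {i, j, k, l})) = v {}"
    by (simp add: simps) (use eqs in linarith)
  show "set_inner 4 x (set_vec4 (row_nullity {i, j, k})) = v {l}"
    by (simp add: simps) (use eqs in linarith)
  show "set_inner 4 x (set_vec4 (row_nullity {i, j})) = v {k, l}"
    by (simp add: simps) (use eqs in linarith)
  show "set_inner 4 x (set_vec4 (circuit_nullity {i, j, k})) = v {i, l} + v {j, l} + v {k, l} - v {l}"
    by (simp add: simps) (use eqs in linarith)
  show "set_inner 4 x (set_vec4 (circuit_nullity {i, j, k, l}))
      = v {i, j} + v {i, k} + v {i, l} + v {j, k} + v {j, l} + v {k, l} + v {} - (v {i} + v {j} + v {k} + v {l})"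
    by (simp add: simps) (use eqs in linarith)
  show "set_inner 4 x (set_vec4 (parallel_nullity {i, j})) = v {i, j} + v {k} + v {l} - v {}"
    by (simp add: simps) (use eqs in linarith)
  show "set_inner 4 x (set_vec4 uniform_nullity) = v {i} + v {j} + v {k} + v {l} - 2 * v {}"
    by (simp add: simps) (use eqs in linarith)
qed

text \<open>
  The identities of \<open>nullity_facet_values\<close>, for enough namings of the indices to reach all 23
  functionals.
\<close>

lemma facets_nonneg_if_nullities:
  assumes top: "\<forall>Q\<subseteq>{..<4}. 3 \<le> card Q \<longrightarrow> subset_sums x Q = 0"
    and nul: "\<And>f. f \<in> nullity_functions4 \<Longrightarrow> set_inner 4 x (set_vec4 f) \<ge> 0"
  shows "\<forall>\<phi>\<in>facets. \<phi> (subset_sums x) \<ge> 0"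
proof -
  let ?v = "subset_sums x"
  obtain i j k l where lab: "labels4 i j k l" using labels4_exist by blast
  note perm = labels4_all_perms [OF lab]
  have F: "0 \<le> ?v {}" "0 \<le> ?v {d}" "0 \<le> ?v {c, d}"
    "0 \<le> ?v {a, d} + ?v {b, d} + ?v {c, d} - ?v {d}"
    "0 \<le> ?v {a, b} + ?v {a, c} + ?v {a, d} + ?v {b, c} + ?v {b, d} + ?v {c, d} + ?v {}
      - (?v {a} + ?v {b} + ?v {c} + ?v {d})"
    "0 \<le> ?v {a, b} + ?v {c} + ?v {d} - ?v {}" "0 \<le> ?v {a} + ?v {b} + ?v {c} + ?v {d} - 2 * ?v {}"
    if abcd: "labels4 a b c d" for a b c d
  proof -
    note ne = labels4_distinct [OF abcd] and lt = labels4_less [OF abcd]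
    have mem: "row_nullity {a, b, c, d} \<in> nullity_functions4" "row_nullity {a, b, c} \<in> nullity_functions4"
      "row_nullity {a, b} \<in> nullity_functions4" "circuit_nullity {a, b, c} \<in> nullity_functions4"
      "circuit_nullity {a, b, c, d} \<in> nullity_functions4" "parallel_nullity {a, b} \<in> nullity_functions4"
      "uniform_nullity \<in> nullity_functions4"
      unfolding nullity_functions4_def by (simp_all add: ne lt card_insert_if)
    note nul' = mem [THEN nul, unfolded nullity_facet_values [OF top abcd]]
    show "0 \<le> ?v {}" "0 \<le> ?v {d}" "0 \<le> ?v {c, d}"
      "0 \<le> ?v {a, d} + ?v {b, d} + ?v {c, d} - ?v {d}"
      "0 \<le> ?v {a, b} + ?v {a, c} + ?v {a, d} + ?v {b, c} + ?v {b, d} + ?v {c, d} + ?v {}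
        - (?v {a} + ?v {b} + ?v {c} + ?v {d})"
      "0 \<le> ?v {a, b} + ?v {c} + ?v {d} - ?v {}" "0 \<le> ?v {a} + ?v {b} + ?v {c} + ?v {d} - 2 * ?v {}"
      using nul' by simp_all
  qed
  note F' = F(1,2,3,4,5,6,7) [OF lab] F(2,4) [OF perm(1)] F(2,4) [OF perm(3)] F(2,4) [OF perm(9)]
    F(3,6) [OF perm(2)] F(3,6) [OF perm(4)] F(3,6) [OF perm(8)] F(3,6) [OF perm(10)] F(3,6) [OF perm(16)]
  have comm: "{j, i} = {i, j}" "{k, i} = {i, k}" "{l, i} = {i, l}" "{k, j} = {j, k}" "{l, j} = {j, l}" "{l, k} = {k, l}"
    by auto
  show ?thesis
    unfolding facets_relation [OF lab, of "\<lambda>a b. 0 \<le> a" ?v ?v]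
    using F' [unfolded comm] by (intro conjI) linarith+
qed

text \<open>
  The entries of the formal logarithm sum to zero, and by homogeneity so do the entries at the sets containing a given
  index; the difference is the sum over the subsets of the complement of that index.
\<close>

lemma homogeneous_subset_sums:
  assumes hom: "r \<in> homogeneous_ratios 4" and Q: "Q \<subseteq> {..<4}" "3 \<le> card Q"
  shows "subset_sums (formal_log 4 r) Q = 0"
proof -
  let ?x = "formal_log 4 r"
  have total: "sum ?x (Pow {..<4}) = 0"
  proof -
    have "sum ?x (Pow {..<4}) = ?x {} + sum ?x (Pow {..<4} - {{}})"
      by (rule sum.remove) auto
    also have "sum ?x (Pow {..<4} - {{}}) = sum (log_entry r) (Pow {..<4} - {{}})"
      by (intro sum.cong) (auto simp: formal_log_def)
    finally show ?thesis by (simp add: formal_log_def)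
  qed
  show ?thesis
  proof (cases "Q = {..<4}")
    case True
    then show ?thesis using total by (simp add: subset_sums_def)
  next
    case False
    have "card Q + card ({..<4} - Q) = 4"
      using card_Un_disjoint [of Q "{..<4} - Q"] Q finite_subset [OF Q(1)] by (simp add: Un_absorb1)
    moreover have "card ({..<4} - Q) \<noteq> 0" using False Q by auto
    ultimately have "card ({..<4} - Q) = 1" using Q by linarith
    then obtain i where i: "{..<4} - Q = {i}" by (auto simp: card_Suc_eq)
    then have "i < 4" by auto
    have "sum ?x (Pow {..<4}) = sum ?x {S \<in> Pow {..<4}. i \<in> S} + sum ?x (Pow Q)"
    proof -
      let ?A = "{S \<in> Pow {..<4}. i \<in> S}"
      have split: "Pow {..<4} = ?A \<union> Pow Q" and disj: "?A \<inter> Pow Q = {}"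
        using i Q by auto
      have "finite ?A" "finite (Pow Q)" using finite_subset [OF Q(1)] by auto
      then have "sum ?x (?A \<union> Pow Q) = sum ?x ?A + sum ?x (Pow Q)"
        using disj by (rule sum.union_disjoint)
      then show ?thesis using split by metis
    qed
    moreover have "sum ?x {S \<in> Pow {..<4}. i \<in> S} = 0"
      using hom \<open>i < 4\<close> by (simp only: homogeneous_iff_degree index_degree_def)
    ultimately show ?thesis using total by (simp add: subset_sums_def)
  qed
qed

lemma nullity_nonneg_imp_bounded:
  assumes hom: "r \<in> homogeneous_ratios 4"
    and nul: "\<forall>\<mu>\<in>nullity_types4. set_inner 4 (formal_log 4 r) \<mu> \<ge> 0"
  shows "r \<in> bounded_ratios 4"
proof -
  let ?x = "formal_log 4 r"
  have r: "r \<in> ratios 4" using hom by (simp add: homogeneous_ratios_def)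
  have top: "\<forall>Q\<subseteq>{..<4}. 3 \<le> card Q \<longrightarrow> subset_sums ?x Q = 0"
    using homogeneous_subset_sums [OF hom] by blast
  have K: "\<forall>\<phi>\<in>facets. \<phi> (subset_sums ?x) \<ge> 0"
    using nul by (intro facets_nonneg_if_nullities top) (auto simp: nullity_types4_eq)
  have "set_inner 4 ?x (log_minor A) \<le> ln 1024 * (\<Sum>Q\<in>low_sets 2. subset_sums ?x Q)"
    if "pos_def 4 A" for A
    using pairing_bounded [OF that K] Mobius_inversion [OF top] by (simp add: set_inner_def)
  then have "bounded_ratio 4 r" using bounded_ratio_iff [OF r] by blast
  then show ?thesis using r by (simp add: bounded_ratios_def)
qed

theorem theorem9:
  shows "bounded_ratios 4 = D_ratios 4
    \<and> card nullity_types4 = 23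
    \<and> (\<forall>r \<in> homogeneous_ratios 4.
           r \<in> bounded_ratios 4 \<longleftrightarrow>
           (\<forall>\<mu> \<in> nullity_types4. set_inner 4 (formal_log 4 r) \<mu> \<ge> 0))"
proof (intro conjI ballI)
  have dims: "\<exists>M. dim_col M = 4 \<and> \<mu> = nullity_type M" if "\<mu> \<in> nullity_types4" for \<mu>
  proof -
    obtain p M where "\<mu> = nullity_type (permute_cols p M)" "M \<in> base_mats4"
      using \<open>\<mu> \<in> nullity_types4\<close> unfolding nullity_types4_def by blast
    moreover from this have "dim_col (permute_cols p M) = 4"
      by (auto simp: permute_cols_def base_mats4_def mat_of_rows_list_def)
    ultimately show ?thesis by blast
  qed
  have D: "\<forall>\<mu>\<in>nullity_types4. set_inner 4 (formal_log 4 r) \<mu> \<ge> 0" if "r \<in> D_ratios 4" for r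
    using that dims unfolding D_ratios_def by fastforce
  show eq: "bounded_ratios 4 = D_ratios 4"
  proof
    show "bounded_ratios 4 \<subseteq> D_ratios 4" by (rule bounded_ratios_subset_D)
    show "D_ratios 4 \<subseteq> bounded_ratios 4"
    proof
      fix r assume r: "r \<in> D_ratios 4"
      then have "r \<in> homogeneous_ratios 4" by (simp add: D_ratios_def)
      then show "r \<in> bounded_ratios 4" using nullity_nonneg_imp_bounded D [OF r] by blast
    qed
  qed
  show "card nullity_types4 = 23" by (rule card_nullity_types4)
  fix r assume "r \<in> homogeneous_ratios 4"
  then show "r \<in> bounded_ratios 4 \<longleftrightarrow>
      (\<forall>\<mu>\<in>nullity_types4. set_inner 4 (formal_log 4 r) \<mu> \<ge> 0)"
    using nullity_nonneg_imp_bounded D eq by blast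
qed

end
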